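(* Let $\mathcal E$ be a uniform toric vector bundle of rank $r$ over a smooth toric variety $Y(\Sigma)$ with $n$ rays, with Khovanskii basis $\mathcal B=\{b_1,\dots,b_m\}\subset E$ witnessing uniformity and diagram $D$ ($d=m-r$). Then the map $\Phi_{\mathcal B}$ has image $\mathcal R(\mathcal E)$ and kernel $\mathcal I_{\mathcal B}=\langle p_1,\dots,p_d\rangle$ if and only if for any nonempty $A\subset\{1,\dots,n\}$ the nonzero entries of the rows of $D$ indexed by $A$ are contained in $r+|A|-2$ columns.
   Context: $\mathbf k$ is algebraically closed, $\Sigma$ a smooth fan with primitive ray generators $\rho_1,\dots,\rho_n$, $\mathcal O_\Sigma$ the semifield of integral piecewise linear functions on $|\Sigma|$ under $\min,+$. A toric vector bundle $\mathcal E$ on $Y(\Sigma)$ with fiber $E$ over the base point of the open orbit corresponds to a valuation $\mathfrak v:\operatorname{Sym}(E)\to\mathcal O_\Sigma$ such that for every $\sigma\in\Sigma$ there is a basis $\mathcal B_\sigma$ of $E$ whose monomials form a vector space basis of $\operatorname{Sym}(E)$ with $\mathfrak v|_\sigma$ of a linear combination equal to the minimum of the values of the monomials occurring, and with $\mathfrak v(b)|_\sigma$ linear and integral for $b\in\mathcal B_\sigma$. $\mathcal B\subset E$ is a Khovanskii basis if for each $\rho\in|\Sigma|$ its classes generate the associated graded algebra of $f\mapsto\mathfrak v(f)(\rho)$. Write $\mathfrak v_i(f)=\mathfrak v(f)(\rho_i)$, $\hat{\mathfrak v}(f)=(\mathfrak v_1(f),\dots,\mathfrak v_n(f))$. $\mathcal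 R(\mathcal E)=\bigoplus_{\mathbf r\in\mathbb Z^n}\{f\in\operatorname{Sym}(E):\mathfrak v_i(f)\ge r_i\ \forall i\}\,t^{\mathbf r}\subset\operatorname{Sym}(E)\otimes\mathbf k[t_1^{\pm1},\dots,t_n^{\pm1}]$ (isomorphic to the Cox ring of $\mathbb P\mathcal E$). $\Phi_{\mathcal B}:\mathbf k[X_1,\dots,X_n,Y_1,\dots,Y_m]\to\operatorname{Sym}(E)\otimes\mathbf k[t^{\pm1}]$ sends $X_i\mapsto t_i^{-1}$, $Y_j\mapsto b_jt^{\hat{\mathfrak v}(b_j)}$; $\mathcal I_{\mathcal B}=\ker\Phi_{\mathcal B}$. The diagram $D$ is the $n\times m$ matrix with entries $\mathfrak v_i(b_j)$; as a standing normalization the minimum entry of each row of $D$ is $0$. Let $L_{\mathcal B}\subset\mathbf k[y_1,\dots,y_m]$ be the linear ideal of relations among the $b_j$, minimally generated by linear forms $\ell_k=\sum_jc_{k,j}y_j$, $1\le k\le d$, with coefficient matrix $M=(c_{k,j})$; let $\alpha_k\in\mathbb Z^n$ be the entrywise minimum of $\hat{\mathfrak v}(b_j)$ over $j$ with $c_{k,j}\neq0$, and $p_k=X^{-\alpha_k}\sum_jc_{k,j}X^{\hat{\mathfrak v}(b_j)}Y_j$. $\mathcal E$ is uniform if a Khovanskii basis $\mathcal B\subset E$ and generators $\ell_k$ can be found such that all minors (of all sizes) of $M$ are nonzero; these are the $\mathcal B$ and $\ell_k$ used here. *)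

theory Defs
  imports
    "HOL-Library.Poly_Mapping"
    "HOL-Library.Extended_Real"
    "HOL-Analysis.Polytope"
    "HOL-Algebra.QuotRing"
    "HOL-Algebra.Generated_Rings"
    "Jordan_Normal_Form.Determinant"
    "Jordan_Normal_Form.DL_Submatrix"
begin

text \<open>All index sets are 0-based: rays, elements of the Khovanskii basis and linear generators are
  indexed by \<open>i < n\<close>, \<open>j < m\<close> and \<open>k < d\<close>.\<close>


section \<open>Smooth fans and integral piecewise linear functions\<close>

definition lattice_basis :: "'v::real_vector set \<Rightarrow> 'v set \<Rightarrow> bool" where
  "lattice_basis N B \<longleftrightarrow> finite B \<and> independent B \<and>
     N = {\<Sum>b\<in>B. of_int (c b) *\<^sub>R b | c :: 'v \<Rightarrow> int. True}"

definition is_lattice :: "'v::real_vector set \<Rightarrow> bool" where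
  "is_lattice N \<longleftrightarrow> (\<exists>B. lattice_basis N B)"

text \<open>The ambient vector space of the fan is \<open>N \<otimes> \<real> = span N\<close>, which may be a proper subspace of
  the whole type (so that rank 0 is allowed). Note that \<open>convex_cone hull {} = {0}\<close>, and that
  \<open>face_of\<close> also counts the empty set as a face.\<close>

definition strongly_convex_rational_cone :: "'v::real_vector set \<Rightarrow> 'v set \<Rightarrow> bool" where
  "strongly_convex_rational_cone N \<sigma> \<longleftrightarrow>
     (\<exists>G. finite G \<and> G \<subseteq> N \<and> \<sigma> = convex_cone hull G) \<and> \<sigma> \<inter> uminus ` \<sigma> = {0}"

definition is_fan :: "'v::real_vector set \<Rightarrow> 'v set set \<Rightarrow> bool" where
  "is_fan N \<Sigma> \<longleftrightarrow> finite \<Sigma> \<and> \<Sigma> \<noteq> {} \<and>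
     (\<forall>\<sigma>\<in>\<Sigma>. strongly_convex_rational_cone N \<sigma>) \<and>
     (\<forall>\<sigma>\<in>\<Sigma>. \<forall>\<tau>. \<tau> face_of \<sigma> \<and> \<tau> \<noteq> {} \<longrightarrow> \<tau> \<in> \<Sigma>) \<and>
     (\<forall>\<sigma>\<in>\<Sigma>. \<forall>\<tau>\<in>\<Sigma>. \<sigma> \<inter> \<tau> face_of \<sigma> \<and> \<sigma> \<inter> \<tau> face_of \<tau>)"

definition smooth_fan :: "'v::real_vector set \<Rightarrow> 'v set set \<Rightarrow> bool" where
  "smooth_fan N \<Sigma> \<longleftrightarrow> is_lattice N \<and> is_fan N \<Sigma> \<and>
     (\<forall>\<sigma>\<in>\<Sigma>. \<exists>B G. lattice_basis N B \<and> G \<subseteq> B \<and> \<sigma> = convex_cone hull G)"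

definition primitive :: "'v::real_vector set \<Rightarrow> 'v \<Rightarrow> bool" where
  "primitive N u \<longleftrightarrow> u \<in> N \<and> u \<noteq> 0 \<and> (\<forall>t. 0 < t \<and> t < 1 \<longrightarrow> t *\<^sub>R u \<notin> N)"

definition ray_generators :: "'v::real_vector set \<Rightarrow> 'v set set \<Rightarrow> 'v set" where
  "ray_generators N \<Sigma> = {u. primitive N u \<and> convex_cone hull {u} \<in> \<Sigma>}"

definition integral_linear_on :: "'v::real_vector set \<Rightarrow> 'v set \<Rightarrow> ('v \<Rightarrow> real) \<Rightarrow> bool" where
  "integral_linear_on N \<sigma> \<phi> \<longleftrightarrow> (\<exists>l. linear l \<and> l ` N \<subseteq> \<int> \<and> (\<forall>u\<in>\<sigma>. \<phi> u = l u))"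

text \<open>The semifield \<open>\<O>\<^sub>\<Sigma>\<close> without its top element. Its elements need not be linear on the cones of
  \<open>\<Sigma>\<close> itself, only on those of some fan with the same support; otherwise they would not be closed
  under minima. Only the values on the support matter.\<close>

definition integral_PL :: "'v::real_vector set \<Rightarrow> 'v set set \<Rightarrow> ('v \<Rightarrow> real) set" where
  "integral_PL N \<Sigma> = {\<phi>. (\<exists>\<Sigma>'. is_fan N \<Sigma>' \<and> \<Union>\<Sigma>' = \<Union>\<Sigma> \<and>
        (\<forall>\<tau>\<in>\<Sigma>'. \<exists>l. linear l \<and> (\<forall>u\<in>\<tau>. \<phi> u = l u))) \<and>
      (\<forall>u\<in>\<Union>\<Sigma> \<inter> N. \<phi> u \<in> \<int>)}"


section \<open>Polynomial rings\<close>

type_synonym ('x, 'k) mpoly = "('x \<Rightarrow>\<^sub>0 nat) \<Rightarrow>\<^sub>0 'k"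

definition pring :: "'x set \<Rightarrow> ('x, 'k::comm_ring_1) mpoly set" where
  "pring V = {f. \<forall>\<alpha>\<in>Poly_Mapping.keys f. Poly_Mapping.keys \<alpha> \<subseteq> V}"

definition pconst :: "'k::comm_ring_1 \<Rightarrow> ('x, 'k) mpoly" where
  "pconst c = Poly_Mapping.single 0 c"

definition pvar :: "'x \<Rightarrow> ('x, 'k::comm_ring_1) mpoly" where
  "pvar x = Poly_Mapping.single (Poly_Mapping.single x 1) 1"

definition monomial_at :: "('x \<Rightarrow> 'a::comm_ring_1) \<Rightarrow> ('x \<Rightarrow>\<^sub>0 nat) \<Rightarrow> 'a" where
  "monomial_at \<theta> \<alpha> = (\<Prod>x\<in>Poly_Mapping.keys \<alpha>. \<theta> x ^ Poly_Mapping.lookup \<alpha> x)"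

text \<open>Substitution \<open>x \<mapsto> \<theta> x\<close> into a polynomial, where \<open>h\<close> is the structure map of the target
  algebra.\<close>

definition poly_subst ::
    "('k::comm_ring_1 \<Rightarrow> 'a::comm_ring_1) \<Rightarrow> ('x \<Rightarrow> 'a) \<Rightarrow> ('x, 'k) mpoly \<Rightarrow> 'a" where
  "poly_subst h \<theta> f =
     (\<Sum>\<alpha>\<in>Poly_Mapping.keys f. h (Poly_Mapping.lookup f \<alpha>) * monomial_at \<theta> \<alpha>)"

definition pscale :: "'k::field \<Rightarrow> ('a \<Rightarrow>\<^sub>0 'k) \<Rightarrow> 'a \<Rightarrow>\<^sub>0 'k" where
  "pscale c f = Poly_Mapping.map ((*) c) f"

lemma lookup_pscale: "Poly_Mapping.lookup (pscale c f) x = c * Poly_Mapping.lookup f x"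
  by (simp add: pscale_def Poly_Mapping.map.rep_eq when_def)

interpretation pm: vector_space pscale
  by unfold_locales
    (auto intro!: poly_mapping_eqI simp: lookup_pscale lookup_add algebra_simps)

text \<open>A subset of a commutative ring given as a type, regarded as a structure of HOL-Algebra.\<close>

definition ring_on :: "'a::comm_ring_1 set \<Rightarrow> 'a ring" where
  "ring_on S = \<lparr>carrier = S, monoid.mult = (*), one = 1, zero = 0, add = (+)\<rparr>"


section \<open>Toric vector bundles\<close>

text \<open>The fiber \<open>E\<close> of rank \<open>r\<close> is identified with its coordinate space: \<open>Sym(E)\<close> is the polynomial ring
  in \<open>r\<close> variables and \<open>E\<close> its space of linear forms.\<close>

abbreviation Sym :: "nat \<Rightarrow> (nat, 'k::comm_ring_1) mpoly set" where
  "Sym r \<equiv> pring {..<r}"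

definition fiber :: "nat \<Rightarrow> (nat, 'k::field) mpoly set" where
  "fiber r = pm.span (pvar ` {..<r})"

text \<open>The value \<open>\<infinity>\<close> of \<open>ereal\<close> stands for the top element of \<open>\<O>\<^sub>\<Sigma>\<close>, the value of \<open>0\<close>.\<close>

definition PL_valuation ::
    "'v::real_vector set \<Rightarrow> 'v set set \<Rightarrow> nat \<Rightarrow> ((nat, 'k::field) mpoly \<Rightarrow> 'v \<Rightarrow> ereal) \<Rightarrow> bool" where
  "PL_valuation N \<Sigma> r v \<longleftrightarrow>
     (\<forall>u\<in>\<Union>\<Sigma>. v 0 u = \<infinity>) \<and>
     (\<forall>f\<in>Sym r. f \<noteq> 0 \<longrightarrow> (\<exists>\<phi>\<in>integral_PL N \<Sigma>. \<forall>u\<in>\<Union>\<Sigma>. v f u = ereal (\<phi> u))) \<and>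
     (\<forall>f\<in>Sym r. \<forall>g\<in>Sym r. \<forall>u\<in>\<Union>\<Sigma>. v (f * g) u = v f u + v g u) \<and>
     (\<forall>f\<in>Sym r. \<forall>g\<in>Sym r. \<forall>u\<in>\<Union>\<Sigma>. min (v f u) (v g u) \<le> v (f + g) u) \<and>
     (\<forall>c. \<forall>f\<in>Sym r. \<forall>u\<in>\<Union>\<Sigma>. c \<noteq> 0 \<longrightarrow> v (pscale c f) u = v f u)"

definition adapted_basis ::
    "'v::real_vector set \<Rightarrow> nat \<Rightarrow> ((nat, 'k::field) mpoly \<Rightarrow> 'v \<Rightarrow> ereal) \<Rightarrow> 'v set \<Rightarrow>
      (nat \<Rightarrow> (nat, 'k) mpoly) \<Rightarrow> bool" where
  "adapted_basis N r v \<sigma> \<beta> \<longleftrightarrow>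
     inj_on \<beta> {..<r} \<and> pm.independent (\<beta> ` {..<r}) \<and> pm.span (\<beta> ` {..<r}) = fiber r \<and>
     \<comment> \<open>every element of \<open>Sym(E)\<close> is a unique linear combination of monomials in the basis\<close>
     bij_betw (poly_subst pconst \<beta>) (pring {..<r}) (Sym r) \<and>
     (\<forall>g\<in>pring {..<r}. g \<noteq> 0 \<longrightarrow> (\<forall>u\<in>\<sigma>.
        v (poly_subst pconst \<beta> g) u = Min ((\<lambda>\<alpha>. v (monomial_at \<beta> \<alpha>) u) ` Poly_Mapping.keys g))) \<and>
     (\<forall>i<r. \<exists>\<phi>. integral_linear_on N \<sigma> \<phi> \<and> (\<forall>u\<in>\<sigma>. v (\<beta> i) u = ereal (\<phi> u)))"

definition toric_vector_bundle ::
    "'v::real_vector set \<Rightarrow> 'v set set \<Rightarrow> nat \<Rightarrow> ((nat, 'k::field) mpoly \<Rightarrow> 'v \<Rightarrow> ereal) \<Rightarrow> bool" where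
  "toric_vector_bundle N \<Sigma> r v \<longleftrightarrow>
     PL_valuation N \<Sigma> r v \<and> (\<forall>\<sigma>\<in>\<Sigma>. \<exists>\<beta>. adapted_basis N r v \<sigma> \<beta>)"


section \<open>Associated graded algebras and Khovanskii bases\<close>

text \<open>For \<open>w\<close> a valuation on a subring \<open>S\<close> with filtration \<open>F\<^sub>a = {f \<in> S. w f \<ge> a}\<close>, the direct sums
  of all \<open>F\<^sub>a\<close> and of all \<open>F\<^sub>>\<^sub>a = {f \<in> S. w f > a}\<close>, as a subring of the group algebra \<open>S[\<real>]\<close> and an ideal of
  it; the associated graded algebra is the quotient.\<close>

definition filt_sum :: "'a::comm_ring_1 set \<Rightarrow> ('a \<Rightarrow> ereal) \<Rightarrow> (real \<Rightarrow>\<^sub>0 'a) set" where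
  "filt_sum S w = {F. \<forall>a. Poly_Mapping.lookup F a \<in> S \<and> ereal a \<le> w (Poly_Mapping.lookup F a)}"

definition filt_sum_strict :: "'a::comm_ring_1 set \<Rightarrow> ('a \<Rightarrow> ereal) \<Rightarrow> (real \<Rightarrow>\<^sub>0 'a) set" where
  "filt_sum_strict S w =
     {F. \<forall>a. Poly_Mapping.lookup F a \<in> S \<and> ereal a < w (Poly_Mapping.lookup F a)}"

definition assoc_graded :: "'a::comm_ring_1 set \<Rightarrow> ('a \<Rightarrow> ereal) \<Rightarrow> (real \<Rightarrow>\<^sub>0 'a) set ring" where
  "assoc_graded S w = ring_on (filt_sum S w) Quot filt_sum_strict S w"

definition graded_class :: "'a::comm_ring_1 set \<Rightarrow> ('a \<Rightarrow> ereal) \<Rightarrow> 'a \<Rightarrow> (real \<Rightarrow>\<^sub>0 'a) set" where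
  "graded_class S w f = filt_sum_strict S w +>\<^bsub>ring_on (filt_sum S w)\<^esub>
     Poly_Mapping.single (real_of_ereal (w f)) f"

text \<open>The \<open>\<k>\<close>-subalgebra generated by a set is the subring generated by it and the constants.\<close>

definition khovanskii_basis ::
    "'v set set \<Rightarrow> nat \<Rightarrow> ((nat, 'k::field) mpoly \<Rightarrow> 'v \<Rightarrow> ereal) \<Rightarrow> (nat, 'k) mpoly set \<Rightarrow> bool" where
  "khovanskii_basis \<Sigma> r v \<B> \<longleftrightarrow> \<B> \<subseteq> fiber r - {0} \<and>
     (\<forall>u\<in>\<Union>\<Sigma>. let w = (\<lambda>f. v f u) in
        generate_ring (assoc_graded (Sym r) w)
          (graded_class (Sym r) w ` (\<B> \<union> (pconst ` (UNIV - {0}))))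
        = carrier (assoc_graded (Sym r) w))"


section \<open>The ring \<open>\<R>(\<E>)\<close> and its presentation\<close>

type_synonym 'k laurent = "(nat \<Rightarrow>\<^sub>0 int) \<Rightarrow>\<^sub>0 (nat, 'k) mpoly"

definition cox_ring ::
    "nat \<Rightarrow> nat \<Rightarrow> ((nat, 'k::field) mpoly \<Rightarrow> 'v \<Rightarrow> ereal) \<Rightarrow> (nat \<Rightarrow> 'v) \<Rightarrow> 'k laurent set" where
  "cox_ring n r v \<rho> = {F. \<forall>a\<in>Poly_Mapping.keys F. Poly_Mapping.keys a \<subseteq> {..<n} \<and>
     Poly_Mapping.lookup F a \<in> Sym r \<and>
     (\<forall>i<n. ereal (of_int (Poly_Mapping.lookup a i)) \<le> v (Poly_Mapping.lookup F a) (\<rho> i))}"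

text \<open>For a toric vector bundle and \<open>b j \<noteq> 0\<close>, the value \<open>v (b j) (\<rho> i)\<close> is a finite integer, so
  nothing is rounded here.\<close>

definition diagram ::
    "((nat, 'k) mpoly \<Rightarrow> 'v \<Rightarrow> ereal) \<Rightarrow> (nat \<Rightarrow> 'v) \<Rightarrow> (nat \<Rightarrow> (nat, 'k::zero) mpoly) \<Rightarrow>
      nat \<Rightarrow> nat \<Rightarrow> int" where
  "diagram v \<rho> b i j = \<lfloor>real_of_ereal (v (b j) (\<rho> i))\<rfloor>"

text \<open>\<open>\<k>[X,Y]\<close> has the variables \<open>X\<^sub>i = Inl i\<close> and \<open>Y\<^sub>j = Inr j\<close>.\<close>

definition XY :: "nat \<Rightarrow> nat \<Rightarrow> (nat + nat) set" where
  "XY n m = Inl ` {..<n} \<union> Inr ` {..<m}"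

definition Phi ::
    "nat \<Rightarrow> (nat \<Rightarrow> nat \<Rightarrow> int) \<Rightarrow> (nat \<Rightarrow> (nat, 'k::field) mpoly) \<Rightarrow>
      (nat + nat, 'k) mpoly \<Rightarrow> 'k laurent" where
  "Phi n D b = poly_subst (\<lambda>c. Poly_Mapping.single 0 (pconst c))
     (case_sum
       (\<lambda>i. Poly_Mapping.single (Poly_Mapping.single i (-1)) 1)
       (\<lambda>j. Poly_Mapping.single (\<Sum>i<n. Poly_Mapping.single i (D i j)) (b j)))"

definition linear_form :: "nat \<Rightarrow> (nat \<Rightarrow> 'k::field) \<Rightarrow> (nat, 'k) mpoly" where
  "linear_form m c = (\<Sum>j<m. pscale (c j) (pvar j))"

definition relation_ideal :: "nat \<Rightarrow> (nat \<Rightarrow> (nat, 'k::field) mpoly) \<Rightarrow> (nat, 'k) mpoly set" where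
  "relation_ideal m b = Idl\<^bsub>ring_on (pring {..<m})\<^esub>
     {linear_form m c | c. (\<Sum>j<m. pscale (c j) (b j)) = 0}"

definition minimally_generates ::
    "('a, 'z) ring_scheme \<Rightarrow> nat \<Rightarrow> (nat \<Rightarrow> 'a) \<Rightarrow> 'a set \<Rightarrow> bool" where
  "minimally_generates R d l I \<longleftrightarrow> Idl\<^bsub>R\<^esub> (l ` {..<d}) = I \<and>
     (\<forall>k<d. Idl\<^bsub>R\<^esub> (l ` ({..<d} - {k})) \<noteq> I)"

definition all_minors_nonzero :: "'k::field mat \<Rightarrow> bool" where
  "all_minors_nonzero M \<longleftrightarrow> (\<forall>I J. I \<subseteq> {..<dim_row M} \<and> J \<subseteq> {..<dim_col M} \<and> card I = card J \<longrightarrow>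
     Determinant.det (submatrix M I J) \<noteq> 0)"

definition uniform_witness ::
    "'v set set \<Rightarrow> nat \<Rightarrow> ((nat, 'k::field) mpoly \<Rightarrow> 'v \<Rightarrow> ereal) \<Rightarrow>
      nat \<Rightarrow> (nat \<Rightarrow> (nat, 'k) mpoly) \<Rightarrow> nat \<Rightarrow> 'k mat \<Rightarrow> bool" where
  "uniform_witness \<Sigma> r v m b d M \<longleftrightarrow>
     inj_on b {..<m} \<and> khovanskii_basis \<Sigma> r v (b ` {..<m}) \<and> M \<in> carrier_mat d m \<and>
     minimally_generates (ring_on (pring {..<m})) d (\<lambda>k. linear_form m (\<lambda>j. M $$ (k, j)))
       (relation_ideal m b) \<and>
     all_minors_nonzero M"

definition row_min :: "(nat \<Rightarrow> nat \<Rightarrow> int) \<Rightarrow> nat \<Rightarrow> 'k::zero mat \<Rightarrow> nat \<Rightarrow> nat \<Rightarrow> int" where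
  "row_min D m M k i = Min {D i j | j. j < m \<and> M $$ (k, j) \<noteq> 0}"

text \<open>The terms with \<open>M $$ (k, j) \<noteq> 0\<close> have exponents \<open>D i j - row_min D m M k i \<ge> 0\<close>; the others vanish.\<close>

definition homogenized_relation ::
    "nat \<Rightarrow> (nat \<Rightarrow> nat \<Rightarrow> int) \<Rightarrow> nat \<Rightarrow> 'k::field mat \<Rightarrow> nat \<Rightarrow> (nat + nat, 'k) mpoly" where
  "homogenized_relation n D m M k =
     (\<Sum>j<m. pscale (M $$ (k, j))
        ((\<Prod>i<n. pvar (Inl i) ^ nat (D i j - row_min D m M k i)) * pvar (Inr j)))"

end

theory Submission
  imports Defs
begin

text \<open>Write \<open>p\<^sub>k\<close> for the homogenized relations and, for a set \<open>A\<close> of rays, \<open>z(A)\<close> for the number of columns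
  of the diagram in which all rows of \<open>A\<close> vanish. As \<open>m = r + d\<close>, the condition on the diagram says
  \<open>z(A) + |A| \<ge> d + 2\<close> for all nonempty \<open>A\<close>.

  The variables \<open>X\<^sub>i\<close> become invertible Laurent monomials. Over the torus the presentation is always
  correct: the kernel of \<open>\<Phi>\<close> is the saturation of \<open>\<langle>p\<^sub>1, \<dots>, p\<^sub>d\<rangle>\<close> by the \<open>X\<^sub>i\<close>, and every element of
  \<open>\<R>(\<E>)\<close> lies in the image after multiplication with a monomial in them. So the question is whether the
  \<open>X\<^sub>i\<close> can be cancelled again. On the locus where \<open>X\<^sub>i = 0\<close> for \<open>i \<in> A\<close> only the \<open>z(A)\<close> variables
  \<open>Y\<^sub>j\<close> of the vanishing columns survive in the \<open>p\<^sub>k\<close>, and since no minor of \<open>M\<close> vanishes, the \<open>p\<^sub>k\<close> cut out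
  codimension \<open>min d z(A)\<close> there. The condition therefore says that each two of the \<open>X\<^sub>i\<close> form a regular
  sequence modulo the \<open>p\<^sub>k\<close>.

  Sufficiency is proved by an elementary induction instead of the theory of Cohen-Macaulay rings. For
  the ideal \<open>I(W, e)\<close> generated by the \<open>X\<^sub>i\<close> with \<open>i \<in> W\<close> and by \<open>e\<close> of the relations,
  \<open>X_nonzerodivisor\<close> states that \<open>X\<^sub>i\<close> with \<open>i \<notin> W\<close> is a nonzerodivisor modulo \<open>I(W, e)\<close> if
  \<open>z(W \<union> A) + |A| > e\<close> for all nonempty \<open>A\<close> disjoint from \<open>W\<close>. By induction, for \<open>k < e\<close> the remaining
  \<open>X\<^sub>l\<close> are nonzerodivisors modulo \<open>I(W \<union> {i}, k)\<close>, so this quotient embeds into its localization. There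
  the \<open>k\<close> relations can be solved for \<open>k\<close> of the \<open>Y\<^sub>j\<close>, so it is a Laurent polynomial ring, in which the
  next relation is not zero. Hence that relation is a nonzerodivisor modulo
  \<open>I(W \<union> {i}, k)\<close>, and \<open>nonzerodivisor_exchange\<close> carries the property of \<open>X\<^sub>i\<close> from \<open>k\<close> to \<open>k + 1\<close> relations.
  The case \<open>W = {}\<close> gives the kernel. For the image, let \<open>X\<^sub>i F = \<Phi> g\<close> with \<open>F \<in> \<R>(\<E>)\<close>. By the
  Khovanskii property a monomial in the variables other than \<open>X\<^sub>i\<close> moves \<open>F\<close> into the image. So the
  product of \<open>g\<close> with this monomial lies in \<open>I({i}, d)\<close>, the monomial cancels by the case \<open>W = {i}\<close>, and \<open>F\<close>
  is in the image.

  For necessity, a singleton \<open>A\<close> satisfies the condition because of the normalization of the diagram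
  (\<open>row_has_many_zeros\<close>). If \<open>A\<close> violates it and contains \<open>i \<noteq> i'\<close>, then the variables \<open>X\<^sub>l\<close> with
  \<open>l \<notin> A\<close>, the \<open>Y\<^sub>j\<close> of the columns not vanishing on \<open>A\<close>, and \<open>X\<^sub>i\<close>, \<open>X\<^sub>i\<^sub>'\<close> are more than \<open>n + r\<close> in number, so their
  images satisfy a nontrivial polynomial relation (\<open>algebraic_dependence\<close>). Dividing it by powers of
  \<open>X\<^sub>i\<close> and \<open>X\<^sub>i\<^sub>'\<close>, which is possible as the image is \<open>\<R>(\<E>)\<close> and the \<open>i\<close>-th condition in \<open>\<R>(\<E>)\<close>
  comes from a valuation, gives an element of \<open>\<langle>X\<^sub>i, p\<^sub>1, \<dots>, p\<^sub>d\<rangle>\<close> with a nonzero part free of \<open>X\<^sub>i\<close> and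
  \<open>X\<^sub>i\<^sub>'\<close>. But all generators of this ideal vanish when the \<open>X\<^sub>l\<close> with \<open>l \<in> A\<close> and the \<open>Y\<^sub>j\<close> of the vanishing columns
  are set to 0, while that part does not change.\<close>

section \<open>Polynomials and substitution\<close>

abbreviation coef :: "('a \<Rightarrow>\<^sub>0 'b::zero) \<Rightarrow> 'a \<Rightarrow> 'b" where "coef \<equiv> Poly_Mapping.lookup"

abbreviation supp :: "('a \<Rightarrow>\<^sub>0 'b::zero) \<Rightarrow> 'a set" where "supp \<equiv> Poly_Mapping.keys"

abbreviation single :: "'a \<Rightarrow> 'b \<Rightarrow> 'a \<Rightarrow>\<^sub>0 'b::zero" where "single \<equiv> Poly_Mapping.single"

lemma pm_sum_single:
  fixes F :: "'i \<Rightarrow>\<^sub>0 'c::comm_monoid_add"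
  shows "F = (\<Sum>a\<in>supp F. single a (coef F a))"
proof (rule poly_mapping_eqI)
  fix a
  have "coef (\<Sum>x\<in>supp F. single x (coef F x)) a
      = (\<Sum>x\<in>supp F. if x = a then coef F x else 0)"
    by (simp add: lookup_sum lookup_single when_def)
  also have "\<dots> = coef F a"
    by (simp add: in_keys_iff)
  finally show "coef F a
      = coef (\<Sum>x\<in>supp F. single x (coef F x)) a"
    by simp
qed

text \<open>The common form of a substitution into polynomials and of the extension of a ring homomorphism
  to Laurent polynomials: \<open>h\<close> acts on the coefficients, \<open>\<mu>\<close> on the exponents.\<close>

definition pm_eval :: "('c::comm_ring_1 \<Rightarrow> 'a::comm_ring_1) \<Rightarrow> ('i \<Rightarrow> 'a) \<Rightarrow> ('i \<Rightarrow>\<^sub>0 'c) \<Rightarrow> 'a" where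
  "pm_eval h \<mu> F = (\<Sum>a\<in>supp F. h (coef F a) * \<mu> a)"

lemma pm_eval_superset:
  assumes "h 0 = 0" "finite S" "supp F \<subseteq> S"
  shows "pm_eval h \<mu> F = (\<Sum>a\<in>S. h (coef F a) * \<mu> a)"
  unfolding pm_eval_def using assms
  by (intro sum.mono_neutral_left) (auto simp: in_keys_iff)

lemma comm_ring_hom_pm_eval:
  fixes \<mu> :: "'i::comm_monoid_add \<Rightarrow> 'a::comm_ring_1"
  assumes h: "comm_ring_hom h" and \<mu>0: "\<mu> 0 = 1" and \<mu>: "\<And>a b. \<mu> (a + b) = \<mu> a * \<mu> b"
  shows "comm_ring_hom (pm_eval h \<mu>)"
proof -
  interpret h: comm_ring_hom h by (rule h)
  have add: "pm_eval h \<mu> (F + G) = pm_eval h \<mu> F + pm_eval h \<mu> G" for F G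
  proof -
    let ?S = "supp F \<union> supp G"
    have "pm_eval h \<mu> (F + G) = (\<Sum>a\<in>?S. h (coef (F + G) a) * \<mu> a)"
      by (rule pm_eval_superset) (auto simp: Poly_Mapping.keys_add)
    also have "\<dots> = (\<Sum>a\<in>?S. h (coef F a) * \<mu> a) + (\<Sum>a\<in>?S. h (coef G a) * \<mu> a)"
      by (simp add: lookup_add h.hom_add algebra_simps sum.distrib)
    also have "\<dots> = pm_eval h \<mu> F + pm_eval h \<mu> G"
      by (simp add: pm_eval_superset[of h ?S])
    finally show ?thesis .
  qed
  have zero: "pm_eval h \<mu> 0 = 0"
    by (simp add: pm_eval_def)
  have sum: "pm_eval h \<mu> (\<Sum>x\<in>S. F x) = (\<Sum>x\<in>S. pm_eval h \<mu> (F x))" for F and S :: "'z set"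
    by (induction S rule: infinite_finite_induct) (auto simp: zero add)
  have single: "pm_eval h \<mu> (single a c) = h c * \<mu> a" for a c
    by (subst pm_eval_superset[of _ "{a}"]) auto
  have mult: "pm_eval h \<mu> (F * G) = pm_eval h \<mu> F * pm_eval h \<mu> G" for F G
  proof -
    have "F * G = (\<Sum>a\<in>supp F. single a (coef F a))
        * (\<Sum>b\<in>supp G. single b (coef G b))"
      using pm_sum_single[of F] pm_sum_single[of G] by simp
    also have "\<dots> = (\<Sum>a\<in>supp F. \<Sum>b\<in>supp G.
        single (a + b) (coef F a * coef G b))"
      by (simp add: sum_product mult_single)
    also have "pm_eval h \<mu> \<dots> = pm_eval h \<mu> F * pm_eval h \<mu> G"
      unfolding pm_eval_def[of _ _ F] pm_eval_def[of _ _ G]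
      by (simp add: sum single sum_product h.hom_mult \<mu> algebra_simps)
    finally show ?thesis .
  qed
  have "pm_eval h \<mu> (single 0 1) = 1"
    unfolding single by (simp add: \<mu>0)
  then have one: "pm_eval h \<mu> 1 = 1"
    by simp
  show ?thesis
    by unfold_locales (auto simp: add mult zero one)
qed

lemma pm_eval_single:
  assumes "h 0 = 0"
  shows "pm_eval h \<mu> (single a c) = h c * \<mu> a"
  using assms by (subst pm_eval_superset[of _ "{a}"]) auto

lemma monomial_at_superset:
  assumes "finite S" "supp \<alpha> \<subseteq> S"
  shows "monomial_at \<theta> \<alpha> = (\<Prod>x\<in>S. \<theta> x ^ coef \<alpha> x)"
  unfolding monomial_at_def using assms
  by (intro prod.mono_neutral_left) (auto simp: in_keys_iff)

lemma monomial_at_zero [simp]: "monomial_at \<theta> 0 = 1"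
  by (simp add: monomial_at_def)

lemma monomial_at_add: "monomial_at \<theta> (\<alpha> + \<beta>) = monomial_at \<theta> \<alpha> * monomial_at \<theta> \<beta>"
proof -
  let ?S = "supp \<alpha> \<union> supp \<beta>"
  have "monomial_at \<theta> (\<alpha> + \<beta>) = (\<Prod>x\<in>?S. \<theta> x ^ coef (\<alpha> + \<beta>) x)"
    by (rule monomial_at_superset) (auto simp: Poly_Mapping.keys_add)
  also have "\<dots> = (\<Prod>x\<in>?S. \<theta> x ^ coef \<alpha> x) * (\<Prod>x\<in>?S. \<theta> x ^ coef \<beta> x)"
    by (simp add: lookup_add power_add prod.distrib)
  also have "\<dots> = monomial_at \<theta> \<alpha> * monomial_at \<theta> \<beta>"
    by (simp add: monomial_at_superset[of ?S])
  finally show ?thesis .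
qed

lemma monomial_at_single: "monomial_at \<theta> (single x k) = \<theta> x ^ k"
  by (subst monomial_at_superset[of "{x}"]) auto

lemma poly_subst_eq_pm_eval: "poly_subst h \<theta> = pm_eval h (monomial_at \<theta>)"
  by (simp add: poly_subst_def pm_eval_def fun_eq_iff)

lemma comm_ring_hom_poly_subst: "comm_ring_hom h \<Longrightarrow> comm_ring_hom (poly_subst h \<theta>)"
  unfolding poly_subst_eq_pm_eval
  by (rule comm_ring_hom_pm_eval) (simp_all add: monomial_at_add)

lemma poly_subst_single: "h 0 = 0 \<Longrightarrow> poly_subst h \<theta> (single \<alpha> c) = h c * monomial_at \<theta> \<alpha>"
  by (simp add: poly_subst_eq_pm_eval pm_eval_single)

lemma poly_subst_pconst: "h 0 = 0 \<Longrightarrow> poly_subst h \<theta> (pconst c) = h c"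
  by (simp add: pconst_def poly_subst_single)

lemma poly_subst_pvar: "h 0 = 0 \<Longrightarrow> h 1 = 1 \<Longrightarrow> poly_subst h \<theta> (pvar x) = \<theta> x"
  by (simp add: pvar_def poly_subst_single monomial_at_single)

lemma comm_ring_hom_pconst: "comm_ring_hom (pconst :: 'k::comm_ring_1 \<Rightarrow> ('x, 'k) mpoly)"
  by unfold_locales (auto simp: pconst_def single_add mult_single)

lemma pconst_0 [simp]: "pconst 0 = 0" and pconst_1 [simp]: "pconst 1 = 1"
  by (auto simp: pconst_def)

lemma pscale_eq: "pscale c f = pconst c * f"
  by (simp add: pscale_def pconst_def mult_map_scale_conv_mult)

lemma poly_mapping_sum_single: "(\<Sum>x\<in>supp \<alpha>. single x (coef \<alpha> x)) = \<alpha>"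
  for \<alpha> :: "'x \<Rightarrow>\<^sub>0 'n::comm_monoid_add"
  using pm_sum_single[of \<alpha>] by simp

lemma pvar_power: "pvar x ^ k = single (single x k) 1"
proof (induction k)
  case (Suc k)
  then show ?case by (simp add: pvar_def mult_single single_add[symmetric])
qed simp

lemma monomial_at_pvar: "monomial_at pvar \<alpha> = (single \<alpha> 1 :: ('x, 'k::comm_ring_1) mpoly)"
proof -
  have "(\<Prod>x\<in>S. single (f x) 1) = (single (\<Sum>x\<in>S. f x) 1 :: ('x, 'k) mpoly)"
    if "finite S" for S and f :: "'x \<Rightarrow> 'x \<Rightarrow>\<^sub>0 nat"
    using that by (induction) (auto simp: mult_single)
  then show ?thesis
    by (simp add: monomial_at_def pvar_power poly_mapping_sum_single)
qed

lemma single_eq_monomial: "single \<alpha> c = pconst c * monomial_at pvar \<alpha>"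
  by (simp add: monomial_at_pvar pconst_def mult_single)

lemma pring_induct [consumes 1, case_names const var add mult]:
  assumes f: "f \<in> pring V"
    and const: "\<And>c. P (pconst c)" and var: "\<And>x. x \<in> V \<Longrightarrow> P (pvar x)"
    and add: "\<And>f g. P f \<Longrightarrow> P g \<Longrightarrow> P (f + g)" and mult: "\<And>f g. P f \<Longrightarrow> P g \<Longrightarrow> P (f * g)"
  shows "P f"
proof -
  have P0: "P 0" "P 1"
    using const[of 0] const[of 1] by simp_all
  have pw: "P f \<Longrightarrow> P (f ^ k)" for f k
    by (induction k) (auto intro: P0 mult)
  have prod: "P (\<Prod>x\<in>S. F x)" if "\<And>x. x \<in> S \<Longrightarrow> P (F x)" for S :: "'a set" and F
    using that by (induction S rule: infinite_finite_induct) (auto intro: P0 mult)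
  have sum: "P (\<Sum>x\<in>S. F x)" if "\<And>x. x \<in> S \<Longrightarrow> P (F x)" for S :: "('a \<Rightarrow>\<^sub>0 nat) set" and F
    using that by (induction S rule: infinite_finite_induct) (auto intro: P0 add)
  have "P (\<Sum>\<alpha>\<in>supp f. single \<alpha> (coef f \<alpha>))"
    unfolding single_eq_monomial monomial_at_def
    using f by (intro sum mult const prod pw var) (auto simp: pring_def)
  then show ?thesis
    using pm_sum_single[of f] by simp
qed

lemma in_pring_UNIV [simp]: "f \<in> pring UNIV"
  by (simp add: pring_def)

lemma pring_0 [simp]: "0 \<in> pring V" and pring_1 [simp]: "1 \<in> pring V"
  and pring_pconst [simp]: "pconst c \<in> pring V"
  by (auto simp: pring_def pconst_def)

lemma pring_pvar [simp]: "pvar x \<in> pring V \<longleftrightarrow> x \<in> V"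
  by (auto simp: pring_def pvar_def)

lemma pring_mono: "V \<subseteq> W \<Longrightarrow> pring V \<subseteq> pring W"
  by (auto simp: pring_def)

lemma pring_add: "f \<in> pring V \<Longrightarrow> g \<in> pring V \<Longrightarrow> f + g \<in> pring V"
  using Poly_Mapping.keys_add[of f g] by (force simp: pring_def)

lemma pring_mult: "f \<in> pring V \<Longrightarrow> g \<in> pring V \<Longrightarrow> f * g \<in> pring V"
  using keys_mult[of f g] Poly_Mapping.keys_add by (force simp: pring_def)

lemma pring_uminus: "f \<in> pring V \<Longrightarrow> - f \<in> pring V"
  by (auto simp: pring_def in_keys_iff)

lemma pring_diff: "f \<in> pring V \<Longrightarrow> g \<in> pring V \<Longrightarrow> f - g \<in> pring V"
  using pring_add[OF _ pring_uminus] by force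

lemma pring_sum: "(\<And>x. x \<in> S \<Longrightarrow> F x \<in> pring V) \<Longrightarrow> (\<Sum>x\<in>S. F x) \<in> pring V"
  by (induction S rule: infinite_finite_induct) (auto intro: pring_add)

lemma pring_prod: "(\<And>x. x \<in> S \<Longrightarrow> F x \<in> pring V) \<Longrightarrow> (\<Prod>x\<in>S. F x) \<in> pring V"
  by (induction S rule: infinite_finite_induct) (auto intro: pring_mult)

lemma pring_power: "f \<in> pring V \<Longrightarrow> f ^ k \<in> pring V"
  by (induction k) (auto intro: pring_mult)

lemma pring_pscale: "f \<in> pring V \<Longrightarrow> pscale c f \<in> pring V"
  by (simp add: pscale_eq pring_mult)

lemmas pring_closed = pring_add pring_mult pring_uminus pring_diff pring_sum pring_prod pring_power
  pring_pscale

lemma poly_subst_cong: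
  assumes "f \<in> pring V" "\<And>x. x \<in> V \<Longrightarrow> \<theta> x = \<theta>' x"
  shows "poly_subst h \<theta> f = poly_subst h \<theta>' f"
proof -
  have "monomial_at \<theta> \<alpha> = monomial_at \<theta>' \<alpha>" if "\<alpha> \<in> supp f" for \<alpha>
    unfolding monomial_at_def using assms that
    by (intro prod.cong) (fastforce simp: pring_def)+
  then show ?thesis
    by (simp add: poly_subst_def)
qed

lemma poly_subst_pring:
  assumes "f \<in> pring V" "\<And>x. x \<in> V \<Longrightarrow> \<theta> x \<in> pring W"
  shows "poly_subst pconst \<theta> f \<in> pring W"
proof -
  have "x \<in> V" if "\<alpha> \<in> supp f" "x \<in> supp \<alpha>" for x \<alpha>
    using assms(1) that by (auto simp: pring_def)
  then show ?thesis
    unfolding poly_subst_def monomial_at_def by (intro pring_closed pring_pconst assms(2))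
qed

lemma poly_subst_pvar_id: "poly_subst pconst pvar f = f"
  using pm_sum_single[of f] by (simp add: poly_subst_def single_eq_monomial)

definition retract :: "'x set \<Rightarrow> ('x, 'k::comm_ring_1) mpoly \<Rightarrow> ('x, 'k) mpoly" where
  "retract V = poly_subst pconst (\<lambda>x. if x \<in> V then pvar x else 0)"

lemma comm_ring_hom_retract: "comm_ring_hom (retract V)"
  unfolding retract_def by (intro comm_ring_hom_poly_subst comm_ring_hom_pconst)

lemma retract_pvar: "retract V (pvar x) = (if x \<in> V then pvar x else 0)"
  by (simp add: retract_def poly_subst_pvar)

lemma retract_id: "f \<in> pring V \<Longrightarrow> retract V f = f"
  using poly_subst_cong[of f V "\<lambda>x. if x \<in> V then pvar x else 0" pvar pconst]
  by (simp add: retract_def poly_subst_pvar_id)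

lemma retract_pring: "retract V f \<in> pring V"
  unfolding retract_def by (rule poly_subst_pring[of _ UNIV]) auto

lemma pring_hom_eqI:
  assumes "comm_ring_hom \<phi>" "comm_ring_hom \<psi>" "f \<in> pring V"
    "\<And>c. \<phi> (pconst c) = \<psi> (pconst c)" "\<And>x. x \<in> V \<Longrightarrow> \<phi> (pvar x) = \<psi> (pvar x)"
  shows "\<phi> f = \<psi> f"
proof -
  interpret \<phi>: comm_ring_hom \<phi> by fact
  interpret \<psi>: comm_ring_hom \<psi> by fact
  show ?thesis
    using \<open>f \<in> pring V\<close>
    by (induction rule: pring_induct) (simp_all add: assms \<phi>.hom_add \<phi>.hom_mult \<psi>.hom_add \<psi>.hom_mult)
qed

section \<open>Linear algebra of generic matrices\<close>

text \<open>Gaussian elimination over arbitrary index sets. It serves the minors of \<open>M\<close> as well as the dimension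
  count for algebraic dependence.\<close>

lemma homogeneous_system_nontrivial:
  fixes A :: "'e \<Rightarrow> 'u \<Rightarrow> 'k::field"
  assumes "finite S" "finite B" "card S < card B"
  shows "\<exists>c. (\<exists>\<mu>\<in>B. c \<mu> \<noteq> 0) \<and> (\<forall>\<nu>\<in>S. (\<Sum>\<mu>\<in>B. c \<mu> * A \<nu> \<mu>) = 0)"
  using assms
proof (induction S arbitrary: A B rule: finite_induct)
  case empty
  then have "B \<noteq> {}" by auto
  then show ?case by (intro exI[of _ "\<lambda>_. 1"]) auto
next
  case (insert \<nu> S)
  show ?case
  proof (cases "\<forall>\<mu>\<in>B. A \<nu> \<mu> = 0")
    case True
    have "card S < card B" using insert.prems insert.hyps by simp
    from insert.IH[OF insert.prems(1) this, of A] obtain c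
      where "\<exists>\<mu>\<in>B. c \<mu> \<noteq> 0" "\<forall>\<nu>\<in>S. (\<Sum>\<mu>\<in>B. c \<mu> * A \<nu> \<mu>) = 0"
      by blast
    then show ?thesis using True by (intro exI[of _ c]) simp
  next
    case False
    then obtain \<mu>0 where \<mu>0: "\<mu>0 \<in> B" "A \<nu> \<mu>0 \<noteq> 0" by auto
    define A' where "A' = (\<lambda>\<nu>' \<mu>. A \<nu>' \<mu> - A \<nu> \<mu> / A \<nu> \<mu>0 * A \<nu>' \<mu>0)"
    have "card S < card (B - {\<mu>0})" "finite (B - {\<mu>0})"
      using insert.prems insert.hyps \<mu>0 by simp_all
    from insert.IH[OF this(2,1), of A'] obtain c where c: "\<exists>\<mu>\<in>B - {\<mu>0}. c \<mu> \<noteq> 0"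
        "\<forall>\<nu>\<in>S. (\<Sum>\<mu>\<in>B - {\<mu>0}. c \<mu> * A' \<nu> \<mu>) = 0"
      by blast
    \<comment> \<open>the equation \<open>\<nu>\<close> determines the value at the eliminated unknown \<open>\<mu>0\<close>\<close>
    define x where "x = - (\<Sum>\<mu>\<in>B - {\<mu>0}. c \<mu> * A \<nu> \<mu>) / A \<nu> \<mu>0"
    define c' where "c' = c(\<mu>0 := x)"
    have split: "(\<Sum>\<mu>\<in>B. c' \<mu> * A \<nu>' \<mu>) = x * A \<nu>' \<mu>0 + (\<Sum>\<mu>\<in>B - {\<mu>0}. c \<mu> * A \<nu>' \<mu>)" for \<nu>'
      unfolding c'_def using \<mu>0 insert.prems by (subst sum.remove[of _ \<mu>0]) (auto intro!: sum.cong)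
    have "(\<Sum>\<mu>\<in>B. c' \<mu> * A \<nu>' \<mu>) = (\<Sum>\<mu>\<in>B - {\<mu>0}. c \<mu> * A' \<nu>' \<mu>)" for \<nu>'
    proof -
      have "(\<Sum>\<mu>\<in>B - {\<mu>0}. c \<mu> * A' \<nu>' \<mu>) = (\<Sum>\<mu>\<in>B - {\<mu>0}. c \<mu> * A \<nu>' \<mu>)
          - (\<Sum>\<mu>\<in>B - {\<mu>0}. c \<mu> * A \<nu> \<mu> * (A \<nu>' \<mu>0 / A \<nu> \<mu>0))"
        unfolding A'_def sum_subtractf[symmetric] by (intro sum.cong) (simp_all add: right_diff_distrib)
      also have "\<dots> = (\<Sum>\<mu>\<in>B. c' \<mu> * A \<nu>' \<mu>)"
        unfolding split x_def sum_distrib_right[symmetric] by simp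
      finally show ?thesis by simp
    qed
    moreover have "(\<Sum>\<mu>\<in>B. c' \<mu> * A \<nu> \<mu>) = 0"
      unfolding split x_def using \<mu>0 by simp
    ultimately show ?thesis
      using c by (intro exI[of _ c'] conjI) (auto simp: c'_def)
  qed
qed

text \<open>Nonvanishing of all minors, stated without determinants.\<close>

definition generic_matrix :: "nat \<Rightarrow> nat \<Rightarrow> (nat \<Rightarrow> nat \<Rightarrow> 'k::field) \<Rightarrow> bool" where
  "generic_matrix d m c \<longleftrightarrow> (\<forall>I J x. I \<subseteq> {..<d} \<and> J \<subseteq> {..<m} \<and> card I = card J \<and>
     (\<forall>j\<in>J. (\<Sum>k\<in>I. x k * c k j) = 0) \<longrightarrow> (\<forall>k\<in>I. x k = 0))"

lemma generic_matrixD: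
  assumes "generic_matrix d m c" "I \<subseteq> {..<d}" "J \<subseteq> {..<m}" "card I \<le> card J"
    "\<And>j. j \<in> J \<Longrightarrow> (\<Sum>k\<in>I. x k * c k j) = 0" "k \<in> I"
  shows "x k = 0"
proof -
  have "finite J" using assms(3) finite_subset by blast
  then obtain J' where "J' \<subseteq> J" "card J' = card I"
    using assms(4) by (metis obtain_subset_with_card_n)
  then have J': "J' \<subseteq> {..<m}" "card I = card J'" "\<forall>j\<in>J'. (\<Sum>k\<in>I. x k * c k j) = 0"
    using assms(3,5) by auto
  have "\<forall>k\<in>I. x k = 0"
    using assms(1)[unfolded generic_matrix_def, THEN spec, THEN spec, THEN spec, of I J' x] assms(2) J'
    by blast
  then show ?thesis
    using assms(6) by blast
qed

lemma generic_matrix_entry: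
  assumes "generic_matrix d m c" "k < d" "j < m"
  shows "c k j \<noteq> 0"
  using generic_matrixD[OF assms(1), of "{k}" "{j}" "\<lambda>_. 1" k] assms(2,3) by auto

text \<open>One equation less than there are unknowns has a nontrivial solution, and genericity keeps it from
  vanishing in the omitted column \<open>j\<close>.\<close>

lemma generic_matrix_dual:
  assumes g: "generic_matrix d m c" and I: "I \<subseteq> {..<d}" and J: "J \<subseteq> {..<m}" "card I = card J" and j: "j \<in> J"
  shows "\<exists>u. \<forall>j'\<in>J. (\<Sum>k\<in>I. u k * c k j') = (if j' = j then 1 else 0)"
proof -
  have fin: "finite I" "finite J"
    using I J finite_subset by blast+
  have "card (J - {j}) < card I"
    using fin j J card_Diff1_less[of J j] by simp
  then obtain x where x: "\<exists>k\<in>I. x k \<noteq> 0" "\<forall>j'\<in>J - {j}. (\<Sum>k\<in>I. x k * c k j') = 0"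
    using homogeneous_system_nontrivial[of "J - {j}" I "\<lambda>j k. c k j"] fin by blast
  define s where "s = (\<Sum>k\<in>I. x k * c k j)"
  have "s \<noteq> 0"
  proof
    assume "s = 0"
    then have "(\<Sum>k\<in>I. x k * c k j') = 0" if "j' \<in> J" for j'
      using x(2) that by (cases "j' = j") (auto simp: s_def)
    with x(1) show False
      using generic_matrixD[OF g I J(1), of x] J(2) by auto
  qed
  then have "\<forall>j'\<in>J. (\<Sum>k\<in>I. (x k / s) * c k j') = (if j' = j then 1 else 0)"
    using x(2) by (auto simp: s_def sum_divide_distrib[symmetric])
  then show ?thesis by (intro exI[of _ "\<lambda>k. x k / s"])
qed

lemma all_minors_nonzero_imp_generic:
  assumes M: "M \<in> carrier_mat d m" and minors: "all_minors_nonzero M"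
  shows "generic_matrix d m (\<lambda>k j. M $$ (k, j))"
  unfolding generic_matrix_def
proof (intro allI impI ballI, elim conjE)
  fix I J x k
  assume I: "I \<subseteq> {..<d}" and J: "J \<subseteq> {..<m}" and card: "card I = card J"
    and sys: "\<forall>j\<in>J. (\<Sum>k\<in>I. x k * M $$ (k, j)) = 0" and k: "k \<in> I"
  define S where "S = submatrix M I J"
  define e where "e = card I"
  have idx: "{i. i < dim_row M \<and> i \<in> I} = I" "{j. j < dim_col M \<and> j \<in> J} = J"
    using I J M by auto
  have S: "S \<in> carrier_mat e e"
    unfolding S_def e_def by (rule carrier_matI) (simp_all add: dim_submatrix idx card)
  have "Determinant.det S \<noteq> 0"
    using minors M I J card unfolding all_minors_nonzero_def S_def by auto
  then have "Determinant.det (transpose_mat S) \<noteq> 0"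
    using S by (simp add: det_transpose)
  then have ker: "w = 0\<^sub>v e" if "w \<in> carrier_vec e" "transpose_mat S *\<^sub>v w = 0\<^sub>v e" for w
    using det_0_iff_vec_prod_zero_field[of "transpose_mat S" e] S that by auto
  have fin: "finite I" "finite J"
    using I J finite_subset by blast+
  have pick: "pick I a \<in> I" "card {a'\<in>I. a' < pick I a} = a" if "a < e" for a
    using that fin pick_in_set_le[of a I] card_pick_le[of a I] by (auto simp: e_def)
  have lt: "card {a\<in>I. a < i} < e" if "i \<in> I" for i
    unfolding e_def using that fin by (intro psubset_card_mono) auto
  define w where "w = vec e (\<lambda>a. x (pick I a))"
  have "transpose_mat S *\<^sub>v w = 0\<^sub>v e"
  proof (rule eq_vecI)
    show "dim_vec (transpose_mat S *\<^sub>v w) = dim_vec (0\<^sub>v e)"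
      using S by simp
    fix b assume "b < dim_vec (0\<^sub>v e :: 'a vec)"
    then have b: "b < e" by simp
    have "Matrix.vec_index (transpose_mat S *\<^sub>v w) b = (\<Sum>a<e. S $$ (a, b) * x (pick I a))"
      using S b by (simp add: w_def scalar_prod_def atLeast0LessThan)
    also have "\<dots> = (\<Sum>a<e. M $$ (pick I a, pick J b) * x (pick I a))"
      using b card by (intro sum.cong) (auto simp: S_def submatrix_index idx e_def)
    also have "\<dots> = (\<Sum>k\<in>I. M $$ (k, pick J b) * x k)"
      using pick lt fin by (intro sum.reindex_bij_witness[where i = "\<lambda>k. card {a\<in>I. a < k}" and j = "pick I"])
        (auto simp: pick_card_in_set)
    also have "\<dots> = 0"
      using sys pick_in_set_le[of b J] b card by (simp add: e_def mult.commute)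
    finally show "Matrix.vec_index (transpose_mat S *\<^sub>v w) b = Matrix.vec_index (0\<^sub>v e) b"
      using b by simp
  qed
  from ker[OF _ this] have "w = 0\<^sub>v e"
    by (simp add: w_def)
  then have "Matrix.vec_index w (card {a\<in>I. a < k}) = 0"
    using lt k by simp
  then show "x k = 0"
    using lt[OF k] k by (simp add: w_def pick_card_in_set)
qed

section \<open>Ideals and nonzerodivisors\<close>

interpretation idl: Modules.module "(*) :: 'a::comm_ring_1 \<Rightarrow> 'a \<Rightarrow> 'a"
  by unfold_locales (simp_all add: algebra_simps)

declare idl.scale_scale [simp del]

text \<open>The half of the permutability of regular sequences that needs neither a grading nor a local ring.\<close>

lemma nonzerodivisor_exchange:
  fixes x p :: "'a::comm_ring_1"
  assumes x: "\<And>f. x * f \<in> idl.span S \<Longrightarrow> f \<in> idl.span S"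
    and p: "\<And>f. p * f \<in> idl.span (insert x S) \<Longrightarrow> f \<in> idl.span (insert x S)"
    and f: "x * f \<in> idl.span (insert p S)"
  shows "f \<in> idl.span (insert p S)"
proof -
  from f obtain k where k: "x * f - k * p \<in> idl.span S"
    unfolding idl.span_insert by blast
  have "x * f - k * p \<in> idl.span (insert x S)"
    using k idl.span_mono[of S "insert x S"] by blast
  moreover have "f * x \<in> idl.span (insert x S)"
    by (intro idl.span_scale idl.span_base) simp
  moreover have "p * k = f * x - (x * f - k * p)"
    by (simp add: algebra_simps)
  ultimately have "p * k \<in> idl.span (insert x S)"
    by (metis idl.span_diff)
  then have "k \<in> idl.span (insert x S)"
    by (rule p)
  then obtain h where h: "k - h * x \<in> idl.span S"
    unfolding idl.span_insert by blast
  have "x * (f - h * p) = (x * f - k * p) + p * (k - h * x)"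
    by (simp add: algebra_simps)
  also have "\<dots> \<in> idl.span S"
    using k h by (intro idl.span_add idl.span_scale)
  finally have "f - h * p \<in> idl.span S"
    by (rule x)
  then show ?thesis
    unfolding idl.span_insert by blast
qed

text \<open>The polynomials \<open>f\<close> with the asserted property form a subring, so the variables suffice. In the
  application \<open>\<mu>\<close> is a monomial in the torus variables, and variables are eliminated after its inversion.\<close>

lemma reduce_to_fewer_variables:
  fixes S :: "('x, 'k::comm_ring_1) mpoly set"
  assumes \<mu>: "\<mu> \<in> pring U" and var: "\<And>x. \<exists>g\<in>pring U. \<mu> * pvar x - g \<in> idl.span S"
  shows "\<exists>N. \<exists>g\<in>pring U. \<mu> ^ N * f - g \<in> idl.span S"
  using in_pring_UNIV[of f]
proof (induction rule: pring_induct)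
  case (const c)
  show ?case
    by (intro exI[of _ 0] bexI[of _ "pconst c"]) (auto intro: idl.span_zero)
next
  case (var x)
  from assms(2)[of x] obtain g where "g \<in> pring U" "\<mu> * pvar x - g \<in> idl.span S" ..
  then show ?case
    by (intro exI[of _ 1] bexI[of _ g]) auto
next
  case (add f f')
  then obtain N g N' g' where *: "g \<in> pring U" "\<mu> ^ N * f - g \<in> idl.span S"
      "g' \<in> pring U" "\<mu> ^ N' * f' - g' \<in> idl.span S" by blast
  have "\<mu> ^ (N + N') * (f + f') - (\<mu> ^ N' * g + \<mu> ^ N * g')
      = \<mu> ^ N' * (\<mu> ^ N * f - g) + \<mu> ^ N * (\<mu> ^ N' * f' - g')"
    by (simp add: algebra_simps power_add)
  also have "\<dots> \<in> idl.span S"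
    using * by (intro idl.span_add idl.span_scale)
  finally have A: "\<mu> ^ (N + N') * (f + f') - (\<mu> ^ N' * g + \<mu> ^ N * g') \<in> idl.span S" .
  have B: "\<mu> ^ N' * g + \<mu> ^ N * g' \<in> pring U"
    by (intro pring_add pring_mult pring_power * \<mu>)
  show ?case
    using A B by (intro exI[of _ "N + N'"] rev_bexI[OF B])
next
  case (mult f f')
  then obtain N g N' g' where *: "g \<in> pring U" "\<mu> ^ N * f - g \<in> idl.span S"
      "g' \<in> pring U" "\<mu> ^ N' * f' - g' \<in> idl.span S" by blast
  have "\<mu> ^ (N + N') * (f * f') - g * g' = (\<mu> ^ N' * f') * (\<mu> ^ N * f - g) + g * (\<mu> ^ N' * f' - g')"
    by (simp add: algebra_simps power_add)
  also have "\<dots> \<in> idl.span S"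
    using * by (intro idl.span_add idl.span_scale)
  finally have A: "\<mu> ^ (N + N') * (f * f') - (g * g') \<in> idl.span S" .
  have B: "g * g' \<in> pring U"
    by (intro pring_add pring_mult pring_power * \<mu>)
  show ?case
    using A B by (intro exI[of _ "N + N'"] rev_bexI[OF B])
qed


section \<open>The homogenized relations of a generic linear system\<close>

definition lconst :: "'k::comm_ring_1 \<Rightarrow> (nat \<Rightarrow>\<^sub>0 int) \<Rightarrow>\<^sub>0 (nat, 'k) mpoly" where
  "lconst c = single 0 (pconst c)"

lemma comm_ring_hom_lconst: "comm_ring_hom (lconst :: 'k::comm_ring_1 \<Rightarrow> _)"
proof -
  interpret pc: comm_ring_hom "pconst :: 'k \<Rightarrow> (nat, 'k) mpoly" by (rule comm_ring_hom_pconst)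
  show ?thesis
    by unfold_locales (auto simp: lconst_def pc.hom_add pc.hom_mult single_add mult_single)
qed

lemma lconst_0 [simp]: "lconst 0 = 0" and lconst_1 [simp]: "lconst 1 = 1"
  by (simp_all add: lconst_def)

definition tdeg :: "nat \<Rightarrow> (nat \<Rightarrow> nat \<Rightarrow> int) \<Rightarrow> nat \<Rightarrow> nat \<Rightarrow>\<^sub>0 int" where
  "tdeg n D j = (\<Sum>i<n. single i (D i j))"

lemma lookup_tdeg: "coef (tdeg n D j) i = (if i < n then D i j else 0)"
  by (auto simp: tdeg_def lookup_sum lookup_single when_def)

text \<open>The substitution that defines the presentation of the Cox ring, restricted to the stratum
  where the coordinates of \<open>W\<close> vanish.\<close>

definition stratum_subst :: "nat \<Rightarrow> (nat \<Rightarrow> nat \<Rightarrow> int) \<Rightarrow> nat set \<Rightarrow> (nat \<Rightarrow> (nat, 'k::field) mpoly) \<Rightarrow>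
    (nat + nat, 'k) mpoly \<Rightarrow> 'k laurent" where
  "stratum_subst n D W b = poly_subst lconst
     (case_sum (\<lambda>i. if i \<in> W then 0 else single (single i (-1)) 1)
       (\<lambda>j. single (tdeg n D j) (b j)))"

lemma Phi_eq_stratum_subst: "Phi n D b = stratum_subst n D {} b"
  by (simp add: Phi_def stratum_subst_def lconst_def[abs_def] tdeg_def)

lemma comm_ring_hom_stratum_subst: "comm_ring_hom (stratum_subst n D W b)"
  unfolding stratum_subst_def by (intro comm_ring_hom_poly_subst comm_ring_hom_lconst)

lemma stratum_subst_pconst [simp]: "stratum_subst n D W b (pconst c) = lconst c"
  by (simp add: stratum_subst_def poly_subst_pconst)

lemma stratum_subst_Inl: "stratum_subst n D W b (pvar (Inl i))
    = (if i \<in> W then 0 else single (single i (-1)) 1)"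
  by (simp add: stratum_subst_def poly_subst_pvar)

lemma stratum_subst_Inr: "stratum_subst n D W b (pvar (Inr j)) = single (tdeg n D j) (b j)"
  by (simp add: stratum_subst_def poly_subst_pvar)

lemma power_single: "single a c ^ k = single (\<Sum>_<k. a) (c ^ k)"
  for c :: "'c::comm_ring_1" and a :: "'i::comm_monoid_add"
  by (induction k) (simp_all add: mult_single add.commute)

lemma prod_single: "(\<Prod>x\<in>S. single (a x) (c x)) = single (\<Sum>x\<in>S. a x) (\<Prod>x\<in>S. c x)"
  for c :: "'s \<Rightarrow> 'c::comm_ring_1" and a :: "'s \<Rightarrow> 'i::comm_monoid_add"
  by (induction S rule: infinite_finite_induct) (simp_all add: mult_single)

text \<open>Distinct monomials in the variables of \<open>U\<close> go to distinct monomials: the exponents of the \<open>Y j\<close> can be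
  read off from the polynomial part, and then those of the \<open>X i\<close> from the torus part.\<close>

lemma stratum_subst_inj:
  assumes g: "g \<in> pring U" and U: "U \<inter> Inl ` W = {}" "\<And>j. Inr j \<in> U \<Longrightarrow> b j = pvar j"
    and 0: "stratum_subst n D W b g = 0"
  shows "g = 0"
proof (rule ccontr)
  assume "g \<noteq> 0"
  then obtain \<beta> where \<beta>: "\<beta> \<in> supp g"
    by (metis keys_eq_empty ex_in_conv)
  define e :: "nat + nat \<Rightarrow> nat \<Rightarrow>\<^sub>0 int" where
    "e = case_sum (\<lambda>i. single i (-1)) (tdeg n D)"
  define q :: "nat + nat \<Rightarrow> nat \<Rightarrow>\<^sub>0 nat" where
    "q = case_sum (\<lambda>_. 0) (\<lambda>j. single j 1)"
  define \<epsilon> where "\<epsilon> \<alpha> = (\<Sum>x\<in>supp \<alpha>. \<Sum>_<coef \<alpha> x. e x)" for \<alpha> :: "nat + nat \<Rightarrow>\<^sub>0 nat"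
  define \<gamma> where "\<gamma> \<alpha> = (\<Sum>x\<in>supp \<alpha>. \<Sum>_<coef \<alpha> x. q x)" for \<alpha> :: "nat + nat \<Rightarrow>\<^sub>0 nat"
  define \<theta> where "\<theta> = case_sum (\<lambda>i. if i \<in> W then 0 else single (single i (-1)) 1)
       (\<lambda>j. single (tdeg n D j) (b j))"
  have \<theta>: "\<theta> x = single (e x) (single (q x) 1)" if "x \<in> U" for x
    using that U by (cases x) (auto simp: \<theta>_def e_def q_def pvar_def)
  have mono: "monomial_at \<theta> \<alpha> = single (\<epsilon> \<alpha>) (single (\<gamma> \<alpha>) 1)"
    if "supp \<alpha> \<subseteq> U" for \<alpha>
  proof -
    have "monomial_at \<theta> \<alpha> = (\<Prod>x\<in>supp \<alpha>.
        single (e x) (single (q x) 1) ^ coef \<alpha> x)"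
      unfolding monomial_at_def using that by (intro prod.cong refl) (metis \<theta> subset_iff)
    then show ?thesis
      by (simp add: power_single prod_single \<epsilon>_def \<gamma>_def)
  qed
  have lookup_sup: "(\<Sum>x\<in>supp \<alpha>. F (coef \<alpha> x) x) = (\<Sum>x\<in>S. F (coef \<alpha> x) x)"
    if "finite S" "supp \<alpha> \<subseteq> S" "\<And>x. F 0 x = 0"
    for \<alpha> :: "nat + nat \<Rightarrow>\<^sub>0 nat" and S and F :: "nat \<Rightarrow> nat + nat \<Rightarrow> 'z::comm_monoid_add"
    using that by (intro sum.mono_neutral_left) (auto simp: in_keys_iff)
  have \<gamma>: "coef (\<gamma> \<alpha>) j = coef \<alpha> (Inr j)" for \<alpha> j
  proof -
    have "coef (\<gamma> \<alpha>) j = (\<Sum>x\<in>supp \<alpha>. coef \<alpha> x * coef (q x) j)"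
      unfolding \<gamma>_def lookup_sum by simp
    also have "\<dots> = (\<Sum>x\<in>insert (Inr j) (supp \<alpha>). coef \<alpha> x * coef (q x) j)"
      by (rule lookup_sup) auto
    also have "\<dots> = (\<Sum>x\<in>insert (Inr j) (supp \<alpha>). if x = Inr j then coef \<alpha> x else 0)"
      by (intro sum.cong refl) (auto simp: q_def lookup_single when_def split: sum.splits)
    also have "\<dots> = coef \<alpha> (Inr j)"
      by (subst sum.delta) auto
    finally show ?thesis .
  qed
  have inj: "\<alpha> = \<beta>" if "\<epsilon> \<alpha> = \<epsilon> \<beta>" "\<gamma> \<alpha> = \<gamma> \<beta>" for \<alpha>
  proof (rule poly_mapping_eqI)
    have R: "coef \<alpha> (Inr j) = coef \<beta> (Inr j)" for j
      using \<gamma>[of \<alpha> j] \<gamma>[of \<beta> j] that(2) by simp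
    have L: "coef \<alpha> (Inl i) = coef \<beta> (Inl i)" for i
    proof -
      define S where "S = insert (Inl i) (supp \<alpha> \<union> supp \<beta>)"
      have eps: "coef (\<epsilon> \<delta>) i = (\<Sum>x\<in>S. int (coef \<delta> x) * coef (e x) i)"
        if "supp \<delta> \<subseteq> S" for \<delta>
      proof -
        have "coef (\<epsilon> \<delta>) i
            = (\<Sum>x\<in>supp \<delta>. int (coef \<delta> x) * coef (e x) i)"
          unfolding \<epsilon>_def lookup_sum by simp
        also have "\<dots> = (\<Sum>x\<in>S. int (coef \<delta> x) * coef (e x) i)"
          by (rule lookup_sup) (use that in \<open>auto simp: S_def\<close>)
        finally show ?thesis .
      qed
      have "0 = (\<Sum>x\<in>S. (int (coef \<alpha> x) - int (coef \<beta> x)) * coef (e x) i)"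
        using eps[of \<alpha>] eps[of \<beta>] that(1)
        by (simp add: S_def left_diff_distrib sum_subtractf subset_insertI2)
      also have "\<dots> = (\<Sum>x\<in>S. if x = Inl i then int (coef \<beta> x) - int (coef \<alpha> x) else 0)"
        by (intro sum.cong refl) (auto simp: e_def lookup_single when_def R split: sum.splits)
      also have "\<dots> = int (coef \<beta> (Inl i)) - int (coef \<alpha> (Inl i))"
        by (subst sum.delta) (auto simp: S_def)
      finally show ?thesis by simp
    qed
    show "coef \<alpha> x = coef \<beta> x" for x
      by (cases x) (simp_all add: L R)
  qed
  have "stratum_subst n D W b g = (\<Sum>\<alpha>\<in>supp g.
      single (\<epsilon> \<alpha>) (single (\<gamma> \<alpha>) (coef g \<alpha>)))"
    unfolding stratum_subst_def poly_subst_def \<theta>_def[symmetric]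
    using g mono by (intro sum.cong refl) (auto simp: pring_def lconst_def pconst_def mult_single)
  then have "0 = (\<Sum>\<alpha>\<in>supp g. coef (coef
      (single (\<epsilon> \<alpha>) (single (\<gamma> \<alpha>) (coef g \<alpha>))) (\<epsilon> \<beta>)) (\<gamma> \<beta>))"
    unfolding lookup_sum[symmetric] using 0 by simp
  also have "\<dots> = (\<Sum>\<alpha>\<in>supp g. if \<alpha> = \<beta> then coef g \<alpha> else 0)"
    by (intro sum.cong refl) (auto simp: lookup_single when_def dest: inj)
  also have "\<dots> = coef g \<beta>"
    using \<beta> by (subst sum.delta) auto
  finally show False
    using \<beta> by (simp add: in_keys_iff)
qed

lemma lookup_linear_comb:
  assumes "finite S"
  shows "coef (\<Sum>j\<in>S. pconst (a j) * pvar j) (single i 1) = (if i \<in> S then a i else 0)"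
proof -
  have "coef (\<Sum>j\<in>S. pconst (a j) * pvar j) (single i 1)
      = (\<Sum>j\<in>S. if j = i then a j else 0)"
    unfolding lookup_sum
  proof (intro sum.cong refl)
    fix j
    have "single j (1::nat) = single i 1 \<longleftrightarrow> j = i"
      by (metis keys_single one_neq_zero singleton_inject)
    then show "coef (pconst (a j) * pvar j) (single i 1) = (if j = i then a j else 0)"
      by (auto simp: pconst_def pvar_def mult_single lookup_single when_def)
  qed
  then show ?thesis
    using assms by (simp add: sum.delta')
qed

lemma sum_single_eq: "(\<Sum>x\<in>S. single a (f x)) = single a (\<Sum>x\<in>S. f x)"
  by (induction S rule: infinite_finite_induct) (simp_all add: single_add)

lemma single_eq_0_iff [simp]: "single a c = 0 \<longleftrightarrow> c = 0"
  by (metis lookup_single_eq lookup_zero single_zero)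

text \<open>The relations \<open>rel k\<close> are the homogenized ones in case all row minima are 0. For a set \<open>W\<close> of rays,
  \<open>zcols W\<close> are the columns whose variables survive in them when the \<open>X i\<close> with \<open>i \<in> W\<close> are set to 0.\<close>

locale generic_relations =
  fixes n m d :: nat and D :: "nat \<Rightarrow> nat \<Rightarrow> int" and c :: "nat \<Rightarrow> nat \<Rightarrow> 'k::field"
  assumes D_nonneg: "\<And>i j. i < n \<Longrightarrow> j < m \<Longrightarrow> 0 \<le> D i j"
    and generic: "generic_matrix d m c"
begin

abbreviation X :: "nat \<Rightarrow> (nat + nat, 'k) mpoly" where "X i \<equiv> pvar (Inl i)"

abbreviation Y :: "nat \<Rightarrow> (nat + nat, 'k) mpoly" where "Y j \<equiv> pvar (Inr j)"

definition colmon :: "nat \<Rightarrow> (nat + nat, 'k) mpoly" where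
  "colmon j = (\<Prod>i<n. X i ^ nat (D i j))"

definition rel :: "nat \<Rightarrow> (nat + nat, 'k) mpoly" where
  "rel k = (\<Sum>j<m. pconst (c k j) * (colmon j * Y j))"

definition zcols :: "nat set \<Rightarrow> nat set" where
  "zcols W = {j. j < m \<and> (\<forall>i\<in>W. D i j = 0)}"

abbreviation stratum_gens :: "nat set \<Rightarrow> nat \<Rightarrow> (nat + nat, 'k) mpoly set" where
  "stratum_gens W e \<equiv> X ` W \<union> rel ` {..<e}"

abbreviation stratum_ideal :: "nat set \<Rightarrow> nat \<Rightarrow> (nat + nat, 'k) mpoly set" where
  "stratum_ideal W e \<equiv> idl.span (stratum_gens W e)"

lemma zcols_bound: "zcols W \<subseteq> {..<m}" and finite_zcols [simp]: "finite (zcols W)"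
  by (auto simp: zcols_def)

lemma colmon_outside:
  assumes "W \<subseteq> {..<n}" "j \<in> zcols W"
  shows "colmon j = (\<Prod>i\<in>{..<n} - W. X i ^ nat (D i j))"
  unfolding colmon_def using assms
  by (intro prod.mono_neutral_right) (auto simp: zcols_def)

lemma colmon_in_ideal:
  assumes "W \<subseteq> {..<n}" "j < m" "j \<notin> zcols W"
  shows "colmon j * f \<in> idl.span (X ` W)"
proof -
  obtain i where i: "i \<in> W" "D i j \<noteq> 0" using assms by (auto simp: zcols_def)
  then have "i < n" "0 < D i j" using assms D_nonneg[of i j] by force+
  then obtain l where l: "nat (D i j) = Suc l" by (metis gr0_implies_Suc zero_less_nat_eq)
  have "colmon j = X i ^ nat (D i j) * (\<Prod>i\<in>{..<n} - {i}. X i ^ nat (D i j))"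
    unfolding colmon_def using \<open>i < n\<close> by (subst prod.remove[of _ i]) auto
  then have "colmon j * f = (X i ^ l * (\<Prod>i\<in>{..<n} - {i}. X i ^ nat (D i j)) * f) * X i"
    by (simp add: l)
  also have "\<dots> \<in> idl.span (X ` W)"
    using i by (intro idl.span_scale idl.span_base) auto
  finally show ?thesis .
qed

lemma stratum_subst_vanishes_X:
  "f \<in> idl.span (X ` W) \<Longrightarrow> stratum_subst n D W b f = 0"
proof -
  interpret \<tau>: comm_ring_hom "stratum_subst n D W b" by (rule comm_ring_hom_stratum_subst)
  show "stratum_subst n D W b f = 0" if "f \<in> idl.span (X ` W)"
    using that by (induction rule: idl.span_induct_alt)
      (auto simp: \<tau>.hom_add \<tau>.hom_mult stratum_subst_Inl)
qed

lemma stratum_subst_colmon: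
  assumes W: "W \<subseteq> {..<n}" and j: "j < m"
  shows "stratum_subst n D W b (colmon j * Y j) = (if j \<in> zcols W then single 0 (b j) else 0)"
proof (cases "j \<in> zcols W")
  case False
  then show ?thesis
    using colmon_in_ideal[OF W j] stratum_subst_vanishes_X by auto
next
  case True
  interpret \<tau>: comm_ring_hom "stratum_subst n D W b" by (rule comm_ring_hom_stratum_subst)
  let ?t = "\<lambda>i. single (single i (-1::int)) (1::(nat, 'k) mpoly)"
  have "stratum_subst n D W b (colmon j) = (\<Prod>i\<in>{..<n} - W. ?t i ^ nat (D i j))"
    unfolding colmon_outside[OF W True]
    by (auto simp: \<tau>.hom_prod \<tau>.hom_power stratum_subst_Inl intro!: prod.cong)
  also have "\<dots> = (\<Prod>i<n. ?t i ^ nat (D i j))"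
    using True by (intro prod.mono_neutral_left) (auto simp: zcols_def)
  also have "\<dots> = single (\<Sum>i<n. \<Sum>_<nat (D i j). single i (-1::int)) 1"
    by (simp only: power_single prod_single power_one prod.neutral_const)
  also have "(\<Sum>i<n. \<Sum>_<nat (D i j). single i (-1::int)) = - tdeg n D j"
  proof (rule poly_mapping_eqI)
    fix l
    have "coef (\<Sum>i<n. \<Sum>_<nat (D i j). single i (-1::int)) l
        = (\<Sum>i<n. if i = l then - int (nat (D i j)) else 0)"
      unfolding lookup_sum by (intro sum.cong) (auto simp: lookup_single when_def)
    also have "\<dots> = coef (- tdeg n D j) l"
      using j D_nonneg[of l j] by (auto simp: lookup_tdeg)
    finally show "coef (\<Sum>i<n. \<Sum>_<nat (D i j). single i (-1::int)) l
      = coef (- tdeg n D j) l" .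
  qed
  finally show ?thesis
    using True by (simp add: \<tau>.hom_mult stratum_subst_Inr mult_single)
qed

lemma stratum_subst_rel:
  assumes W: "W \<subseteq> {..<n}"
  shows "stratum_subst n D W b (rel k) = single 0 (\<Sum>j\<in>zcols W. pconst (c k j) * b j)"
proof -
  interpret \<tau>: comm_ring_hom "stratum_subst n D W b" by (rule comm_ring_hom_stratum_subst)
  have "stratum_subst n D W b (rel k)
      = (\<Sum>j<m. lconst (c k j) * stratum_subst n D W b (colmon j * Y j))"
    by (simp add: rel_def \<tau>.hom_sum \<tau>.hom_mult)
  also have "\<dots> = (\<Sum>j<m. if j \<in> zcols W then single 0 (pconst (c k j) * b j) else 0)"
    by (intro sum.cong) (auto simp: stratum_subst_colmon[OF W] lconst_def mult_single)
  also have "\<dots> = (\<Sum>j\<in>zcols W. single 0 (pconst (c k j) * b j))"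
    using zcols_bound[of W] by (intro sum.mono_neutral_cong_right) auto
  also have "\<dots> = single 0 (\<Sum>j\<in>zcols W. pconst (c k j) * b j)"
    by (rule sum_single_eq)
  finally show ?thesis .
qed

text \<open>A parametrization of the solutions of the first \<open>e\<close> relations on the stratum: the variables of the
  columns in \<open>J\<close> are expressed by the others.\<close>

definition solved :: "nat set \<Rightarrow> nat \<Rightarrow> nat set \<Rightarrow> (nat \<Rightarrow> (nat, 'k) mpoly) \<Rightarrow> bool" where
  "solved W e J b \<longleftrightarrow> J \<subseteq> zcols W \<and> card J = e \<and> (\<forall>j. j \<notin> J \<longrightarrow> b j = pvar j) \<and>
     (\<forall>k<e. (\<Sum>j\<in>zcols W. pconst (c k j) * b j) = 0)"

lemma dual_coeffs:
  assumes "e \<le> d" "J \<subseteq> {..<m}" "card J = e"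
  obtains u where "\<And>j j'. j \<in> J \<Longrightarrow> j' \<in> J \<Longrightarrow> (\<Sum>k<e. u j k * c k j') = (if j' = j then 1 else 0)"
    "\<And>k k'. k < e \<Longrightarrow> k' < e \<Longrightarrow> (\<Sum>j\<in>J. c k j * u j k') = (if k' = k then 1 else 0)"
proof -
  have "\<exists>u. \<forall>j\<in>J. \<forall>j'\<in>J. (\<Sum>k<e. u j k * c k j') = (if j' = j then 1 else 0)"
    using generic_matrix_dual[OF generic, of "{..<e}" J] assms by (intro bchoice) auto
  then obtain u where u: "\<And>j j'. j \<in> J \<Longrightarrow> j' \<in> J \<Longrightarrow> (\<Sum>k<e. u j k * c k j') = (if j' = j then 1 else 0)"
    by blast
  have fin: "finite J" using assms(2) finite_subset by blast
  \<comment> \<open>a left inverse of a square matrix is a right inverse\<close>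
  have "(\<Sum>j\<in>J. c k j * u j k') - (if k' = k then 1 else 0) = 0" if "k < e" "k' < e" for k k'
  proof (rule generic_matrixD[OF generic, of "{..<e}" J "\<lambda>k'. (\<Sum>j\<in>J. c k j * u j k') - (if k' = k then 1 else 0)"])
    fix j' assume j': "j' \<in> J"
    have "(\<Sum>k'<e. ((\<Sum>j\<in>J. c k j * u j k') - (if k' = k then 1 else 0)) * c k' j')
        = (\<Sum>k'<e. \<Sum>j\<in>J. c k j * u j k' * c k' j') - (\<Sum>k'<e. if k' = k then c k' j' else 0)"
      by (simp add: left_diff_distrib sum_subtractf sum_distrib_right if_distrib[of "\<lambda>x. x * _"] cong: if_cong)
    also have "(\<Sum>k'<e. \<Sum>j\<in>J. c k j * u j k' * c k' j') = (\<Sum>j\<in>J. c k j * (\<Sum>k'<e. u j k' * c k' j'))"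
      by (subst sum.swap) (simp add: sum_distrib_left mult.assoc)
    also have "\<dots> = (\<Sum>j\<in>J. if j = j' then c k j else 0)"
      using j' by (intro sum.cong) (auto simp: u)
    also have "\<dots> = c k j'"
      using fin j' by simp
    also have "(\<Sum>k'<e. if k' = k then c k' j' else 0) = c k j'"
      using that by simp
    finally show "(\<Sum>k'<e. ((\<Sum>j\<in>J. c k j * u j k') - (if k' = k then 1 else 0)) * c k' j') = 0"
      by simp
  qed (use assms that in auto)
  with u show ?thesis
    by (intro that[of u]) auto
qed

lemma solved_exists:
  assumes "e \<le> d" "J \<subseteq> zcols W" "card J = e"
  shows "\<exists>b. solved W e J b"
proof -
  interpret pc: comm_ring_hom "pconst :: 'k \<Rightarrow> (nat, 'k) mpoly" by (rule comm_ring_hom_pconst)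
  obtain u where u: "\<And>k k'. k < e \<Longrightarrow> k' < e \<Longrightarrow> (\<Sum>j\<in>J. c k j * u j k') = (if k' = k then 1 else 0)"
    using dual_coeffs[of e J] assms zcols_bound[of W] by (metis subset_trans)
  define b where "b j = (if j \<in> J then - (\<Sum>j'\<in>zcols W - J. pconst (\<Sum>k<e. u j k * c k j') * pvar j') else pvar j)" for j
  have "(\<Sum>j\<in>zcols W. pconst (c k j) * b j) = 0" if k: "k < e" for k
  proof -
    have "(\<Sum>j\<in>J. pconst (c k j) * b j)
        = - (\<Sum>j\<in>J. \<Sum>j'\<in>zcols W - J. pconst (c k j * (\<Sum>k'<e. u j k' * c k' j')) * pvar j')"
      by (simp add: b_def sum_negf sum_distrib_left[of _ _ "zcols W - J"] pc.hom_mult mult.assoc)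
    also have "(\<Sum>j\<in>J. \<Sum>j'\<in>zcols W - J. pconst (c k j * (\<Sum>k'<e. u j k' * c k' j')) * pvar j')
        = (\<Sum>j'\<in>zcols W - J. pconst (\<Sum>j\<in>J. c k j * (\<Sum>k'<e. u j k' * c k' j')) * pvar j')"
      by (subst sum.swap) (simp add: pc.hom_sum sum_distrib_right)
    also have "\<dots> = (\<Sum>j'\<in>zcols W - J. pconst (c k j') * pvar j')"
    proof (intro sum.cong refl)
      fix j'
      have "(\<Sum>j\<in>J. c k j * (\<Sum>k'<e. u j k' * c k' j')) = (\<Sum>k'<e. (\<Sum>j\<in>J. c k j * u j k') * c k' j')"
        by (simp add: sum_distrib_left sum_distrib_right mult.assoc) (rule sum.swap)
      also have "\<dots> = (\<Sum>k'<e. if k' = k then c k' j' else 0)"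
        by (intro sum.cong) (auto simp: u k)
      also have "\<dots> = c k j'" using k by simp
      finally show "pconst (\<Sum>j\<in>J. c k j * (\<Sum>k'<e. u j k' * c k' j')) * pvar j' = (pconst (c k j') * pvar j' :: (nat, 'k) mpoly)"
        by simp
    qed
    finally have "(\<Sum>j\<in>J. pconst (c k j) * b j) = - (\<Sum>j\<in>zcols W - J. pconst (c k j) * b j)"
      by (simp add: b_def)
    then show ?thesis
      using sum.subset_diff[OF assms(2), of "\<lambda>j. pconst (c k j) * b j"] by simp
  qed
  then show ?thesis
    using assms by (intro exI[of _ b]) (auto simp: solved_def b_def)
qed

text \<open>By genericity, \<open>e + 1\<close> relations determine one variable more, but the variables outside \<open>J\<close> are free.\<close>

lemma solved_next_relation_nonzero:
  assumes s: "solved W e J b" and e: "e < d" "e < card (zcols W)"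
  shows "(\<Sum>j\<in>zcols W. pconst (c e j) * b j) \<noteq> 0"
proof
  interpret pc: comm_ring_hom "pconst :: 'k \<Rightarrow> (nat, 'k) mpoly" by (rule comm_ring_hom_pconst)
  assume 0: "(\<Sum>j\<in>zcols W. pconst (c e j) * b j) = 0"
  have J: "J \<subseteq> zcols W" "card J = e" and finJ: "finite J"
    using s finite_subset[OF _ finite_zcols] by (auto simp: solved_def)
  then obtain j0 where j0: "j0 \<in> zcols W" "j0 \<notin> J"
    using e(2) by (metis card_subset_eq finite_zcols nat_neq_iff subsetI subset_antisym)
  \<comment> \<open>with one more relation one could also solve for the free variable \<open>j0\<close>\<close>
  obtain x where x: "\<forall>j'\<in>insert j0 J. (\<Sum>k\<in>{..e}. x k * c k j') = (if j' = j0 then 1 else 0)"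
    using generic_matrix_dual[OF generic, of "{..e}" "insert j0 J" j0] J j0 e(1) zcols_bound[of W] finJ
    by force
  define a where "a j = (\<Sum>k\<in>{..e}. x k * c k j)" for j
  have "(\<Sum>j\<in>zcols W. pconst (c k j) * b j) = 0" if "k \<le> e" for k
    using that s 0 by (cases "k = e") (auto simp: solved_def)
  then have "0 = (\<Sum>k\<in>{..e}. pconst (x k) * (\<Sum>j\<in>zcols W. pconst (c k j) * b j))"
    by simp
  also have "\<dots> = (\<Sum>j\<in>zcols W. pconst (a j) * b j)"
    by (simp add: a_def sum_distrib_left sum_distrib_right pc.hom_sum pc.hom_mult mult.assoc) (rule sum.swap)
  also have "\<dots> = (\<Sum>j\<in>zcols W - J. pconst (a j) * pvar j)"
    using J j0 x s by (intro sum.mono_neutral_cong_right) (auto simp: a_def solved_def)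
  finally have "0 = coef (\<Sum>j\<in>zcols W - J. pconst (a j) * pvar j) (single j0 1)"
    by simp
  then have "a j0 = 0"
    using j0 lookup_linear_comb[of "zcols W - J" a j0] by (simp del: One_nat_def)
  then show False
    using x by (simp add: a_def)
qed

lemma stratum_subst_vanishes:
  assumes W: "W \<subseteq> {..<n}" and rels: "\<And>k. k < e \<Longrightarrow> (\<Sum>j\<in>zcols W. pconst (c k j) * b j) = 0"
    and f: "f \<in> stratum_ideal W e"
  shows "stratum_subst n D W b f = 0"
proof -
  interpret \<tau>: comm_ring_hom "stratum_subst n D W b" by (rule comm_ring_hom_stratum_subst)
  show ?thesis
    using f by (induction rule: idl.span_induct_alt)
      (auto simp: \<tau>.hom_add \<tau>.hom_mult stratum_subst_Inl stratum_subst_rel[OF W] rels)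
qed

definition tmon :: "nat set \<Rightarrow> (nat + nat, 'k) mpoly" where
  "tmon W = (\<Prod>i\<in>{..<n} - W. X i)"

text \<open>Where the torus variables are invertible, the variables in \<open>J\<close> can be eliminated modulo the ideal; what
  remains is a polynomial in free variables, on which the substitution is injective.\<close>

lemma saturation:
  assumes W: "W \<subseteq> {..<n}" and e: "e \<le> d" and s: "solved W e J b" and g: "stratum_subst n D W b g = 0"
  shows "\<exists>N. tmon W ^ N * g \<in> stratum_ideal W e"
proof -
  interpret pc: comm_ring_hom "pconst :: 'k \<Rightarrow> (nat + nat, 'k) mpoly" by (rule comm_ring_hom_pconst)
  interpret \<tau>: comm_ring_hom "stratum_subst n D W b" by (rule comm_ring_hom_stratum_subst)
  let ?I = "stratum_ideal W e"
  have J: "J \<subseteq> zcols W" "card J = e" and finJ: "finite J"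
    using s finite_subset[OF _ finite_zcols] by (auto simp: solved_def)
  obtain u where u: "\<And>j j'. j \<in> J \<Longrightarrow> j' \<in> J \<Longrightarrow> (\<Sum>k<e. u j k * c k j') = (if j' = j then 1 else 0)"
    using dual_coeffs[of e J] J e zcols_bound[of W] by (metis subset_trans)
  define U :: "(nat + nat) set" where "U = - (Inl ` W \<union> Inr ` J)"
  define T where "T = (\<Sum>i<n. \<Sum>j<m. nat (D i j))"
  define \<mu> where "\<mu> = tmon W ^ T"
  have \<mu>U: "\<mu> \<in> pring U"
    unfolding \<mu>_def tmon_def by (intro pring_power pring_prod) (auto simp: U_def)
  have factor: "\<exists>q\<in>pring U. \<mu> = q * colmon j" and colU: "colmon j \<in> pring U" if j: "j \<in> zcols W" for j
  proof -
    have "nat (D i j) \<le> T" if "i < n" for i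
    proof -
      have "nat (D i j) \<le> (\<Sum>j<m. nat (D i j))"
        using j zcols_bound[of W] by (intro member_le_sum) auto
      also have "\<dots> \<le> T"
        unfolding T_def using that by (intro member_le_sum[of i "{..<n}" "\<lambda>i. \<Sum>j<m. nat (D i j)"]) auto
      finally show ?thesis .
    qed
    then have "\<mu> = (\<Prod>i\<in>{..<n} - W. X i ^ (T - nat (D i j))) * colmon j"
      unfolding \<mu>_def tmon_def colmon_outside[OF W j] prod_power_distrib prod.distrib[symmetric]
      by (intro prod.cong) (auto simp: power_add[symmetric])
    moreover have "(\<Prod>i\<in>{..<n} - W. X i ^ (T - nat (D i j))) \<in> pring U"
      by (intro pring_power pring_prod) (auto simp: U_def)
    ultimately show "\<exists>q\<in>pring U. \<mu> = q * colmon j" by blast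
    show "colmon j \<in> pring U"
      unfolding colmon_outside[OF W j] by (intro pring_power pring_prod) (auto simp: U_def)
  qed
  have "\<exists>g\<in>pring U. \<mu> * pvar x - g \<in> ?I" for x
  proof -
    consider "x \<in> U" | i where "x = Inl i" "i \<in> W" | j where "x = Inr j" "j \<in> J"
      by (auto simp: U_def)
    then show ?thesis
    proof cases
      case 1
      then show ?thesis
        using \<mu>U by (intro bexI[of _ "\<mu> * pvar x"]) (auto intro: pring_mult idl.span_zero)
    next
      case 2
      then show ?thesis
        by (intro bexI[of _ 0]) (simp_all add: idl.span_scale idl.span_base)
    next
      case (3 j)
      \<comment> \<open>the combination of the relations that isolates the column \<open>j\<close> among the columns of \<open>J\<close>\<close>
      define a where "a j' = (\<Sum>k<e. u j k * c k j')" for j'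
      define R where "R = (\<Sum>j'\<in>zcols W - J. pconst (a j') * (colmon j' * Y j'))"
      have "(\<Sum>k<e. pconst (u j k) * rel k) = (\<Sum>j'<m. pconst (a j') * (colmon j' * Y j'))"
        by (simp add: rel_def a_def sum_distrib_left sum_distrib_right pc.hom_sum pc.hom_mult mult.assoc)
          (rule sum.swap)
      also have "\<dots> = (\<Sum>j'\<in>zcols W. pconst (a j') * (colmon j' * Y j'))
          + (\<Sum>j'\<in>{..<m} - zcols W. pconst (a j') * (colmon j' * Y j'))"
        using sum.subset_diff[OF zcols_bound] by (simp add: add.commute)
      also have "(\<Sum>j'\<in>zcols W. pconst (a j') * (colmon j' * Y j'))
          = R + (\<Sum>j'\<in>J. pconst (a j') * (colmon j' * Y j'))"
        unfolding R_def using sum.subset_diff[OF J(1)] by simp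
      also have "(\<Sum>j'\<in>J. pconst (a j') * (colmon j' * Y j')) = (\<Sum>j'\<in>J. if j' = j then colmon j' * Y j' else 0)"
        using 3 by (intro sum.cong) (auto simp: a_def u)
      also have "\<dots> = colmon j * Y j"
        using 3 finJ by simp
      finally have eq: "colmon j * Y j + R = (\<Sum>k<e. pconst (u j k) * rel k)
          - (\<Sum>j'\<in>{..<m} - zcols W. pconst (a j') * (colmon j' * Y j'))"
        by simp
      have "(\<Sum>k<e. pconst (u j k) * rel k) \<in> ?I"
        by (intro idl.span_sum idl.span_scale idl.span_base) auto
      moreover have "(\<Sum>j'\<in>{..<m} - zcols W. pconst (a j') * (colmon j' * Y j')) \<in> ?I"
      proof (rule idl.span_sum)
        fix j' assume "j' \<in> {..<m} - zcols W"
        then have "colmon j' * Y j' \<in> ?I"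
          using colmon_in_ideal[OF W, of j' "Y j'"] idl.span_mono[of "X ` W" "stratum_gens W e"] by auto
        then show "pconst (a j') * (colmon j' * Y j') \<in> ?I"
          by (rule idl.span_scale)
      qed
      ultimately have I: "colmon j * Y j + R \<in> ?I"
        unfolding eq by (rule idl.span_diff)
      obtain q where q: "q \<in> pring U" "\<mu> = q * colmon j"
        using factor 3 J by blast
      have RU: "R \<in> pring U"
        unfolding R_def using colU by (intro pring_sum pring_mult) (auto simp: U_def)
      have "\<mu> * pvar x - (- (q * R)) = q * (colmon j * Y j + R)"
        using 3 q by (simp add: algebra_simps)
      also have "\<dots> \<in> ?I"
        using I by (rule idl.span_scale)
      finally show ?thesis
        using RU q by (intro bexI[of _ "- (q * R)"]) (auto intro!: pring_uminus pring_mult)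
    qed
  qed
  then obtain N g' where g': "g' \<in> pring U" "\<mu> ^ N * g - g' \<in> ?I"
    using reduce_to_fewer_variables[OF \<mu>U, of "stratum_gens W e" g] by blast
  have "stratum_subst n D W b (\<mu> ^ N * g - g') = 0"
    using s by (intro stratum_subst_vanishes[OF W _ g'(2)]) (auto simp: solved_def)
  then have "stratum_subst n D W b g' = 0"
    by (simp add: \<tau>.hom_minus \<tau>.hom_mult g)
  from stratum_subst_inj[OF g'(1) _ _ this] have "g' = 0"
    using s unfolding U_def solved_def by blast
  then have "tmon W ^ (T * N) * g \<in> ?I"
    using g'(2) by (simp add: \<mu>_def power_mult)
  then show ?thesis ..
qed

lemma X_nonzerodivisor_coordinate_subspace:
  assumes i: "i \<notin> W" and f: "X i * f \<in> idl.span (X ` W)"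
  shows "f \<in> idl.span (X ` W)"
proof -
  interpret \<tau>: comm_ring_hom "stratum_subst n D W (pvar :: nat \<Rightarrow> (nat, 'k) mpoly)"
    by (rule comm_ring_hom_stratum_subst)
  let ?U = "- (Inl ` W) :: (nat + nat) set"
  have "\<exists>g\<in>pring ?U. 1 * pvar x - g \<in> idl.span (X ` W)" for x :: "nat + nat"
    by (intro bexI[of _ "if x \<in> ?U then pvar x else 0"]) (auto intro: idl.span_zero idl.span_base)
  then obtain g where g: "g \<in> pring ?U" "f - g \<in> idl.span (X ` W)"
    using reduce_to_fewer_variables[of 1 ?U "X ` W" f] by auto
  have "stratum_subst n D W pvar (X i * f) = 0"
    by (rule stratum_subst_vanishes_X[OF f])
  then have "stratum_subst n D W (pvar :: nat \<Rightarrow> (nat, 'k) mpoly) f = 0"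
    using i by (auto simp: \<tau>.hom_mult stratum_subst_Inl)
  moreover have "stratum_subst n D W (pvar :: nat \<Rightarrow> (nat, 'k) mpoly) (f - g) = 0"
    by (rule stratum_subst_vanishes_X[OF g(2)])
  ultimately have "stratum_subst n D W (pvar :: nat \<Rightarrow> (nat, 'k) mpoly) g = 0"
    by (simp add: \<tau>.hom_minus)
  then have "g = 0"
    by (intro stratum_subst_inj[OF g(1), of W pvar n D]) auto
  then show ?thesis
    using g by simp
qed

lemma tmon_cancel:
  assumes X: "\<And>i f. i \<in> {..<n} - W \<Longrightarrow> X i * f \<in> stratum_ideal W e \<Longrightarrow> f \<in> stratum_ideal W e"
  shows "tmon W ^ N * f \<in> stratum_ideal W e \<Longrightarrow> f \<in> stratum_ideal W e"
proof (induction N arbitrary: f)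
  case (Suc N)
  have *: "(\<Prod>i\<in>S. X i) * g \<in> stratum_ideal W e \<Longrightarrow> g \<in> stratum_ideal W e"
    if "finite S" "S \<subseteq> {..<n} - W" for S g
    using that
  proof (induction S arbitrary: g rule: finite_induct)
    case (insert i S)
    then have "(\<Prod>i\<in>S. X i) * (X i * g) \<in> stratum_ideal W e"
      by (simp add: mult_ac)
    then have "X i * g \<in> stratum_ideal W e"
      using insert by blast
    then show ?case
      using X insert by blast
  qed simp
  have "tmon W * (tmon W ^ N * f) \<in> stratum_ideal W e"
    using Suc.prems by (simp add: mult.assoc)
  then have "tmon W ^ N * f \<in> stratum_ideal W e"
    using *[of "{..<n} - W" "tmon W ^ N * f"] unfolding tmon_def by blast
  then show ?case by (rule Suc.IH)
qed simp

text \<open>The quotient by the stratum ideal embeds into its localization, which is a subring of the domain of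
  Laurent polynomials, and \<open>rel e\<close> is not zero there.\<close>

lemma rel_nonzerodivisor:
  assumes W: "W \<subseteq> {..<n}" and e: "e < d" "e < card (zcols W)"
    and X: "\<And>i f. i \<in> {..<n} - W \<Longrightarrow> X i * f \<in> stratum_ideal W e \<Longrightarrow> f \<in> stratum_ideal W e"
    and g: "rel e * g \<in> stratum_ideal W e"
  shows "g \<in> stratum_ideal W e"
proof -
  obtain J where "J \<subseteq> zcols W" "card J = e"
    using e(2) by (metis less_imp_le obtain_subset_with_card_n)
  then obtain b where s: "solved W e J b"
    using solved_exists[of e J W] e(1) by auto
  interpret \<tau>: comm_ring_hom "stratum_subst n D W b" by (rule comm_ring_hom_stratum_subst)
  have "stratum_subst n D W b (rel e * g) = 0"
    using s by (intro stratum_subst_vanishes[OF W _ g]) (auto simp: solved_def)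
  moreover have "stratum_subst n D W b (rel e) \<noteq> 0"
    using solved_next_relation_nonzero[OF s e] by (simp add: stratum_subst_rel[OF W])
  ultimately have "stratum_subst n D W b g = 0"
    by (simp add: \<tau>.hom_mult)
  then obtain N where N: "tmon W ^ N * g \<in> stratum_ideal W e"
    using saturation[OF W less_imp_le[OF e(1)] s] by blast
  show ?thesis
    by (rule tmon_cancel[OF _ N]) (rule X)
qed

text \<open>For fixed \<open>i\<close>, the induction hypothesis applies to \<open>insert i W\<close> and fewer relations: the condition for
  \<open>A\<close> there is the one for \<open>insert i A\<close> here. Hence the other \<open>X l\<close> are nonzerodivisors
  there, and so is each relation modulo \<open>X i\<close> and the earlier ones; by exchange the relations can be added
  one by one.\<close>

theorem X_nonzerodivisor:
  assumes "W \<subseteq> {..<n}" "e \<le> d"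
    and "\<And>A. A \<noteq> {} \<Longrightarrow> A \<subseteq> {..<n} - W \<Longrightarrow> e < card (zcols (W \<union> A)) + card A"
    and "i \<in> {..<n} - W" "X i * f \<in> stratum_ideal W e"
  shows "f \<in> stratum_ideal W e"
  using assms
proof (induction e arbitrary: W i f rule: less_induct)
  case (less e)
  let ?W = "insert i W"
  have W': "?W \<subseteq> {..<n}" using less.prems by auto
  have rel: "g \<in> stratum_ideal ?W k" if k: "k < e" and g: "rel k * g \<in> stratum_ideal ?W k" for k g
  proof (rule rel_nonzerodivisor[OF W' _ _ _ g])
    show "k < d" using k less.prems by simp
    show "k < card (zcols ?W)"
      using less.prems(3)[of "{i}"] less.prems(4) k by simp
  next
    fix i' f' assume i': "i' \<in> {..<n} - ?W" and f': "X i' * f' \<in> stratum_ideal ?W k"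
    show "f' \<in> stratum_ideal ?W k"
    proof (rule less.IH[OF k W' _ _ i' f'])
      show "k \<le> d" using k less.prems by simp
      fix A assume A: "A \<noteq> {}" "A \<subseteq> {..<n} - ?W"
      then have "finite A" "i \<notin> A" "insert i A \<subseteq> {..<n} - W"
        using less.prems(4) finite_subset by auto
      then show "k < card (zcols (?W \<union> A)) + card A"
        using less.prems(3)[of "insert i A"] k by auto
    qed
  qed
  have "\<forall>f. X i * f \<in> stratum_ideal W k \<longrightarrow> f \<in> stratum_ideal W k" if "k \<le> e" for k
    using that
  proof (induction k)
    case 0
    then show ?case
      using X_nonzerodivisor_coordinate_subspace[of i W] less.prems(4) by simp
  next
    case (Suc k)
    have *: "stratum_gens W (Suc k) = insert (rel k) (stratum_gens W k)"
      by (auto simp: lessThan_Suc)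
    have **: "stratum_gens ?W k = insert (X i) (stratum_gens W k)"
      by auto
    have k: "k < e" using Suc.prems by simp
    have IH: "X i * f \<in> stratum_ideal W k \<Longrightarrow> f \<in> stratum_ideal W k" for f
      using Suc by simp
    show ?case
      unfolding *
    proof (intro allI impI)
      fix f assume "X i * f \<in> idl.span (insert (rel k) (stratum_gens W k))"
      with IH rel[OF k, unfolded **] show "f \<in> idl.span (insert (rel k) (stratum_gens W k))"
        by (rule nonzerodivisor_exchange)
    qed
  qed
  then show ?case
    using less.prems(5) by blast
qed

end

section \<open>Rings and ideals carried by sets\<close>

definition subring_set :: "'a::comm_ring_1 set \<Rightarrow> bool" where
  "subring_set S \<longleftrightarrow> 1 \<in> S \<and> (\<forall>x\<in>S. \<forall>y\<in>S. x - y \<in> S \<and> x * y \<in> S)"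

lemma subring_set_closed:
  assumes "subring_set S"
  shows "1 \<in> S" "0 \<in> S" "x \<in> S \<Longrightarrow> - x \<in> S" "x \<in> S \<Longrightarrow> y \<in> S \<Longrightarrow> x + y \<in> S"
    "x \<in> S \<Longrightarrow> y \<in> S \<Longrightarrow> x - y \<in> S" "x \<in> S \<Longrightarrow> y \<in> S \<Longrightarrow> x * y \<in> S"
proof -
  have 1: "1 \<in> S" and diff: "\<And>x y. x \<in> S \<Longrightarrow> y \<in> S \<Longrightarrow> x - y \<in> S"
    and mult: "\<And>x y. x \<in> S \<Longrightarrow> y \<in> S \<Longrightarrow> x * y \<in> S"
    using assms by (auto simp: subring_set_def)
  have 0: "0 \<in> S" using diff[OF 1 1] by simp
  have neg: "- x \<in> S" if "x \<in> S" for x using diff[OF 0 that] by simp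
  show "1 \<in> S" "0 \<in> S" by fact+
  show "x \<in> S \<Longrightarrow> - x \<in> S" "x \<in> S \<Longrightarrow> y \<in> S \<Longrightarrow> x - y \<in> S" "x \<in> S \<Longrightarrow> y \<in> S \<Longrightarrow> x * y \<in> S"
    using neg diff mult by auto
  show "x \<in> S \<Longrightarrow> y \<in> S \<Longrightarrow> x + y \<in> S" using diff[of x "- y"] neg by simp
qed

lemma ring_on_simps [simp]:
  "carrier (ring_on S) = S" "mult (ring_on S) = (*)" "one (ring_on S) = 1" "zero (ring_on S) = 0" "add (ring_on S) = (+)"
  by (simp_all add: ring_on_def)

lemma cring_ring_on:
  assumes "subring_set S"
  shows "cring (ring_on S)"
proof (rule cringI)
  note closed = subring_set_closed[OF assms]
  show "abelian_group (ring_on S)"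
    by (rule abelian_groupI) (auto simp: closed algebra_simps intro!: bexI[of _ "- x" for x])
  show "Group.comm_monoid (ring_on S)"
    by (rule comm_monoidI) (auto simp: closed algebra_simps)
qed (auto simp: algebra_simps)

lemma a_inv_ring_on:
  assumes S: "subring_set S" and "x \<in> S"
  shows "\<ominus>\<^bsub>ring_on S\<^esub> x = - x"
proof -
  interpret cring "ring_on S" by (rule cring_ring_on[OF S])
  show ?thesis
    by (rule minus_equality) (use assms subring_set_closed[OF S] in auto)
qed

lemma a_minus_ring_on:
  "subring_set S \<Longrightarrow> x \<in> S \<Longrightarrow> y \<in> S \<Longrightarrow> x \<ominus>\<^bsub>ring_on S\<^esub> y = x - y"
  by (simp add: a_minus_def a_inv_ring_on)

lemma ideal_ring_on:
  assumes S: "subring_set S" and I: "I \<subseteq> S" "0 \<in> I" "\<And>x y. x \<in> I \<Longrightarrow> y \<in> I \<Longrightarrow> x + y \<in> I"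
    "\<And>x y. x \<in> S \<Longrightarrow> y \<in> I \<Longrightarrow> x * y \<in> I"
  shows "ideal I (ring_on S)"
proof -
  interpret cring "ring_on S" by (rule cring_ring_on[OF S])
  have neg: "- x \<in> I" if "x \<in> I" for x
    using I(4)[of "-1" x] that subring_set_closed[OF S] by simp
  show ?thesis
  proof (rule idealI)
    show "ring (ring_on S)" by (rule ring_axioms)
    show "Group.subgroup I (add_monoid (ring_on S))"
    proof (rule group.subgroupI)
      show "group (add_monoid (ring_on S))" by (rule add.is_group)
      fix x assume x: "x \<in> I"
      have "inv\<^bsub>add_monoid (ring_on S)\<^esub> x = - x"
        using a_inv_ring_on[OF S, of x] x I(1) by (auto simp: a_inv_def)
      then show "inv\<^bsub>add_monoid (ring_on S)\<^esub> x \<in> I"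
        using neg x by simp
    qed (use I in auto)
    show "x \<otimes>\<^bsub>ring_on S\<^esub> a \<in> I" "a \<otimes>\<^bsub>ring_on S\<^esub> x \<in> I" if "a \<in> I" "x \<in> carrier (ring_on S)" for a x
      using I(4)[of x a] that by (simp_all add: mult.commute)
  qed
qed

lemma subring_ring_on:
  assumes S: "subring_set S" and "subring_set T" "T \<subseteq> S"
  shows "subring T (ring_on S)"
proof -
  interpret cring "ring_on S" by (rule cring_ring_on[OF S])
  note closed = subring_set_closed[OF assms(2)]
  show ?thesis
  proof (rule subringI)
    fix x assume x: "x \<in> T"
    have "\<ominus>\<^bsub>ring_on S\<^esub> x = - x"
      using a_inv_ring_on[OF S, of x] x assms(3) by auto
    then show "\<ominus>\<^bsub>ring_on S\<^esub> x \<in> T"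
      using closed x by simp
  qed (use closed assms in auto)
qed

lemma subring_set_pring: "subring_set (pring V)"
  by (auto simp: subring_set_def pring_closed)

text \<open>Coefficients from the larger ring do no harm: retracting a representation onto \<open>pring V\<close> fixes
  the generators and the element itself.\<close>

lemma Idl_pring:
  fixes T :: "('a, 'b::comm_ring_1) mpoly set"
  assumes T: "T \<subseteq> pring V"
  shows "Idl\<^bsub>ring_on (pring V)\<^esub> T = pring V \<inter> idl.span T"
proof
  interpret cring "ring_on (pring V)" by (rule cring_ring_on[OF subring_set_pring])
  have "ideal (pring V \<inter> idl.span T) (ring_on (pring V))"
    by (rule ideal_ring_on[OF subring_set_pring])
      (auto intro: pring_closed idl.span_zero idl.span_add idl.span_scale)
  then show "Idl\<^bsub>ring_on (pring V)\<^esub> T \<subseteq> pring V \<inter> idl.span T"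
    by (rule genideal_minimal) (use T idl.span_base in auto)
  interpret I: ideal "Idl\<^bsub>ring_on (pring V)\<^esub> T" "ring_on (pring V)"
    using T by (intro genideal_ideal) simp
  interpret \<pi>: comm_ring_hom "retract V :: ('a, 'b) mpoly \<Rightarrow> _" by (rule comm_ring_hom_retract)
  have "retract V f \<in> Idl\<^bsub>ring_on (pring V)\<^esub> T" if "f \<in> idl.span T" for f
    using that
  proof (induction rule: idl.span_induct_alt)
    case base
    then show ?case using I.zero_closed by simp
  next
    case (step c x y)
    have "x \<in> Idl\<^bsub>ring_on (pring V)\<^esub> T"
      using genideal_self[of T] T step by auto
    then have "retract V c * x \<in> Idl\<^bsub>ring_on (pring V)\<^esub> T"
      using I.I_l_closed[of x "retract V c"] retract_pring[of V c] by simp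
    moreover have "retract V x = x"
      using retract_id step T by blast
    ultimately show ?case
      using I.a_closed[of "retract V c * x" "retract V y"] step by (simp add: \<pi>.hom_add \<pi>.hom_mult)
  qed
  then show "pring V \<inter> idl.span T \<subseteq> Idl\<^bsub>ring_on (pring V)\<^esub> T"
    using retract_id by force
qed

lemma retract_span:
  fixes T :: "('a, 'b::comm_ring_1) mpoly set"
  assumes T: "T \<subseteq> pring V" and f: "f \<in> idl.span T"
  shows "retract V f \<in> idl.span T"
proof -
  interpret \<pi>: comm_ring_hom "retract V :: ('a, 'b) mpoly \<Rightarrow> _" by (rule comm_ring_hom_retract)
  show ?thesis using f
  proof (induction rule: idl.span_induct_alt)
    case (step c x y)
    have "retract V x = x" using retract_id step T by blast
    then show ?case
      using step by (simp add: \<pi>.hom_add \<pi>.hom_mult idl.span_add idl.span_scale idl.span_base)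
  qed (simp add: idl.span_zero)
qed


section \<open>Valuations on a symmetric algebra and Khovanskii bases\<close>

lemma add_eq_single_iff:
  fixes a b :: "'x \<Rightarrow>\<^sub>0 nat"
  shows "a + b = single k 1 \<longleftrightarrow> (a = 0 \<and> b = single k 1) \<or> (a = single k 1 \<and> b = 0)"
proof
  assume ab: "a + b = single k 1"
  then have l: "coef a x + coef b x = (if x = k then 1 else 0)" for x
    by (metis lookup_add lookup_single_eq lookup_single_not_eq)
  have "a = 0 \<or> b = 0"
  proof (rule ccontr)
    assume "\<not> (a = 0 \<or> b = 0)"
    then obtain x y where "coef a x \<noteq> 0" "coef b y \<noteq> 0"
      by (metis lookup_zero poly_mapping_eqI)
    then show False using l[of x] l[of y] by (auto split: if_splits)
  qed
  then show "(a = 0 \<and> b = single k 1) \<or> (a = single k 1 \<and> b = 0)"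
    using ab by auto
qed auto

lemma lookup_mult_expand:
  fixes F G :: "'i::monoid_add \<Rightarrow>\<^sub>0 'c::semiring_0"
  shows "coef (F * G) s = (\<Sum>a\<in>supp F. \<Sum>b\<in>supp G.
     if a + b = s then coef F a * coef G b else 0)"
proof -
  have "F * G = (\<Sum>a\<in>supp F. single a (coef F a))
      * (\<Sum>b\<in>supp G. single b (coef G b))"
    using pm_sum_single[of F] pm_sum_single[of G] by simp
  also have "\<dots> = (\<Sum>a\<in>supp F. \<Sum>b\<in>supp G.
      single (a + b) (coef F a * coef G b))"
    by (simp add: sum_product mult_single)
  finally show ?thesis
    by (simp add: lookup_sum lookup_single when_def)
qed

lemma lookup_mult_0:
  fixes f g :: "('x, 'k::comm_ring_1) mpoly"
  shows "coef (f * g) 0 = coef f 0 * coef g 0"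
proof -
  have z: "a + b = 0 \<longleftrightarrow> a = 0 \<and> b = 0" for a b :: "'x \<Rightarrow>\<^sub>0 nat"
    by (metis add_eq_0_iff_both_eq_0 add.left_neutral lookup_add lookup_zero poly_mapping_eqI)
  have "coef (f * g) 0 = (\<Sum>a\<in>supp f. \<Sum>b\<in>supp g.
      (if a = 0 then coef f a else 0) * (if b = 0 then coef g b else 0))"
    unfolding lookup_mult_expand by (intro sum.cong refl) (auto simp: z)
  also have "\<dots> = coef f 0 * coef g 0"
    unfolding sum_product[symmetric] by (simp add: in_keys_iff)
  finally show ?thesis .
qed

lemma lookup_mult_linear:
  fixes f g :: "('x, 'k::comm_ring_1) mpoly"
  shows "coef (f * g) (single k 1)
    = coef f 0 * coef g (single k 1)
      + coef f (single k 1) * coef g 0"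
proof -
  let ?s = "single k (1::nat)"
  have s: "?s \<noteq> 0" by simp
  have "coef (f * g) ?s = (\<Sum>a\<in>supp f. \<Sum>b\<in>supp g.
      (if a = 0 then coef f a else 0) * (if b = ?s then coef g b else 0)
      + (if a = ?s then coef f a else 0) * (if b = 0 then coef g b else 0))"
    unfolding lookup_mult_expand using s
    by (intro sum.cong refl) (auto simp: add_eq_single_iff simp del: One_nat_def)
  also have "\<dots> = coef f 0 * coef g ?s + coef f ?s * coef g 0"
    unfolding sum.distrib sum_product[symmetric] by (simp add: in_keys_iff)
  finally show ?thesis .
qed

definition linear_part :: "nat \<Rightarrow> (nat, 'k::field) mpoly \<Rightarrow> (nat, 'k) mpoly" where
  "linear_part r f = (\<Sum>k<r. pscale (coef f (single k 1)) (pvar k))"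

lemma linear_part_add: "linear_part r (f + g) = linear_part r f + linear_part r g"
  by (simp add: linear_part_def lookup_add pm.scale_left_distrib sum.distrib)

lemma linear_part_diff: "linear_part r (f - g) = linear_part r f - linear_part r g"
  by (simp add: linear_part_def lookup_minus pm.scale_left_diff_distrib sum_subtractf)

lemma linear_part_0 [simp]: "linear_part r 0 = 0"
  by (simp add: linear_part_def)

lemma linear_part_mult: "linear_part r (f * g)
    = pscale (coef f 0) (linear_part r g) + pscale (coef g 0) (linear_part r f)"
  by (simp add: linear_part_def lookup_mult_linear pm.scale_left_distrib sum.distrib pm.scale_sum_right
      mult.commute del: One_nat_def)

lemma single_linear_nonzero: "single k (1::nat) \<noteq> 0"
  by simp

lemma lookup_pconst: "coef (pconst c) \<alpha> = (if \<alpha> = 0 then c else 0)"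
  by (auto simp: pconst_def lookup_single when_def)

lemma linear_part_pconst [simp]: "linear_part r (pconst c) = 0"
  by (simp add: linear_part_def lookup_pconst single_linear_nonzero del: One_nat_def)

lemma single_1_eq_iff: "single j (1::nat) = single k 1 \<longleftrightarrow> j = k"
  by (metis keys_single one_neq_zero singleton_inject)

lemma lookup_pvar: "coef (pvar k) (single j 1) = (if j = k then 1 else 0)"
  "coef (pvar k) 0 = 0"
  by (simp_all add: pvar_def lookup_single when_def single_1_eq_iff del: One_nat_def)

lemma linear_part_fiber:
  assumes "f \<in> fiber r"
  shows "linear_part r f = f" "coef f 0 = 0"
proof -
  have "linear_part r f = f \<and> coef f 0 = 0"
    using assms unfolding fiber_def
  proof (induction rule: pm.span_induct_alt)
    case (step c x f)
    then obtain k where k: "x = pvar k" "k < r" by auto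
    have "linear_part r x = x"
      using k by (simp add: linear_part_def lookup_pvar if_distrib[of "\<lambda>c. pscale c _"] cong: if_cong del: One_nat_def)
    then have "linear_part r (pscale c x) = pscale c x"
      unfolding pscale_eq linear_part_mult k by (simp add: lookup_pconst pscale_eq)
    with step k show ?case
      by (simp add: linear_part_add lookup_add lookup_pscale lookup_pvar)
  qed simp
  then show "linear_part r f = f" "coef f 0 = 0" by auto
qed

lemma fiber_Sym: "f \<in> fiber r \<Longrightarrow> f \<in> Sym r"
  unfolding fiber_def by (induction rule: pm.span_induct_alt) (auto intro!: pring_add pring_pscale)

text \<open>Linear forms have no constant term, so only the linear terms of \<open>g\<close> contribute.\<close>

lemma linear_part_subst:
  assumes g: "g \<in> pring {..<r}" and \<beta>: "\<And>k. k < r \<Longrightarrow> \<beta> k \<in> fiber r"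
  shows "linear_part r (poly_subst pconst \<beta> g)
      = (\<Sum>k<r. pscale (coef g (single k 1)) (\<beta> k))"
proof -
  interpret comm_ring_hom "poly_subst pconst \<beta>" by (intro comm_ring_hom_poly_subst comm_ring_hom_pconst)
  have "coef (poly_subst pconst \<beta> g) 0 = coef g 0 \<and>
     linear_part r (poly_subst pconst \<beta> g)
      = (\<Sum>k<r. pscale (coef g (single k 1)) (\<beta> k))"
    using g
  proof (induction rule: pring_induct)
    case (const c)
    then show ?case
      by (simp add: poly_subst_pconst lookup_pconst single_linear_nonzero del: One_nat_def)
  next
    case (var x)
    then show ?case
      using linear_part_fiber[OF \<beta>, of x]
      by (simp add: poly_subst_pvar lookup_pvar if_distrib[of "\<lambda>c. pscale c _"] cong: if_cong del: One_nat_def)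
  next
    case (add f g)
    then show ?case
      by (simp add: hom_add lookup_add linear_part_add pm.scale_left_distrib sum.distrib)
  next
    case (mult f g)
    then show ?case
      by (simp add: hom_mult lookup_mult_0 lookup_mult_linear linear_part_mult pm.scale_left_distrib sum.distrib
          pm.scale_sum_right mult.commute del: One_nat_def)
  qed
  then show ?thesis by simp
qed

text \<open>A product formula for families of sets indexed by the exponents. It is used for the two filtrations
  behind the associated graded algebra and for the multigraded pieces of the Cox ring.\<close>

lemma graded_mult:
  fixes G H :: "'i::monoid_add \<Rightarrow>\<^sub>0 'a::comm_ring_1"
  assumes G: "\<And>p. coef G p \<in> P p" and H: "\<And>q. coef H q \<in> Q q"
    and 0: "0 \<in> R a" and add: "\<And>x y. x \<in> R a \<Longrightarrow> y \<in> R a \<Longrightarrow> x + y \<in> R a"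
    and mult: "\<And>p q x y. x \<in> P p \<Longrightarrow> y \<in> Q q \<Longrightarrow> p + q = a \<Longrightarrow> x * y \<in> R a"
  shows "coef (G * H) a \<in> R a"
proof -
  have sum: "(\<Sum>x\<in>S. F x) \<in> R a" if "\<And>x. x \<in> S \<Longrightarrow> F x \<in> R a" for S :: "'i set" and F
    using that by (induction S rule: infinite_finite_induct) (auto intro: 0 add)
  have "(if p + q = a then coef G p * coef H q else 0) \<in> R a" for p q
    using mult[OF G H, of p q] 0 by simp
  then show ?thesis
    unfolding lookup_mult_expand by (intro sum)
qed

locale sym_valuation =
  fixes r :: nat and w :: "(nat, 'k::field) mpoly \<Rightarrow> ereal"
  assumes w_0: "w 0 = \<infinity>"
    and w_finite: "f \<in> Sym r \<Longrightarrow> f \<noteq> 0 \<Longrightarrow> \<exists>x::real. w f = ereal x"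
    and w_mult: "f \<in> Sym r \<Longrightarrow> g \<in> Sym r \<Longrightarrow> w (f * g) = w f + w g"
    and w_add: "f \<in> Sym r \<Longrightarrow> g \<in> Sym r \<Longrightarrow> min (w f) (w g) \<le> w (f + g)"
    and w_scale: "f \<in> Sym r \<Longrightarrow> c \<noteq> 0 \<Longrightarrow> w (pscale c f) = w f"
begin

lemma w_not_minus_infinity: "f \<in> Sym r \<Longrightarrow> w f \<noteq> -\<infinity>"
  by (cases "f = 0") (auto simp: w_0 dest: w_finite)

lemma w_add_ge: "f \<in> Sym r \<Longrightarrow> g \<in> Sym r \<Longrightarrow> a \<le> w f \<Longrightarrow> a \<le> w g \<Longrightarrow> a \<le> w (f + g)"
  using w_add[of f g] by (metis min.bounded_iff order_trans)

lemma w_add_gr: "f \<in> Sym r \<Longrightarrow> g \<in> Sym r \<Longrightarrow> a < w f \<Longrightarrow> a < w g \<Longrightarrow> a < w (f + g)"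
  using w_add[of f g] by (metis min_less_iff_conj order_less_le_trans)

lemma w_one: "w 1 = 0"
proof -
  obtain x :: real where x: "w 1 = ereal x" using w_finite[of 1] by auto
  then have "ereal x = ereal (x + x)" using w_mult[of 1 1] by simp
  then show ?thesis using x by simp
qed

lemma w_pconst: "c \<noteq> 0 \<Longrightarrow> w (pconst c) = 0"
  using w_scale[of 1 c] w_one by (simp add: pscale_eq)

lemma w_scale_ge: "f \<in> Sym r \<Longrightarrow> a \<le> w f \<Longrightarrow> a \<le> w (pscale c f)"
  by (cases "c = 0") (auto simp: w_0 w_scale)

lemma w_uminus: "f \<in> Sym r \<Longrightarrow> w (- f) = w f"
  using w_scale[of f "-1"] by simp

lemma w_diff_ge: "f \<in> Sym r \<Longrightarrow> g \<in> Sym r \<Longrightarrow> a \<le> w f \<Longrightarrow> a \<le> w g \<Longrightarrow> a \<le> w (f - g)"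
  using w_add_ge[of f "- g" a] by (simp add: w_uminus pring_uminus)

lemma w_sum_ge: "(\<And>x. x \<in> S \<Longrightarrow> F x \<in> Sym r \<and> a \<le> w (F x)) \<Longrightarrow> a \<le> w (\<Sum>x\<in>S. F x)"
proof (induction S rule: infinite_finite_induct)
  case (insert x S)
  then show ?case by (auto intro!: w_add_ge pring_sum)
qed (auto simp: w_0)

lemma w_prod_power: 
  assumes "finite S" "\<And>x. x \<in> S \<Longrightarrow> F x \<in> Sym r" "\<And>x. x \<in> S \<Longrightarrow> w (F x) = ereal (a x)"
  shows "w (\<Prod>x\<in>S. F x ^ e x) = ereal (\<Sum>x\<in>S. real (e x) * a x)"
  using assms
proof (induction S rule: finite_induct)
  case (insert x S)
  have "w (F x ^ l) = ereal (real l * a x)" for l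
    using insert.prems by (induction l) (auto simp: w_one w_mult pring_power algebra_simps)
  then show ?case
    using insert by (simp add: w_mult pring_power pring_prod)
qed (simp add: w_one zero_ereal_def)

lemma subring_set_filt_sum: "subring_set (filt_sum (Sym r) w)"
  unfolding subring_set_def
proof (intro conjI ballI)
  show "1 \<in> filt_sum (Sym r) w"
    by (auto simp: filt_sum_def lookup_one when_def w_0 w_one zero_ereal_def)
  fix F G assume F: "F \<in> filt_sum (Sym r) w" and G: "G \<in> filt_sum (Sym r) w"
  then show "F - G \<in> filt_sum (Sym r) w"
    by (auto simp: filt_sum_def lookup_minus intro!: pring_diff w_diff_ge)
  have "coef (F * G) a \<in> {f \<in> Sym r. ereal a \<le> w f}" for a
  proof (rule graded_mult[where P = "\<lambda>a. {f \<in> Sym r. ereal a \<le> w f}" and Q = "\<lambda>a. {f \<in> Sym r. ereal a \<le> w f}"])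
    fix p q x y assume "x \<in> {f \<in> Sym r. ereal p \<le> w f}" "y \<in> {f \<in> Sym r. ereal q \<le> w f}" "p + q = a"
    then show "x * y \<in> {f \<in> Sym r. ereal a \<le> w f}"
      using add_mono[of "ereal p" "w x" "ereal q" "w y"] by (auto simp: w_mult pring_mult)
  qed (use F G in \<open>auto simp: filt_sum_def w_0 intro: pring_add w_add_ge\<close>)
  then show "F * G \<in> filt_sum (Sym r) w"
    by (auto simp: filt_sum_def)
qed

lemma ideal_filt_sum_strict: "ideal (filt_sum_strict (Sym r) w) (ring_on (filt_sum (Sym r) w))"
proof (rule ideal_ring_on[OF subring_set_filt_sum])
  show "filt_sum_strict (Sym r) w \<subseteq> filt_sum (Sym r) w"
    by (auto simp: filt_sum_def filt_sum_strict_def less_imp_le)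
  show "0 \<in> filt_sum_strict (Sym r) w"
    by (auto simp: filt_sum_strict_def w_0)
  show "F + G \<in> filt_sum_strict (Sym r) w"
    if "F \<in> filt_sum_strict (Sym r) w" "G \<in> filt_sum_strict (Sym r) w" for F G
    using that by (auto simp: filt_sum_strict_def lookup_add intro!: pring_add w_add_gr)
  fix F G assume F: "F \<in> filt_sum (Sym r) w" and G: "G \<in> filt_sum_strict (Sym r) w"
  have "coef (F * G) a \<in> {f \<in> Sym r. ereal a < w f}" for a
  proof (rule graded_mult[where P = "\<lambda>a. {f \<in> Sym r. ereal a \<le> w f}" and Q = "\<lambda>a. {f \<in> Sym r. ereal a < w f}"])
    fix p q x y assume *: "x \<in> {f \<in> Sym r. ereal p \<le> w f}" "y \<in> {f \<in> Sym r. ereal q < w f}" "p + q = a"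
    then have "ereal p + ereal q < w x + w y"
      using w_not_minus_infinity[of x] by (cases "w x"; cases "w y") auto
    then show "x * y \<in> {f \<in> Sym r. ereal a < w f}"
      using * by (auto simp: w_mult pring_mult)
  qed (use F G in \<open>auto simp: filt_sum_def filt_sum_strict_def w_0 intro: pring_add w_add_gr\<close>)
  then show "F * G \<in> filt_sum_strict (Sym r) w"
    by (auto simp: filt_sum_strict_def)
qed

text \<open>The classes of all families whose linear part at each value \<open>a\<close> is a combination of generators of value
  \<open>a\<close>, and whose constant term is concentrated at the value 0, form a subring. It contains the given
  generators, hence is the whole associated graded algebra.\<close>

lemma leading_form:
  assumes B: "B \<subseteq> fiber r - {0}"
    and gen: "generate_ring (assoc_graded (Sym r) w)
      (graded_class (Sym r) w ` (B \<union> (pconst ` (UNIV - {0})))) = carrier (assoc_graded (Sym r) w)"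
    and f: "f \<in> fiber r" "w f = ereal a"
  shows "\<exists>h s. h \<in> Sym r \<and> ereal a < w h \<and> s \<in> pm.span {x\<in>B. w x = ereal a} \<and> linear_part r h = f - s"
proof -
  let ?F = "filt_sum (Sym r) w" and ?I = "filt_sum_strict (Sym r) w"
  let ?R = "ring_on ?F"
  define K where "K a = pm.span {x\<in>B. w x = ereal a}" for a
  define Q where "Q a = {f \<in> Sym r. ereal a \<le> w f \<and> (a \<noteq> 0 \<longrightarrow> coef f 0 = 0) \<and> linear_part r f \<in> K a}" for a
  define T where "T = {G :: real \<Rightarrow>\<^sub>0 (nat, 'k) mpoly. \<forall>a. coef G a \<in> Q a}"
  interpret I: ideal ?I ?R by (rule ideal_filt_sum_strict)
  interpret \<pi>: ring_hom_ring ?R "?R Quot ?I" "(+>\<^bsub>?R\<^esub>) ?I" by (rule I.rcos_ring_hom_ring)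
  have Q_add: "x + y \<in> Q a" and Q_diff: "x - y \<in> Q a" if "x \<in> Q a" "y \<in> Q a" for x y a
    using that by (auto simp: Q_def K_def lookup_add lookup_minus linear_part_add linear_part_diff
        intro: pring_closed w_add_ge w_diff_ge pm.span_add pm.span_diff)
  have Q_0: "0 \<in> Q a" for a
    by (auto simp: Q_def K_def w_0 pm.span_zero)
  have Q_mult: "x * y \<in> Q a" if x: "x \<in> Q p" and y: "y \<in> Q q" and pq: "p + q = a" for x y p q a
  proof -
    have "ereal a \<le> w (x * y)"
      using x y pq add_mono[of "ereal p" "w x" "ereal q" "w y"] by (auto simp: Q_def w_mult)
    moreover have "pscale (coef x 0) (linear_part r y) \<in> K a"
      using x y pq unfolding K_def by (cases "p = 0") (auto simp: Q_def K_def pm.span_zero pm.span_scale)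
    moreover have "pscale (coef y 0) (linear_part r x) \<in> K a"
      using x y pq unfolding K_def by (cases "q = 0") (auto simp: Q_def K_def pm.span_zero pm.span_scale)
    moreover have "a \<noteq> 0 \<longrightarrow> coef (x * y) 0 = 0"
      using x y pq by (auto simp: Q_def lookup_mult_0)
    ultimately show ?thesis
      using x y by (auto simp: Q_def K_def linear_part_mult intro: pring_mult pm.span_add)
  qed
  have T: "subring_set T"
    unfolding subring_set_def
  proof (intro conjI ballI)
    have "coef 1 a \<in> Q a" for a
      using linear_part_pconst[of r "1::'k"]
      by (auto simp: lookup_one when_def Q_0) (auto simp: Q_def w_one K_def pm.span_zero)
    then show "1 \<in> T" by (simp add: T_def)
    fix G H assume "G \<in> T" "H \<in> T"
    then show "G - H \<in> T" by (auto simp: T_def lookup_minus Q_diff)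
    have "coef (G * H) a \<in> Q a" for a
      by (rule graded_mult[where P = Q and Q = Q]) (use \<open>G \<in> T\<close> \<open>H \<in> T\<close> Q_0 Q_add Q_mult in \<open>auto simp: T_def\<close>)
    then show "G * H \<in> T" by (simp add: T_def)
  qed
  have TF: "T \<subseteq> ?F"
    by (auto simp: T_def Q_def filt_sum_def)
  have single: "single a x \<in> T" if "x \<in> Q a" for a x
    using that Q_0 by (auto simp: T_def lookup_single when_def)
  have classes: "graded_class (Sym r) w ` (B \<union> (pconst ` (UNIV - {0}))) \<subseteq> ((+>\<^bsub>?R\<^esub>) ?I) ` T"
  proof (intro image_subsetI)
    fix x assume "x \<in> B \<union> (pconst ` (UNIV - {0}))"
    then consider "x \<in> B" | c where "x = pconst c" "c \<noteq> 0" by blast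
    then have "single (real_of_ereal (w x)) x \<in> T"
    proof cases
      case 1
      then have x: "x \<in> fiber r" "x \<noteq> 0" using B by auto
      then obtain t :: real where "w x = ereal t" using w_finite fiber_Sym by blast
      with 1 x show ?thesis
        by (intro single) (auto simp: Q_def K_def fiber_Sym linear_part_fiber intro: pm.span_base)
    next
      case 2
      then show ?thesis
        by (intro single) (auto simp: Q_def K_def w_pconst pm.span_zero zero_ereal_def[symmetric])
    qed
    then show "graded_class (Sym r) w x \<in> ((+>\<^bsub>?R\<^esub>) ?I) ` T"
      by (simp add: graded_class_def)
  qed
  have sub: "subring (((+>\<^bsub>?R\<^esub>) ?I) ` T) (?R Quot ?I)"
    by (rule \<pi>.img_is_subring[OF subring_ring_on[OF subring_set_filt_sum T TF]])
  have "graded_class (Sym r) w ` (B \<union> (pconst ` (UNIV - {0}))) \<subseteq> carrier (?R Quot ?I)"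
    using classes subringE(1)[OF sub] by blast
  from \<pi>.S.generate_ring_min_subring1[OF this sub classes]
  have "carrier (?R Quot ?I) \<subseteq> ((+>\<^bsub>?R\<^esub>) ?I) ` T"
    using gen unfolding assoc_graded_def by simp
  moreover have fF: "single a f \<in> ?F"
    using f fiber_Sym by (auto simp: filt_sum_def lookup_single when_def w_0)
  moreover have "?I +>\<^bsub>?R\<^esub> single a f \<in> carrier (?R Quot ?I)"
    by (rule \<pi>.hom_closed) (simp add: fF)
  ultimately obtain G where G: "G \<in> T" "?I +>\<^bsub>?R\<^esub> single a f = ?I +>\<^bsub>?R\<^esub> G"
    by blast
  then have "single a f - G \<in> ?I"
    using I.quotient_eq_iff_same_a_r_cos[OF ideal_filt_sum_strict, of "single a f" G] fF TF
    by (auto simp: a_minus_ring_on[OF subring_set_filt_sum])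
  then have h: "coef (single a f - G) a \<in> Sym r"
      "ereal a < w (coef (single a f - G) a)"
    unfolding filt_sum_strict_def by blast+
  have "linear_part r (coef G a) \<in> K a"
    using G by (auto simp: T_def Q_def)
  with h show ?thesis
    unfolding K_def lookup_minus lookup_single_eq
    by (intro exI[of _ "f - coef G a"] exI[of _ "linear_part r (coef G a)"])
      (simp add: linear_part_diff linear_part_fiber[OF f(1)])
qed

end

locale adapted_valuation = sym_valuation r w for r and w :: "(nat, 'k::field) mpoly \<Rightarrow> ereal" +
  fixes \<beta> :: "nat \<Rightarrow> (nat, 'k) mpoly"
  assumes \<beta>_fiber: "k < r \<Longrightarrow> \<beta> k \<in> fiber r"
    and \<beta>_finite: "k < r \<Longrightarrow> \<exists>x::real. w (\<beta> k) = ereal x"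
    and \<beta>_surj: "f \<in> Sym r \<Longrightarrow> \<exists>g\<in>pring {..<r}. f = poly_subst pconst \<beta> g"
    and \<beta>_min: "g \<in> pring {..<r} \<Longrightarrow> g \<noteq> 0 \<Longrightarrow> w (poly_subst pconst \<beta> g)
      = Min ((\<lambda>\<alpha>. w (monomial_at \<beta> \<alpha>)) ` supp g)"
begin

definition linear_poly :: "(nat, 'k) mpoly \<Rightarrow> (nat, 'k) mpoly" where
  "linear_poly g = (\<Sum>k<r. pconst (coef g (single k 1)) * pvar k)"

lemma linear_poly_pring: "linear_poly g \<in> pring {..<r}"
  unfolding linear_poly_def by (intro pring_closed) auto

lemma keys_linear_poly: "supp (linear_poly g) \<subseteq> supp g \<inter> (\<lambda>k. single k 1) ` {..<r}"
proof
  fix \<alpha> assume "\<alpha> \<in> supp (linear_poly g)"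
  then obtain k where k: "k < r" "\<alpha> \<in> supp (pconst (coef g (single k 1)) * pvar k :: (nat, 'k) mpoly)"
    unfolding linear_poly_def using Poly_Mapping.keys_sum[of "\<lambda>k. pconst (coef g (single k 1)) * pvar k :: (nat, 'k) mpoly" "{..<r}"] by blast
  then have "\<alpha> = single k 1" "coef g (single k 1) \<noteq> 0"
    by (auto simp: pconst_def pvar_def mult_single split: if_splits)
  then show "\<alpha> \<in> supp g \<inter> (\<lambda>k. single k 1) ` {..<r}"
    using k by (auto simp: in_keys_iff)
qed

lemma subst_linear_poly:
  assumes "g \<in> pring {..<r}"
  shows "poly_subst pconst \<beta> (linear_poly g) = linear_part r (poly_subst pconst \<beta> g)"
proof -
  interpret comm_ring_hom "poly_subst pconst \<beta>" by (intro comm_ring_hom_poly_subst comm_ring_hom_pconst)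
  show ?thesis
    by (simp add: linear_part_subst[OF assms \<beta>_fiber] linear_poly_def hom_sum hom_mult poly_subst_pconst poly_subst_pvar pscale_eq)
qed

text \<open>The linear part of \<open>h\<close> collects the terms of degree one in the expansion of \<open>h\<close> in the adapted basis, so its
  value is a minimum over fewer terms.\<close>

lemma w_linear_part:
  assumes "h \<in> Sym r"
  shows "w h \<le> w (linear_part r h)"
proof -
  obtain g where g: "g \<in> pring {..<r}" "h = poly_subst pconst \<beta> g"
    using \<beta>_surj assms by blast
  show ?thesis
  proof (cases "linear_poly g = 0")
    case True
    then have "linear_part r h = 0"
      using subst_linear_poly[OF g(1)] g(2) by (simp add: poly_subst_def)
    then show ?thesis by (simp add: w_0)
  next
    case False
    then have "supp (linear_poly g) \<noteq> {}" "g \<noteq> 0"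
      using keys_linear_poly[of g] by auto
    then show ?thesis
      unfolding g(2) subst_linear_poly[OF g(1), symmetric] \<beta>_min[OF g(1) \<open>g \<noteq> 0\<close>] \<beta>_min[OF linear_poly_pring False]
      using keys_linear_poly[of g] by (intro Min_antimono) auto
  qed
qed

lemma w_fiber_values:
  assumes f: "f \<in> fiber r" "f \<noteq> 0"
  shows "w f \<in> w ` \<beta> ` {..<r}"
proof -
  obtain g where g: "g \<in> pring {..<r}" "f = poly_subst pconst \<beta> g"
    using \<beta>_surj fiber_Sym f by blast
  have eq: "f = poly_subst pconst \<beta> (linear_poly g)"
    using subst_linear_poly[OF g(1)] g(2) linear_part_fiber[OF f(1)] by simp
  then have nz: "linear_poly g \<noteq> 0"
    using f(2) by (auto simp: poly_subst_def)
  have "w f \<in> (\<lambda>\<alpha>. w (monomial_at \<beta> \<alpha>)) ` supp (linear_poly g)"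
    using \<beta>_min[OF linear_poly_pring nz] nz unfolding eq[symmetric] by simp
  then show ?thesis
    using keys_linear_poly[of g] by (auto simp: monomial_at_single)
qed

text \<open>Subtracting a combination of generators of value \<open>w f\<close> leaves a linear form of larger value, and
  linear forms have only finitely many values.\<close>

theorem khovanskii_fiber:
  assumes B: "B \<subseteq> fiber r - {0}"
    and gen: "generate_ring (assoc_graded (Sym r) w)
      (graded_class (Sym r) w ` (B \<union> (pconst ` (UNIV - {0})))) = carrier (assoc_graded (Sym r) w)"
    and f: "f \<in> fiber r" "f \<noteq> 0"
  shows "f \<in> pm.span {x\<in>B. w f \<le> w x}"
  using f
proof (induction "card {t \<in> w ` \<beta> ` {..<r}. w f < t}" arbitrary: f rule: less_induct)
  case less
  obtain a :: real where a: "w f = ereal a"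
    using w_finite fiber_Sym less.prems by blast
  obtain h s where h: "h \<in> Sym r" "ereal a < w h" "s \<in> pm.span {x\<in>B. w x = ereal a}" "linear_part r h = f - s"
    using leading_form[OF B gen less.prems(1) a] by blast
  have "{x\<in>B. w x = ereal a} \<subseteq> {x\<in>B. w f \<le> w x}"
    using a by auto
  from pm.span_mono[OF this] have s: "s \<in> pm.span {x\<in>B. w f \<le> w x}"
    using h(3) by blast
  have sf: "s \<in> fiber r"
    using h(3) B pm.span_mono[of "{x\<in>B. w x = ereal a}" "fiber r"] unfolding fiber_def by (auto simp: pm.span_span)
  have "f - s \<in> pm.span {x\<in>B. w f \<le> w x}"
  proof (cases "f - s = 0")
    case True
    then show ?thesis by (simp add: pm.span_zero)
  next
    case False
    have fs: "f - s \<in> fiber r"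
      using less.prems(1) sf unfolding fiber_def by (rule pm.span_diff)
    have lt: "w f < w (f - s)"
      using w_linear_part[OF h(1)] h a by auto
    have "{t \<in> w ` \<beta> ` {..<r}. w (f - s) < t} \<subset> {t \<in> w ` \<beta> ` {..<r}. w f < t}"
      using lt w_fiber_values[OF fs False] by auto
    then have "f - s \<in> pm.span {x\<in>B. w (f - s) \<le> w x}"
      by (intro less.hyps psubset_card_mono fs False) auto
    then show ?thesis
      using pm.span_mono[of "{x\<in>B. w (f - s) \<le> w x}" "{x\<in>B. w f \<le> w x}"] lt by fastforce
  qed
  then show ?case
    using pm.span_add[OF _ s] by force
qed

end

section \<open>The Cox ring of a uniform bundle\<close>

lemma Inl_XY [simp]: "Inl i \<in> XY n m \<longleftrightarrow> i < n" and Inr_XY [simp]: "Inr j \<in> XY n m \<longleftrightarrow> j < m"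
  by (auto simp: XY_def)

text \<open>What remains of the toric geometry: one valuation \<open>w i\<close> with an adapted basis \<open>\<beta> i\<close> for each ray, and the
  Khovanskii property in degree one.\<close>

locale uniform_bundle = generic_relations n m d D c
  for n m d :: nat and D :: "nat \<Rightarrow> nat \<Rightarrow> int" and c :: "nat \<Rightarrow> nat \<Rightarrow> 'k::field" +
  fixes r :: nat and w :: "nat \<Rightarrow> (nat, 'k) mpoly \<Rightarrow> ereal" and b :: "nat \<Rightarrow> (nat, 'k) mpoly"
    and \<beta> :: "nat \<Rightarrow> nat \<Rightarrow> (nat, 'k) mpoly"
  assumes adapted: "i < n \<Longrightarrow> adapted_valuation r (w i) (\<beta> i)"
    and \<beta>_integral: "i < n \<Longrightarrow> k < r \<Longrightarrow> \<exists>z::int. w i (\<beta> i k) = ereal (of_int z)"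
    and b_fiber: "j < m \<Longrightarrow> b j \<in> fiber r"
    and b_value: "i < n \<Longrightarrow> j < m \<Longrightarrow> w i (b j) = ereal (of_int (D i j))"
    and b_span: "fiber r \<subseteq> pm.span (b ` {..<m})"
    and khovanskii: "i < n \<Longrightarrow> f \<in> fiber r \<Longrightarrow> f \<noteq> 0 \<Longrightarrow> f \<in> pm.span {x \<in> b ` {..<m}. w i f \<le> w i x}"
    and relations: "(\<Sum>j<m. pscale (x j) (b j)) = 0 \<longleftrightarrow> (\<exists>y. \<forall>j<m. x j = (\<Sum>k<d. y k * c k j))"
    and rank: "r + d = m"
    and row_zero: "i < n \<Longrightarrow> \<exists>j<m. D i j = 0"
begin

abbreviation \<Phi> :: "(nat + nat, 'k) mpoly \<Rightarrow> 'k laurent" where "\<Phi> \<equiv> stratum_subst n D {} b"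

abbreviation P :: "(nat + nat, 'k) mpoly set" where "P \<equiv> pring (XY n m)"

sublocale \<Phi>: comm_ring_hom \<Phi> by (rule comm_ring_hom_stratum_subst)

definition cox :: "'k laurent set" where
  "cox = {F. \<forall>a\<in>supp F. supp a \<subseteq> {..<n} \<and> coef F a \<in> Sym r \<and>
     (\<forall>i<n. ereal (of_int (coef a i)) \<le> w i (coef F a))}"

lemma sym_valuation_at_ray: "i < n \<Longrightarrow> sym_valuation r (w i)"
  using adapted adapted_valuation.axioms(1) by blast

text \<open>The element 0 is admitted in every degree, also for exponents outside the \<open>n\<close> torus variables, so that
  each piece is an additive group.\<close>

definition cox_piece :: "(nat \<Rightarrow>\<^sub>0 int) \<Rightarrow> (nat, 'k) mpoly set" where
  "cox_piece a = {f. f \<noteq> 0 \<longrightarrow> supp a \<subseteq> {..<n} \<and> f \<in> Sym r \<and>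
     (\<forall>i<n. ereal (of_int (coef a i)) \<le> w i f)}"

lemma cox_iff: "F \<in> cox \<longleftrightarrow> (\<forall>a. coef F a \<in> cox_piece a)"
  by (auto simp: cox_def cox_piece_def in_keys_iff)

lemma cox_pieceI: "supp a \<subseteq> {..<n} \<Longrightarrow> f \<in> Sym r \<Longrightarrow>
    (\<And>i. i < n \<Longrightarrow> ereal (of_int (coef a i)) \<le> w i f) \<Longrightarrow> f \<in> cox_piece a"
  by (auto simp: cox_piece_def)

lemma cox_piece_0: "0 \<in> cox_piece a"
  by (simp add: cox_piece_def)

lemma cox_piece_diff: "f \<in> cox_piece a \<Longrightarrow> g \<in> cox_piece a \<Longrightarrow> f - g \<in> cox_piece a"
proof -
  assume *: "f \<in> cox_piece a" "g \<in> cox_piece a"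
  show ?thesis
  proof (cases "f = 0 \<and> g = 0")
    case False
    have ge: "ereal (of_int (coef a i)) \<le> w i 0" if "i < n" for i
      using sym_valuation.w_0[OF sym_valuation_at_ray[OF that]] by simp
    from False * have "supp a \<subseteq> {..<n}" "f \<in> Sym r" "g \<in> Sym r"
      "\<forall>i<n. ereal (of_int (coef a i)) \<le> w i f \<and> ereal (of_int (coef a i)) \<le> w i g"
      using ge by (auto simp: cox_piece_def)
    then show ?thesis
      using sym_valuation.w_diff_ge[OF sym_valuation_at_ray] by (intro cox_pieceI pring_diff) auto
  qed (simp add: cox_piece_0)
qed

lemma cox_piece_mult:
  assumes "f \<in> cox_piece a" "g \<in> cox_piece a'"
  shows "f * g \<in> cox_piece (a + a')"
proof (cases "f = 0 \<or> g = 0")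
  case False
  with assms have *: "supp a \<subseteq> {..<n}" "supp a' \<subseteq> {..<n}" "f \<in> Sym r" "g \<in> Sym r"
      "\<And>i. i < n \<Longrightarrow> ereal (of_int (coef a i)) \<le> w i f"
      "\<And>i. i < n \<Longrightarrow> ereal (of_int (coef a' i)) \<le> w i g"
    by (auto simp: cox_piece_def)
  show ?thesis
  proof (rule cox_pieceI)
    show "supp (a + a') \<subseteq> {..<n}"
      using * Poly_Mapping.keys_add[of a a'] by blast
    show "f * g \<in> Sym r" using * by (simp add: pring_mult)
    fix i assume "i < n"
    then show "ereal (of_int (coef (a + a') i)) \<le> w i (f * g)"
      using add_mono[OF *(5,6)] sym_valuation.w_mult[OF sym_valuation_at_ray] * by (simp add: lookup_add)
  qed
qed (auto simp: cox_piece_0)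

lemma cox_single: "f \<in> cox_piece a \<Longrightarrow> single a f \<in> cox"
  by (auto simp: cox_iff lookup_single when_def cox_piece_0)

lemma subring_set_cox: "subring_set cox"
  unfolding subring_set_def
proof (intro conjI ballI)
  have "(1 :: (nat, 'k) mpoly) \<in> cox_piece 0"
    using sym_valuation.w_one[OF sym_valuation_at_ray] by (intro cox_pieceI) (auto simp: zero_ereal_def)
  then show "1 \<in> cox" using cox_single[of 1 0] by simp
  fix F G assume *: "F \<in> cox" "G \<in> cox"
  show "F - G \<in> cox"
    using * by (auto simp: cox_iff lookup_minus intro: cox_piece_diff)
  have "coef (F * G) a \<in> cox_piece a" for a
    by (rule graded_mult[where P = cox_piece and Q = cox_piece])
      (use * cox_piece_0 cox_piece_mult cox_piece_diff[OF _ cox_piece_diff[OF cox_piece_0]] in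
        \<open>fastforce simp: cox_iff\<close>)+
  then show "F * G \<in> cox" by (simp add: cox_iff)
qed

lemma keys_tdeg: "supp (tdeg n D j) \<subseteq> {..<n}"
  by (auto simp: in_keys_iff lookup_tdeg split: if_splits)

lemma image_subset_cox: "\<Phi> ` P \<subseteq> cox"
proof
  note closed = subring_set_closed[OF subring_set_cox]
  fix F assume "F \<in> \<Phi> ` P"
  then obtain f where f: "f \<in> P" "F = \<Phi> f" by auto
  have "\<Phi> f \<in> cox"
    using f(1)
  proof (induction rule: pring_induct)
    case (const c)
    show ?case
      unfolding stratum_subst_pconst lconst_def
      by (intro cox_single, cases "c = 0")
        (auto simp: cox_piece_0 sym_valuation.w_pconst[OF sym_valuation_at_ray] zero_ereal_def intro!: cox_pieceI)
  next
    case (var x)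
    then consider i where "x = Inl i" "i < n" | j where "x = Inr j" "j < m" by (auto simp: XY_def)
    then show ?case
    proof cases
      case 1
      then show ?thesis
        by (auto simp: stratum_subst_Inl sym_valuation.w_one[OF sym_valuation_at_ray] lookup_single when_def zero_ereal_def
            intro!: cox_single cox_pieceI)
    next
      case 2
      then show ?thesis
        using keys_tdeg by (auto simp: stratum_subst_Inr b_value lookup_tdeg fiber_Sym b_fiber intro!: cox_single cox_pieceI)
    qed
  qed (auto simp: \<Phi>.hom_add \<Phi>.hom_mult closed)
  then show "F \<in> cox" using f by simp
qed

lemma subring_set_image: "subring_set (\<Phi> ` P)"
  unfolding subring_set_def
proof (intro conjI ballI)
  show "1 \<in> \<Phi> ` P" by (rule image_eqI[of _ _ 1]) auto
  fix F G assume "F \<in> \<Phi> ` P" "G \<in> \<Phi> ` P"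
  then obtain f g where *: "f \<in> P" "g \<in> P" "F = \<Phi> f" "G = \<Phi> g" by auto
  show "F - G \<in> \<Phi> ` P" by (rule image_eqI[of _ _ "f - g"]) (use * in \<open>auto simp: \<Phi>.hom_minus pring_diff\<close>)
  show "F * G \<in> \<Phi> ` P" by (rule image_eqI[of _ _ "f * g"]) (use * in \<open>auto simp: \<Phi>.hom_mult pring_mult\<close>)
qed

lemma \<Phi>X: "\<Phi> (X i) = single (single i (-1)) 1"
  by (simp add: stratum_subst_Inl)

lemma \<Phi>X_nonzero: "\<Phi> (X i) \<noteq> 0"
  by (simp add: \<Phi>X)

lemma Y_in_P: "Y j \<in> P \<longleftrightarrow> j < m"
  by simp

lemma \<Phi>X_power: "\<Phi> (X i) ^ k * single (single i (int k)) 1 = 1"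
proof -
  have "(\<Sum>_<k. single i (-1::int)) + single i (int k) = 0"
    by (rule poly_mapping_eqI) (unfold lookup_add lookup_sum lookup_single, simp add: when_def)
  then show ?thesis
    by (simp add: \<Phi>X power_single mult_single)
qed

text \<open>Membership in the image after the \<open>X i\<close> with \<open>i \<notin> W\<close> are inverted.\<close>

definition localized_image :: "nat set \<Rightarrow> 'k laurent set" where
  "localized_image W = {F. \<exists>N. \<Phi> (tmon W) ^ N * F \<in> \<Phi> ` P}"

lemma tmon_P: "tmon W \<in> P"
  unfolding tmon_def by (intro pring_prod) auto

lemma subring_set_localized_image: "subring_set (localized_image W)"
  unfolding subring_set_def
proof (intro conjI ballI)
  note closed = subring_set_closed[OF subring_set_image]
  show "1 \<in> localized_image W" unfolding localized_image_def using closed(1) by (auto intro!: exI[of _ 0])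
  fix F G assume "F \<in> localized_image W" "G \<in> localized_image W"
  then obtain N N' where *: "\<Phi> (tmon W) ^ N * F \<in> \<Phi> ` P" "\<Phi> (tmon W) ^ N' * G \<in> \<Phi> ` P"
    by (auto simp: localized_image_def)
  have pw: "\<Phi> (tmon W) ^ k \<in> \<Phi> ` P" for k
    using tmon_P by (auto simp: \<Phi>.hom_power[symmetric] intro: pring_power)
  have "\<Phi> (tmon W) ^ (N + N') * (F - G) = \<Phi> (tmon W) ^ N' * (\<Phi> (tmon W) ^ N * F) - \<Phi> (tmon W) ^ N * (\<Phi> (tmon W) ^ N' * G)"
    by (simp add: algebra_simps power_add)
  also have "\<dots> \<in> \<Phi> ` P" by (intro closed(5,6) pw *)
  finally show "F - G \<in> localized_image W" unfolding localized_image_def by blast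
  have "\<Phi> (tmon W) ^ (N + N') * (F * G) = (\<Phi> (tmon W) ^ N * F) * (\<Phi> (tmon W) ^ N' * G)"
    by (simp add: algebra_simps power_add)
  also have "\<dots> \<in> \<Phi> ` P" by (intro closed(6) *)
  finally show "F * G \<in> localized_image W" unfolding localized_image_def by blast
qed

lemma image_subset_localized_image: "\<Phi> ` P \<subseteq> localized_image W"
  unfolding localized_image_def by (auto intro!: exI[of _ 0])

lemma subring_set_prod: "subring_set S \<Longrightarrow> (\<And>x. x \<in> A \<Longrightarrow> F x \<in> S) \<Longrightarrow> (\<Prod>x\<in>A. F x) \<in> S"
  by (induction A rule: infinite_finite_induct) (auto simp: subring_set_closed)

lemma subring_set_sum: "subring_set S \<Longrightarrow> (\<And>x. x \<in> A \<Longrightarrow> F x \<in> S) \<Longrightarrow> (\<Sum>x\<in>A. F x) \<in> S"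
  by (induction A rule: infinite_finite_induct) (auto simp: subring_set_closed)

lemma subring_set_power: "subring_set S \<Longrightarrow> x \<in> S \<Longrightarrow> x ^ k \<in> S"
  by (induction k) (auto simp: subring_set_closed)

lemma lconst_localized: "lconst x \<in> localized_image W"
  using image_subset_localized_image[of W] stratum_subst_pconst[of n D "{}" b x, symmetric] by (metis image_subset_iff pring_pconst)

lemma torus_localized:
  assumes a: "supp a \<subseteq> {..<n}" and W: "\<And>i. i \<in> W \<Longrightarrow> coef a i \<le> 0"
  shows "single a 1 \<in> localized_image W"
proof -
  have "single (single i z) 1 \<in> localized_image W" if i: "i < n" and z: "i \<in> W \<longrightarrow> z \<le> 0" for i z
  proof (cases "z \<le> 0")
    case True
    have "(\<Sum>_<nat (- z). single i (-1::int)) = single i z"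
      using True by (intro poly_mapping_eqI) (unfold lookup_sum lookup_single, simp add: when_def)
    then have "single (single i z) 1 = \<Phi> (X i ^ nat (- z))"
      by (simp add: \<Phi>.hom_power \<Phi>X power_single)
    moreover have "X i ^ nat (- z) \<in> P"
      using i by (intro pring_power) simp
    ultimately show ?thesis
      using image_subset_localized_image[of W] by auto
  next
    case False
    then have iW: "i \<in> {..<n} - W" using i z by auto
    define k where "k = nat z"
    have k: "z = int k" using False by (simp add: k_def)
    define R where "R = (\<Prod>l\<in>{..<n} - W - {i}. X l)"
    have "tmon W = X i * R"
      unfolding tmon_def R_def using iW by (subst prod.remove[of _ i]) auto
    then have "\<Phi> (tmon W) ^ k * single (single i z) 1 = \<Phi> (R ^ k)"
      using \<Phi>X_power[of i k] by (simp add: k \<Phi>.hom_mult \<Phi>.hom_power power_mult_distrib mult_ac)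
    moreover have "R ^ k \<in> P"
      unfolding R_def by (intro pring_power pring_prod) auto
    ultimately show ?thesis unfolding localized_image_def by blast
  qed
  then have "(\<Prod>i<n. single (single i (coef a i)) 1) \<in> localized_image W"
    using W by (intro subring_set_prod[OF subring_set_localized_image]) auto
  moreover have "(\<Sum>i<n. single i (coef a i)) = a"
    using a by (intro poly_mapping_eqI) (auto simp: lookup_sum lookup_single when_def in_keys_iff)
  ultimately show ?thesis
    by (simp add: prod_single)
qed

text \<open>Once the other \<open>X l\<close> are invertible, only the condition at the ray \<open>i\<close> remains. The adapted basis \<open>\<beta> i\<close>
  reduces it to monomials in the \<open>\<beta> i k\<close>, and by the Khovanskii property \<open>\<beta> i k\<close> is a combination of
  those \<open>b j\<close> whose value at \<open>i\<close> is at least as large.\<close>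

lemma cox_subset_localized_image:
  assumes i: "i < n" and F: "F \<in> cox"
  shows "F \<in> localized_image {i}"
proof -
  interpret adapted_valuation r "w i" "\<beta> i" by (rule adapted[OF i])
  note closed = subring_set_closed[OF subring_set_localized_image[of "{i}"]]
  obtain z where z: "\<And>k. k < r \<Longrightarrow> w i (\<beta> i k) = ereal (of_int (z k))"
    using \<beta>_integral[OF i] by metis
  have beta: "single (single i (z k)) (\<beta> i k) \<in> localized_image {i}" if k: "k < r" for k
  proof -
    have "\<beta> i k \<noteq> 0" using \<beta>_finite[OF k] w_0 by auto
    then have "\<beta> i k \<in> pm.span {x \<in> b ` {..<m}. ereal (of_int (z k)) \<le> w i x}"
      using khovanskii[OF i \<beta>_fiber[OF k]] z[OF k] by simp
    then show ?thesis
    proof (induction rule: pm.span_induct_alt)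
      case base
      then show ?case by (simp add: closed)
    next
      case (step c x y)
      then obtain j where j: "j < m" "x = b j" "z k \<le> D i j"
        using b_value[OF i] by auto
      have "single (single i (z k)) (b j)
          = \<Phi> (Y j) * single (single i (z k) - tdeg n D j) 1"
        by (simp add: stratum_subst_Inr mult_single)
      also have "\<dots> \<in> localized_image {i}"
      proof (rule closed)
        show "\<Phi> (Y j) \<in> localized_image {i}" using image_subset_localized_image[of "{i}"] j by auto
        show "single (single i (z k) - tdeg n D j) 1 \<in> localized_image {i}"
          using i j by (intro torus_localized) (auto simp: in_keys_iff lookup_minus lookup_tdeg lookup_single when_def split: if_splits)
      qed
      finally have "single (single i (z k)) (b j) \<in> localized_image {i}" .
      moreover have "single (single i (z k)) (pscale c x + y)
          = lconst c * single (single i (z k)) (b j) + single (single i (z k)) y"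
        by (simp add: j pscale_eq lconst_def mult_single single_add)
      ultimately show ?case
        using step lconst_localized by (simp add: closed)
    qed
  qed
  have mono: "single a (monomial_at (\<beta> i) \<alpha>) \<in> localized_image {i}"
    if \<alpha>: "supp \<alpha> \<subseteq> {..<r}" and a: "supp a \<subseteq> {..<n}" 
      "ereal (of_int (coef a i)) \<le> w i (monomial_at (\<beta> i) \<alpha>)" for a \<alpha>
  proof -
    define s where "s = (\<Sum>k\<in>supp \<alpha>. int (coef \<alpha> k) * z k)"
    have "w i (monomial_at (\<beta> i) \<alpha>) = ereal (\<Sum>k\<in>supp \<alpha>. real (coef \<alpha> k) * of_int (z k))"
      unfolding monomial_at_def using \<alpha> z by (intro w_prod_power) (auto intro: fiber_Sym[OF \<beta>_fiber])
    then have s: "coef a i \<le> s"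
      using a(2) by (simp add: s_def) (metis (mono_tags, lifting) of_int_le_iff of_int_sum of_int_mult of_int_of_nat_eq sum.cong)
    have eq: "(\<Sum>k\<in>supp \<alpha>. \<Sum>_<coef \<alpha> k. single i (z k)) = single i s"
      unfolding s_def by (intro poly_mapping_eqI) (unfold lookup_sum lookup_single, auto simp: when_def)
    have "(\<Prod>k\<in>supp \<alpha>. single (single i (z k)) (\<beta> i k) ^ coef \<alpha> k) \<in> localized_image {i}"
      using \<alpha> beta by (intro subring_set_prod subring_set_power subring_set_localized_image) auto
    then have "single (single i s) (monomial_at (\<beta> i) \<alpha>) \<in> localized_image {i}"
      by (simp only: power_single prod_single eq monomial_at_def)
    moreover have "single (a - single i s) 1 \<in> localized_image {i}"
      using i a s by (intro torus_localized) (auto simp: in_keys_iff lookup_minus lookup_single when_def split: if_splits)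
    ultimately have "single (single i s) (monomial_at (\<beta> i) \<alpha>)
        * single (a - single i s) 1 \<in> localized_image {i}"
      by (rule closed)
    then show ?thesis by (simp add: mult_single)
  qed
  have "single a (coef F a) \<in> localized_image {i}" if aF: "a \<in> supp F" for a
  proof -
    let ?f = "coef F a"
    have a: "supp a \<subseteq> {..<n}" "?f \<in> Sym r" "ereal (of_int (coef a i)) \<le> w i ?f" "?f \<noteq> 0"
      using F aF i by (auto simp: cox_def in_keys_iff)
    obtain g where g: "g \<in> pring {..<r}" "?f = poly_subst pconst (\<beta> i) g"
      using \<beta>_surj[OF a(2)] by blast
    have "g \<noteq> 0" using a(4) g(2) by (auto simp: poly_subst_def)
    have "w i ?f \<le> w i (monomial_at (\<beta> i) \<alpha>)" if "\<alpha> \<in> supp g" for \<alpha>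
      unfolding g(2) \<beta>_min[OF g(1) \<open>g \<noteq> 0\<close>] using that by (intro Min_le) auto
    then have *: "single a (monomial_at (\<beta> i) \<alpha>) \<in> localized_image {i}" if "\<alpha> \<in> supp g" for \<alpha>
      using that g(1) a by (intro mono) (auto simp: pring_def intro: order_trans[OF a(3)])
    have "single a ?f = (\<Sum>\<alpha>\<in>supp g. lconst (coef g \<alpha>) * single a (monomial_at (\<beta> i) \<alpha>))"
      unfolding g(2) poly_subst_def sum_single_eq[symmetric] by (simp add: lconst_def mult_single)
    also have "\<dots> \<in> localized_image {i}"
      using * lconst_localized by (intro subring_set_sum[OF subring_set_localized_image] closed)
    finally show ?thesis .
  qed
  then have "(\<Sum>a\<in>supp F. single a (coef F a)) \<in> localized_image {i}"
    by (intro subring_set_sum[OF subring_set_localized_image])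
  then show ?thesis
    using pm_sum_single[of F] by simp
qed

text \<open>Without rays no index \<open>i\<close> can be singled out as before; then it suffices that the \<open>b j\<close> span the fiber.\<close>

lemma cox_subset_image_no_rays:
  assumes "n = 0"
  shows "cox \<subseteq> \<Phi> ` P"
proof
  note closed = subring_set_closed[OF subring_set_image]
  have const: "lconst x \<in> \<Phi> ` P" for x
    by (metis image_eqI pring_pconst stratum_subst_pconst)
  fix F assume F: "F \<in> cox"
  have Sym: "single 0 f \<in> \<Phi> ` P" if "f \<in> Sym r" for f
    using that
  proof (induction rule: pring_induct)
    case (const c)
    show ?case using \<open>\<And>x. lconst x \<in> \<Phi> ` P\<close>[of c] by (simp add: lconst_def)
  next
    case (var k)
    then have "pvar k \<in> fiber r" unfolding fiber_def by (auto intro: pm.span_base)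
    then have "pvar k \<in> pm.span (b ` {..<m})" using b_span by blast
    then show ?case
    proof (induction rule: pm.span_induct_alt)
      case base
      then show ?case by (simp add: closed)
    next
      case (step c x y)
      then obtain j where j: "j < m" "x = b j" by auto
      have "\<Phi> (Y j) = single 0 x"
        using j by (simp add: stratum_subst_Inr tdeg_def assms)
      then have "single 0 x \<in> \<Phi> ` P"
        using j by (metis image_eqI Y_in_P)
      moreover have "single 0 (pscale c x + y) = lconst c * single 0 x + single 0 y"
        by (simp add: pscale_eq lconst_def mult_single single_add)
      ultimately show ?case
        using step const by (simp add: closed)
    qed
  next
    case (mult f g)
    then show ?case using closed(6)[of "single 0 f" "single 0 g"] by (simp add: mult_single)
  qed (simp add: single_add closed)
  have "single a (coef F a) \<in> \<Phi> ` P" if "a \<in> supp F" for a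
  proof -
    have "supp a \<subseteq> {..<n}" and f: "coef F a \<in> Sym r"
      using F that by (auto simp: cox_def)
    then have "a = 0" using assms by simp
    then show ?thesis using Sym[OF f] by simp
  qed
  then have "(\<Sum>a\<in>supp F. single a (coef F a)) \<in> \<Phi> ` P"
    by (intro subring_set_sum[OF subring_set_image])
  then show "F \<in> \<Phi> ` P"
    using pm_sum_single[of F] by simp
qed

lemma zcols_empty: "zcols {} = {..<m}"
  by (auto simp: zcols_def)

lemma b_relation: "k < d \<Longrightarrow> (\<Sum>j<m. pconst (c k j) * b j) = 0"
proof -
  assume k: "k < d"
  have "\<forall>j<m. c k j = (\<Sum>k'<d. (if k' = k then 1 else 0) * c k' j)"
    using k by (simp add: if_distrib[of "\<lambda>x. x * _"] cong: if_cong)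
  then have "\<exists>y. \<forall>j<m. c k j = (\<Sum>k'<d. y k' * c k' j)"
    by (rule exI[of _ "\<lambda>k'. if k' = k then 1 else 0"])
  then have "(\<Sum>j<m. pscale (c k j) (b j)) = 0"
    unfolding relations .
  then show ?thesis
    by (simp add: pscale_eq)
qed

lemma \<Phi>_vanishes: "f \<in> idl.span (rel ` {..<d}) \<Longrightarrow> \<Phi> f = 0"
  using stratum_subst_vanishes[of "{}" d b f] b_relation by (simp add: zcols_empty)

lemma rel_P: "rel k \<in> P"
  unfolding rel_def colmon_def by (intro pring_sum pring_mult pring_prod pring_power) auto

text \<open>A polynomial that vanishes under the substitution of \<open>b\<close> also vanishes under every substitution of
  elements that satisfy the same linear relations, in particular for a solution in which \<open>r\<close> of the
  elements are independent variables.\<close>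

lemma kernel_saturation:
  assumes f: "f \<in> P" and 0: "\<Phi> f = 0"
  shows "\<exists>N. tmon {} ^ N * f \<in> stratum_ideal {} d"
proof -
  interpret pc: comm_ring_hom "pconst :: 'k \<Rightarrow> (nat, 'k) mpoly" by (rule comm_ring_hom_pconst)
  have "d \<le> m" using rank by simp
  then obtain b' where s: "solved {} d {..<d} b'"
    using solved_exists[of d "{..<d}" "{}"] zcols_empty by auto
  have rel': "(\<Sum>j<m. pconst (c k j) * b' j) = 0" if "k < d" for k
    using s that by (simp add: solved_def zcols_empty)
  \<comment> \<open>a substitution that carries the spanning set \<open>b\<close> to the solution \<open>b'\<close> of the same relations\<close>
  have "\<exists>a. pvar k = (\<Sum>j<m. pscale (a j) (b j))" if "k < r" for k
  proof -
    have "pvar k \<in> fiber r" unfolding fiber_def using that by (auto intro: pm.span_base)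
    then have "pvar k \<in> pm.span (b ` {..<m})" using b_span by blast
    then show ?thesis
    proof (induction rule: pm.span_induct_alt)
      case base
      show ?case by (intro exI[of _ "\<lambda>_. 0"]) simp
    next
      case (step x y z)
      then obtain i a where i: "i < m" "y = b i" "z = (\<Sum>j<m. pscale (a j) (b j))" by auto
      have "pscale x y = (\<Sum>j<m. pscale (if j = i then x else 0) (b j))"
        using i by (simp add: if_distrib[of "\<lambda>x. pscale x _"] cong: if_cong)
      then have "pscale x y + z = (\<Sum>j<m. pscale ((if j = i then x else 0) + a j) (b j))"
        using i by (simp only: pm.scale_left_distrib sum.distrib)
      then show ?case by (rule exI[of _ "\<lambda>j. (if j = i then x else 0) + a j"])
    qed
  qed
  then obtain a where a: "\<And>k. k < r \<Longrightarrow> pvar k = (\<Sum>j<m. pscale (a k j) (b j))" by metis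
  define \<eta> where "\<eta> k = (\<Sum>j<m. pscale (a k j) (b' j))" for k
  let ?H = "poly_subst pconst \<eta>"
  interpret H: comm_ring_hom ?H by (intro comm_ring_hom_poly_subst comm_ring_hom_pconst)
  have H: "?H (b j) = b' j" if j: "j < m" for j
  proof -
    define x where "x k = coef (b j) (single k 1)" for k
    have bj: "b j = (\<Sum>k<r. pscale (x k) (pvar k))"
      using linear_part_fiber(1)[OF b_fiber[OF j]] by (simp add: linear_part_def x_def)
    define e where "e j' = (\<Sum>k<r. x k * a k j')" for j'
    have swap: "(\<Sum>k<r. pscale (x k) (\<Sum>j'<m. pscale (a k j') (g j'))) = (\<Sum>j'<m. pscale (e j') (g j'))" for g :: "nat \<Rightarrow> (nat, 'k) mpoly"
      unfolding e_def pm.scale_sum_right pm.scale_sum_left by (subst sum.swap) (simp add: pm.scale_scale)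
    have "b j = (\<Sum>k<r. pscale (x k) (\<Sum>j'<m. pscale (a k j') (b j')))"
      unfolding bj by (intro sum.cong) (auto simp: a[symmetric])
    then have "b j = (\<Sum>j'<m. pscale (e j') (b j'))"
      by (simp only: swap)
    moreover have delta: "(\<Sum>j'<m. pscale (if j' = j then 1 else 0) (g j')) = g j" for g :: "nat \<Rightarrow> (nat, 'k) mpoly"
      using j by (simp add: if_distrib[of "\<lambda>x. pscale x _"] cong: if_cong)
    ultimately have "(\<Sum>j'<m. pscale ((if j' = j then 1 else 0) - e j') (b j')) = 0"
      by (simp only: pm.scale_left_diff_distrib sum_subtractf) simp
    then obtain y where y: "\<And>j'. j' < m \<Longrightarrow> (if j' = j then 1 else 0) - e j' = (\<Sum>k<d. y k * c k j')"
      using relations[of "\<lambda>j'. (if j' = j then 1 else 0) - e j'"] by auto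
    have "(\<Sum>j'<m. pscale ((if j' = j then 1 else 0) - e j') (b' j')) = (\<Sum>j'<m. \<Sum>k<d. pconst (y k) * (pconst (c k j') * b' j'))"
      by (intro sum.cong) (auto simp: y pscale_eq pc.hom_sum pc.hom_mult sum_distrib_right mult.assoc)
    also have "\<dots> = (\<Sum>k<d. pconst (y k) * (\<Sum>j'<m. pconst (c k j') * b' j'))"
      by (subst sum.swap) (simp add: sum_distrib_left)
    also have "\<dots> = 0" by (simp add: rel')
    finally have "b' j = (\<Sum>j'<m. pscale (e j') (b' j'))"
      using delta[of b'] by (simp add: pm.scale_left_diff_distrib sum_subtractf)
    also have "\<dots> = (\<Sum>k<r. pscale (x k) (\<eta> k))"
      unfolding \<eta>_def swap ..
    also have "\<dots> = ?H (b j)"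
      unfolding bj by (simp add: H.hom_sum pscale_eq H.hom_mult poly_subst_pconst poly_subst_pvar)
    finally show ?thesis by simp
  qed
  define \<Lambda> :: "'k laurent \<Rightarrow> 'k laurent" where
    "\<Lambda> = pm_eval (\<lambda>x. single 0 (?H x)) (\<lambda>a. single a 1)"
  have h0: "comm_ring_hom (\<lambda>x. single 0 (?H x) :: 'k laurent)"
    by unfold_locales (auto simp: H.hom_add H.hom_mult single_add mult_single)
  interpret \<Lambda>: comm_ring_hom \<Lambda>
    unfolding \<Lambda>_def by (rule comm_ring_hom_pm_eval[OF h0]) (simp_all add: mult_single)
  have \<Lambda>_single: "\<Lambda> (single t x) = single t (?H x)" for t x
    unfolding \<Lambda>_def by (subst pm_eval_single) (auto simp: mult_single)
  have "stratum_subst n D {} b' f = (\<Lambda> \<circ> \<Phi>) f"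
  proof (rule pring_hom_eqI[OF comm_ring_hom_stratum_subst _ f])
    show "comm_ring_hom (\<Lambda> \<circ> \<Phi>)"
      by unfold_locales (simp_all add: \<Phi>.hom_add \<Phi>.hom_mult \<Lambda>.hom_add \<Lambda>.hom_mult)
    fix x show "stratum_subst n D {} b' (pconst x) = (\<Lambda> \<circ> \<Phi>) (pconst x)"
      by (simp add: lconst_def \<Lambda>_single poly_subst_pconst)
  next
    fix x assume "x \<in> XY n m"
    then consider i where "x = Inl i" "i < n" | j where "x = Inr j" "j < m" by (auto simp: XY_def)
    then show "stratum_subst n D {} b' (pvar x) = (\<Lambda> \<circ> \<Phi>) (pvar x)"
      by cases (simp_all add: stratum_subst_Inl stratum_subst_Inr \<Lambda>_single H)
  qed
  then have "stratum_subst n D {} b' f = 0"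
    using 0 by simp
  then show ?thesis
    using saturation[OF _ _ s] by simp
qed

text \<open>The condition on the diagram, expressed by the columns in which the rows of \<open>A\<close> vanish instead of the
  complementary ones.\<close>

definition hall_condition :: bool where
  "hall_condition \<longleftrightarrow> (\<forall>A. A \<noteq> {} \<and> A \<subseteq> {..<n} \<longrightarrow> d + 2 \<le> card (zcols A) + card A)"

lemma kernel_subset_ideal:
  assumes hall: hall_condition and f: "f \<in> P" "\<Phi> f = 0"
  shows "f \<in> idl.span (rel ` {..<d})"
proof -
  obtain N where N: "tmon {} ^ N * f \<in> stratum_ideal {} d"
    using kernel_saturation[OF f] by blast
  have "f \<in> stratum_ideal {} d"
  proof (rule tmon_cancel[OF _ N])
    fix i f assume i: "i \<in> {..<n} - {}" and f: "X i * f \<in> stratum_ideal {} d"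
    show "f \<in> stratum_ideal {} d"
    proof (rule X_nonzerodivisor[OF _ _ _ i f])
      fix A assume "A \<noteq> {}" "A \<subseteq> {..<n} - {}"
      then show "d < card (zcols ({} \<union> A)) + card A"
        using hall[unfolded hall_condition_def, rule_format, of A] by simp
    qed auto
  qed
  then show ?thesis by simp
qed

text \<open>A preimage \<open>g\<close> of \<open>X i\<close> times \<open>F\<close> lies, up to a monomial in the other \<open>X l\<close>, in the ideal generated by \<open>X i\<close>
  and the relations. That monomial cancels modulo this ideal, and the cofactor of \<open>X i\<close> is a preimage of \<open>F\<close>.\<close>

lemma divide_by_X:
  assumes hall: hall_condition and i: "i < n" and F: "F \<in> cox" and XF: "\<Phi> (X i) * F \<in> \<Phi> ` P"
  shows "F \<in> \<Phi> ` P"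
proof -
  obtain g where g: "g \<in> P" "\<Phi> (X i) * F = \<Phi> g" using XF by blast
  obtain N h where h: "h \<in> P" "\<Phi> (tmon {i}) ^ N * F = \<Phi> h"
    using cox_subset_localized_image[OF i F] unfolding localized_image_def by auto
  let ?I = "stratum_ideal {i} d"
  have "\<Phi> (tmon {i} ^ N * g - X i * h) = 0"
    unfolding \<Phi>.hom_minus \<Phi>.hom_mult \<Phi>.hom_power g(2)[symmetric] h(2)[symmetric] by (simp add: mult_ac)
  then have "tmon {i} ^ N * g - X i * h \<in> idl.span (rel ` {..<d})"
    using i g h tmon_P by (intro kernel_subset_ideal[OF hall] pring_diff pring_mult pring_power) auto
  then have "tmon {i} ^ N * g - X i * h \<in> ?I"
    using idl.span_mono[of "rel ` {..<d}" ?I] idl.span_mono[of "rel ` {..<d}" "stratum_gens {i} d"] by blast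
  moreover have "h * X i \<in> ?I"
    by (intro idl.span_scale idl.span_base) auto
  ultimately have N: "tmon {i} ^ N * g \<in> ?I"
    using idl.span_add[of "tmon {i} ^ N * g - X i * h" _ "h * X i"] by (simp add: mult.commute)
  have "g \<in> ?I"
  proof (rule tmon_cancel[OF _ N])
    fix l f assume l: "l \<in> {..<n} - {i}" and f: "X l * f \<in> ?I"
    show "f \<in> ?I"
    proof (rule X_nonzerodivisor[OF _ _ _ l f])
      fix A assume A: "A \<noteq> {}" "A \<subseteq> {..<n} - {i}"
      then have "finite A" "i \<notin> A" "insert i A \<subseteq> {..<n}" using i finite_subset by auto
      then show "d < card (zcols ({i} \<union> A)) + card A"
        using hall[unfolded hall_condition_def, rule_format, of "insert i A"] by simp
    qed (use i in auto)
  qed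
  then obtain k where k: "g - k * X i \<in> idl.span (rel ` {..<d})"
    unfolding Un_insert_left Un_empty_left image_insert image_empty idl.span_insert by auto
  interpret \<pi>: comm_ring_hom "retract (XY n m) :: (nat + nat, 'k) mpoly \<Rightarrow> _" by (rule comm_ring_hom_retract)
  let ?k = "retract (XY n m) k"
  have "retract (XY n m) (g - k * X i) \<in> idl.span (rel ` {..<d})"
    using rel_P by (intro retract_span[OF _ k]) auto
  then have "\<Phi> (g - ?k * X i) = 0"
    using \<Phi>_vanishes retract_id[OF g(1)] i by (simp add: \<pi>.hom_minus \<pi>.hom_mult retract_pvar)
  then have "\<Phi> (X i) * F = \<Phi> (X i) * \<Phi> ?k"
    using g(2) by (simp add: \<Phi>.hom_minus \<Phi>.hom_mult mult.commute)
  then have "F = \<Phi> ?k"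
    using \<Phi>X_nonzero by simp
  then show ?thesis
    using retract_pring by blast
qed

lemma cox_subset_image:
  assumes hall: hall_condition
  shows "cox \<subseteq> \<Phi> ` P"
proof (cases "n = 0")
  case True
  then show ?thesis by (rule cox_subset_image_no_rays)
next
  case False
  note closed = subring_set_closed[OF subring_set_cox]
  have X: "\<Phi> (X i) \<in> cox" if "i < n" for i
    using that image_subset_cox by auto
  have prod: "F \<in> \<Phi> ` P" if "finite S" "S \<subseteq> {..<n}" "F \<in> cox" "(\<Prod>i\<in>S. \<Phi> (X i)) * F \<in> \<Phi> ` P" for S F
    using that
  proof (induction S arbitrary: F rule: finite_induct)
    case (insert i S)
    have "\<Phi> (X i) * F \<in> \<Phi> ` P"
    proof (rule insert.IH)
      show "\<Phi> (X i) * F \<in> cox"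
        using insert.prems X by (intro closed(6)) auto
      show "(\<Prod>i\<in>S. \<Phi> (X i)) * (\<Phi> (X i) * F) \<in> \<Phi> ` P"
        using insert.prems insert.hyps by (simp add: mult_ac)
    qed (use insert.prems in auto)
    then show ?case
      using divide_by_X[OF hall, of i F] insert.prems by simp
  qed simp
  have pow: "F \<in> \<Phi> ` P" if "F \<in> cox" "\<Phi> (tmon W) ^ N * F \<in> \<Phi> ` P" for W N F
    using that
  proof (induction N arbitrary: F)
    case (Suc N)
    have t: "\<Phi> (tmon W) \<in> cox" using image_subset_cox tmon_P by auto
    have "\<Phi> (tmon W) * F \<in> \<Phi> ` P"
    proof (rule Suc.IH)
      show "\<Phi> (tmon W) * F \<in> cox"
        using Suc.prems t by (intro closed(6))
      show "\<Phi> (tmon W) ^ N * (\<Phi> (tmon W) * F) \<in> \<Phi> ` P"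
        using Suc.prems by (simp add: mult_ac)
    qed
    then have "(\<Prod>i\<in>{..<n} - W. \<Phi> (X i)) * F \<in> \<Phi> ` P"
      by (simp add: tmon_def \<Phi>.hom_prod)
    then show ?case
      using prod[of "{..<n} - W" F] Suc.prems(1) by blast
  qed simp
  show ?thesis
  proof
    fix F assume "F \<in> cox"
    then show "F \<in> \<Phi> ` P"
      using cox_subset_localized_image[of 0 F] False pow unfolding localized_image_def by blast
  qed
qed

theorem presentation_if_hall:
  assumes hall_condition
  shows "\<Phi> ` P = cox" "{f \<in> P. \<Phi> f = 0} = P \<inter> idl.span (rel ` {..<d})"
proof -
  show "\<Phi> ` P = cox"
    using cox_subset_image[OF assms] image_subset_cox by (rule equalityI[rotated])
  show "{f \<in> P. \<Phi> f = 0} = P \<inter> idl.span (rel ` {..<d})"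
    using kernel_subset_ideal[OF assms] \<Phi>_vanishes by blast
qed

end

section \<open>Necessity of the condition\<close>

lemma split_off_variable:
  assumes "f \<in> pring U" "x \<in> U"
  shows "\<exists>G H. f = G + pvar x * H \<and> G \<in> pring (U - {x}) \<and> H \<in> pring U"
  using assms(1)
proof (induction rule: pring_induct)
  case (const c)
  show ?case by (intro exI[of _ "pconst c"] exI[of _ 0]) simp
next
  case (var y)
  show ?case
  proof (cases "y = x")
    case True
    then show ?thesis by (intro exI[of _ 0] exI[of _ 1]) simp
  next
    case False
    then show ?thesis using var by (intro exI[of _ "pvar y"] exI[of _ 0]) simp
  qed
next
  case (add f g)
  then obtain G H G' H' where *: "f = G + pvar x * H" "G \<in> pring (U - {x})" "H \<in> pring U"
    "g = G' + pvar x * H'" "G' \<in> pring (U - {x})" "H' \<in> pring U" by blast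
  have "f + g = (G + G') + pvar x * (H + H')" unfolding * by (simp add: algebra_simps)
  then show ?case using * pring_add by blast
next
  case (mult f g)
  then obtain G H G' H' where *: "f = G + pvar x * H" "G \<in> pring (U - {x})" "H \<in> pring U"
    "g = G' + pvar x * H'" "G' \<in> pring (U - {x})" "H' \<in> pring U" by blast
  have U: "G \<in> pring U" "G' \<in> pring U" using * pring_mono[of "U - {x}" U] by auto
  have "f * g = G * G' + pvar x * (G * H' + H * G' + pvar x * (H * H'))"
    unfolding * by (simp add: algebra_simps)
  moreover have "G * G' \<in> pring (U - {x})" using * by (intro pring_mult)
  moreover have "G * H' + H * G' + pvar x * (H * H') \<in> pring U"
    using * U assms(2) by (intro pring_add pring_mult) auto
  ultimately show ?case by blast
qed

lemma keys_pvar_power_mult: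
  assumes "\<alpha> \<in> supp (pvar x ^ k * f)"
  shows "k \<le> coef \<alpha> x"
  using subsetD[OF keys_mult assms] by (auto simp: pvar_power lookup_add split: if_splits)

lemma factor_variable_power:
  assumes F: "F \<in> pring U" "F \<noteq> 0" and x: "x \<in> U"
  shows "\<exists>k G H. F = pvar x ^ k * (G + pvar x * H) \<and> G \<noteq> 0 \<and> G \<in> pring (U - {x}) \<and> H \<in> pring U"
proof (rule ccontr)
  assume no: "\<not> ?thesis"
  have "\<exists>H\<in>pring U. F = pvar x ^ k * H" for k
  proof (induction k)
    case 0
    then show ?case using F by auto
  next
    case (Suc k)
    then obtain H where H: "H \<in> pring U" "F = pvar x ^ k * H" by blast
    obtain G H' where G: "H = G + pvar x * H'" "G \<in> pring (U - {x})" "H' \<in> pring U"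
      using split_off_variable[OF H(1) x] by blast
    then have "G = 0" using no H by blast
    then have "F = pvar x ^ Suc k * H'" using G H by (simp add: mult_ac)
    then show ?case using G by blast
  qed
  note all = this
  obtain \<alpha> where \<alpha>: "\<alpha> \<in> supp F" using F(2) by (metis keys_eq_empty ex_in_conv)
  obtain H where "F = pvar x ^ Suc (coef \<alpha> x) * H"
    using all[of "Suc (coef \<alpha> x)"] by blast
  then show False using \<alpha> keys_pvar_power_mult[of \<alpha> x "Suc (coef \<alpha> x)" H] by auto
qed

lemma keys_fiber:
  assumes "f \<in> fiber r" "\<gamma> \<in> supp f"
  shows "\<exists>k<r. \<gamma> = single k 1"
proof -
  have "f = (\<Sum>k<r. pconst (coef f (single k 1)) * pvar k)"
    using linear_part_fiber(1)[OF assms(1)] by (simp add: linear_part_def pscale_eq)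
  then have "\<gamma> \<in> supp (\<Sum>k<r. pconst (coef f (single k 1)) * pvar k)"
    using assms(2) by simp
  then obtain k where "k < r" "\<gamma> \<in> supp (pconst (coef f (single k 1)) * pvar k)"
    using Poly_Mapping.keys_sum[of "\<lambda>k. pconst (coef f (single k 1)) * pvar k" "{..<r}"] by blast
  then show ?thesis
    by (auto simp: pconst_def pvar_def mult_single split: if_splits)
qed

definition exponent_box :: "nat \<Rightarrow> nat \<Rightarrow> nat \<Rightarrow> ((nat \<Rightarrow>\<^sub>0 int) \<times> (nat \<Rightarrow>\<^sub>0 nat)) set" where
  "exponent_box n r T = {(a, \<gamma>). supp a \<subseteq> {..<n} \<and> (\<forall>i. \<bar>coef a i\<bar> \<le> int T) \<and>
     supp \<gamma> \<subseteq> {..<r} \<and> (\<forall>k. coef \<gamma> k \<le> T)}"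

lemma sum_single_restrict:
  fixes a :: "'x \<Rightarrow>\<^sub>0 'n::comm_monoid_add"
  assumes "finite S" "supp a \<subseteq> S"
  shows "(\<Sum>x\<in>S. single x (coef a x)) = a"
proof -
  have "(\<Sum>x\<in>S. single x (coef a x)) = (\<Sum>x\<in>supp a. single x (coef a x))"
    using assms by (intro sum.mono_neutral_right) (auto simp: in_keys_iff)
  then show ?thesis by (simp add: poly_mapping_sum_single)
qed

lemma card_exponent_box: "finite (exponent_box n r T)" "card (exponent_box n r T) \<le> (2 * T + 1) ^ (n + r)"
proof -
  let ?A = "PiE {..<n} (\<lambda>_. {- int T..int T})" and ?G = "PiE {..<r} (\<lambda>_. {..T})"
  let ?f = "\<lambda>(f, g). (\<Sum>i<n. single i (f i), \<Sum>k<r. single k (g k))"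
  have sub: "exponent_box n r T \<subseteq> ?f ` (?A \<times> ?G)"
  proof
    fix x assume "x \<in> exponent_box n r T"
    then obtain a \<gamma> where x: "x = (a, \<gamma>)" and *: "supp a \<subseteq> {..<n}" "\<And>i. \<bar>coef a i\<bar> \<le> int T"
      "supp \<gamma> \<subseteq> {..<r}" "\<And>k. coef \<gamma> k \<le> T"
      by (auto simp: exponent_box_def)
    have "x = ?f (restrict (coef a) {..<n}, restrict (coef \<gamma>) {..<r})"
      using sum_single_restrict[OF _ *(1)] sum_single_restrict[OF _ *(3)] by (simp add: x)
    moreover have "(restrict (coef a) {..<n}, restrict (coef \<gamma>) {..<r}) \<in> ?A \<times> ?G"
      using *(2,4) by (auto simp: abs_le_iff minus_le_iff)
    ultimately show "x \<in> ?f ` (?A \<times> ?G)" by (rule image_eqI)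
  qed
  have fin: "finite (?A \<times> ?G)" by (intro finite_cartesian_product finite_PiE) auto
  show "finite (exponent_box n r T)" by (rule finite_subset[OF sub]) (use fin in blast)
  have "card (exponent_box n r T) \<le> card (?A \<times> ?G)"
    using card_mono[OF _ sub] card_image_le[OF fin, of ?f] fin by fastforce
  also have "\<dots> = (2 * T + 1) ^ n * (T + 1) ^ r"
    by (simp add: card_cartesian_product card_PiE nat_add_distrib nat_mult_distrib)
  also have "\<dots> \<le> (2 * T + 1) ^ n * (2 * T + 1) ^ r"
    by (intro mult_left_mono power_mono) auto
  finally show "card (exponent_box n r T) \<le> (2 * T + 1) ^ (n + r)"
    by (simp add: power_add)
qed

definition bounded_laurent :: "nat \<Rightarrow> nat \<Rightarrow> nat \<Rightarrow> 'k::field laurent set" where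
  "bounded_laurent n r T = {F. \<forall>a \<gamma>. coef (coef F a) \<gamma> \<noteq> 0 \<longrightarrow> (a, \<gamma>) \<in> exponent_box n r T}"

lemma exponent_box_mono: "S \<le> T \<Longrightarrow> exponent_box n r S \<subseteq> exponent_box n r T"
  by (fastforce simp: exponent_box_def intro: order_trans)

lemma bounded_laurent_mono: "S \<le> T \<Longrightarrow> bounded_laurent n r S \<subseteq> bounded_laurent n r T"
  using exponent_box_mono[of S T n r] by (auto simp: bounded_laurent_def)

lemma exponent_box_add:
  assumes "(a, \<gamma>) \<in> exponent_box n r S" "(a', \<gamma>') \<in> exponent_box n r T"
  shows "(a + a', \<gamma> + \<gamma>') \<in> exponent_box n r (S + T)"
proof -
  have "\<bar>coef (a + a') i\<bar> \<le> int (S + T)" for i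
    using assms abs_triangle_ineq[of "coef a i" "coef a' i"]
    by (auto simp: exponent_box_def lookup_add intro: order_trans[OF _ add_mono])
  moreover have "coef (\<gamma> + \<gamma>') k \<le> S + T" for k
    using assms by (auto simp: exponent_box_def lookup_add intro: add_mono)
  ultimately show ?thesis
    using assms Poly_Mapping.keys_add[of a a'] Poly_Mapping.keys_add[of \<gamma> \<gamma>'] by (auto simp: exponent_box_def)
qed

lemma bounded_laurent_mult:
  assumes F: "F \<in> bounded_laurent n r S" and G: "G \<in> bounded_laurent n r T"
  shows "F * G \<in> bounded_laurent n r (S + T)"
  unfolding bounded_laurent_def
proof (intro CollectI allI impI)
  fix a \<gamma> assume nz: "coef (coef (F * G) a) \<gamma> \<noteq> 0"
  have "coef (coef (F * G) a) \<gamma> = (\<Sum>p\<in>supp F. \<Sum>q\<in>supp G.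
      coef (if p + q = a then coef F p * coef G q else 0) \<gamma>)"
    by (simp add: lookup_mult_expand[of F G] lookup_sum)
  with nz obtain p q where "coef (if p + q = a then coef F p * coef G q else 0) \<gamma> \<noteq> 0"
    by (metis (no_types, lifting) sum.neutral)
  then have pq: "p + q = a" "\<gamma> \<in> supp (coef F p * coef G q)"
    by (auto simp: in_keys_iff split: if_splits)
  then obtain x y where "x \<in> supp (coef F p)" "y \<in> supp (coef G q)" "\<gamma> = x + y"
    using keys_mult[of "coef F p" "coef G q"] by blast
  then show "(a, \<gamma>) \<in> exponent_box n r (S + T)"
    using F G pq exponent_box_add[of p x n r S q y T] by (auto simp: bounded_laurent_def in_keys_iff)
qed

lemma bounded_laurent_one: "1 \<in> bounded_laurent n r T"
  by (auto simp: bounded_laurent_def exponent_box_def lookup_one when_def)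

lemma bounded_laurent_power: "F \<in> bounded_laurent n r T \<Longrightarrow> F ^ k \<in> bounded_laurent n r (k * T)"
  by (induction k) (auto simp: bounded_laurent_one intro: bounded_laurent_mult)

lemma bounded_laurent_prod:
  "finite S \<Longrightarrow> (\<And>x. x \<in> S \<Longrightarrow> F x \<in> bounded_laurent n r (T x)) \<Longrightarrow> (\<Prod>x\<in>S. F x) \<in> bounded_laurent n r (\<Sum>x\<in>S. T x)"
  by (induction S rule: finite_induct) (auto simp: bounded_laurent_one intro: bounded_laurent_mult)

lemma lookup_lconst_mult:
  fixes x :: "'k::field"
  shows "coef (coef (lconst x * G) a) \<gamma>
    = x * coef (coef G a) \<gamma>"
proof -
  have "lconst x * G = Poly_Mapping.map ((*) (pconst x)) G"
    by (simp add: lconst_def mult_map_scale_conv_mult)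
  then have "coef (lconst x * G) a = pconst x * coef G a"
    by (simp add: Poly_Mapping.map.rep_eq when_def)
  also have "\<dots> = pscale x (coef G a)" by (simp add: pscale_eq)
  finally show ?thesis by (simp add: lookup_pscale)
qed

lemma lookup_single_mult:
  fixes F :: "'i::ab_group_add \<Rightarrow>\<^sub>0 'c::comm_ring_1"
  shows "coef (single e 1 * F) a = coef F (a - e)"
proof (cases "F = 0")
  case False
  have "coef (single e 1 * F) a
      = (\<Sum>q\<in>supp F. if q = a - e then coef F q else 0)"
  proof -
    have "e + q = a \<longleftrightarrow> q = a - e" for q by (auto simp: algebra_simps)
    then show ?thesis by (simp add: lookup_mult_expand)
  qed
  also have "\<dots> = coef F (a - e)"
    by (simp add: in_keys_iff)
  finally show ?thesis .
qed simp

context uniform_bundle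
begin

lemma variable_bounded: "\<exists>K. \<forall>x\<in>XY n m. \<Phi> (pvar x) \<in> bounded_laurent n r K"
proof -
  define K where "K = 1 + (\<Sum>i<n. \<Sum>j<m. nat \<bar>D i j\<bar>)"
  have DK: "\<bar>D i j\<bar> \<le> int K" if "i < n" "j < m" for i j
  proof -
    have "nat \<bar>D i j\<bar> \<le> (\<Sum>j<m. nat \<bar>D i j\<bar>)"
      using that by (intro member_le_sum) auto
    also have "\<dots> \<le> (\<Sum>i<n. \<Sum>j<m. nat \<bar>D i j\<bar>)"
      using that by (intro member_le_sum[of i "{..<n}" "\<lambda>i. \<Sum>j<m. nat \<bar>D i j\<bar>"]) auto
    finally show ?thesis unfolding K_def by linarith
  qed
  have K1: "Suc 0 \<le> K" by (simp add: K_def)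
  have "\<Phi> (pvar x) \<in> bounded_laurent n r K" if "x \<in> XY n m" for x
  proof -
    from that consider i where "x = Inl i" "i < n" | j where "x = Inr j" "j < m" by (auto simp: XY_def)
    then show ?thesis
    proof cases
      case 1
      then show ?thesis
        by (auto simp: stratum_subst_Inl bounded_laurent_def exponent_box_def lookup_single lookup_one when_def K1 split: if_splits)
    next
      case 2
      have "\<exists>k<r. \<gamma> = single k 1" if "coef (b j) \<gamma> \<noteq> 0" for \<gamma>
        using keys_fiber[OF b_fiber[OF 2(2)], of \<gamma>] that by (simp add: in_keys_iff)
      then have "(tdeg n D j, \<gamma>) \<in> exponent_box n r K" if "coef (b j) \<gamma> \<noteq> 0" for \<gamma>
        using DK[OF _ 2(2)] keys_tdeg that
        by (fastforce simp: exponent_box_def lookup_tdeg lookup_single when_def K_def)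
      then show ?thesis
        using 2 by (auto simp: stratum_subst_Inr bounded_laurent_def lookup_single when_def split: if_splits)
    qed
  qed
  then show ?thesis by blast
qed

text \<open>The monomials with exponents up to \<open>T\<close> in the variables of \<open>U\<close> are \<open>(T + 1) ^ card U\<close> in number, while
  their images lie in a space whose dimension grows only like the \<open>n + r\<close>-th power of \<open>T\<close>.\<close>

lemma algebraic_dependence:
  assumes U: "U \<subseteq> XY n m" and card: "n + r < card U"
  shows "\<exists>F\<in>pring U. F \<noteq> 0 \<and> \<Phi> F = 0"
proof -
  obtain K where K: "\<And>x. x \<in> XY n m \<Longrightarrow> \<Phi> (pvar x) \<in> bounded_laurent n r K"
    using variable_bounded by blast
  have "finite (XY n m)" by (simp add: XY_def)
  then have fin: "finite U" using U finite_subset by blast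
  \<comment> \<open>\<open>V\<close> bounds the exponents in the images, and \<open>2 * V + 1 \<le> L * (T + 1)\<close>; so \<open>T\<close> has to beat
    \<open>L ^ (n + r)\<close>\<close>
  define L where "L = 2 * (K * card U) + 1"
  define T where "T = L ^ (n + r)"
  define V where "V = card U * (T * K)"
  have "card (exponent_box n r V) \<le> (2 * V + 1) ^ (n + r)"
    by (rule card_exponent_box)
  also have "2 * V + 1 \<le> L * (T + 1)"
    by (simp add: V_def L_def algebra_simps)
  then have "(2 * V + 1) ^ (n + r) \<le> (L * (T + 1)) ^ (n + r)"
    by (rule power_mono) simp
  also have "\<dots> = T * (T + 1) ^ (n + r)"
    unfolding power_mult_distrib T_def ..
  also have "\<dots> < (T + 1) ^ Suc (n + r)"
    by simp
  also have "\<dots> \<le> (T + 1) ^ card U"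
    using card by (intro power_increasing) auto
  finally have count: "card (exponent_box n r V) < (T + 1) ^ card U" .
  define h where "h f = (\<Sum>x\<in>U. single x (f x))" for f :: "nat + nat \<Rightarrow> nat"
  have lookup_h: "coef (h f) x = (if x \<in> U then f x else 0)" for f x
    using fin by (auto simp: h_def lookup_sum lookup_single when_def)
  define B where "B = h ` PiE U (\<lambda>_. {..T})"
  have "inj_on h (PiE U (\<lambda>_. {..T}))"
  proof (rule inj_onI)
    fix f g assume "f \<in> PiE U (\<lambda>_. {..T})" "g \<in> PiE U (\<lambda>_. {..T})" "h f = h g"
    then show "f = g"
      by (intro PiE_ext) (auto, metis lookup_h)
  qed
  then have cardB: "card B = (T + 1) ^ card U" and finB: "finite B"
    unfolding B_def using fin by (auto simp: card_image card_PiE intro!: finite_PiE)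
  have B: "supp \<alpha> \<subseteq> U" "coef \<alpha> x \<le> T" if "\<alpha> \<in> B" for \<alpha> x
    using that by (auto simp: B_def in_keys_iff lookup_h split: if_splits)
  have bounded: "\<Phi> (single \<alpha> 1) \<in> bounded_laurent n r V" if \<alpha>: "\<alpha> \<in> B" for \<alpha>
  proof -
    have "\<Phi> (single \<alpha> 1) = (\<Prod>x\<in>U. \<Phi> (pvar x) ^ coef \<alpha> x)"
      unfolding monomial_at_pvar[symmetric] monomial_at_superset[OF fin B(1)[OF \<alpha>]]
      by (simp add: \<Phi>.hom_prod \<Phi>.hom_power)
    also have "\<dots> \<in> bounded_laurent n r (\<Sum>x\<in>U. coef \<alpha> x * K)"
      using K U by (intro bounded_laurent_prod bounded_laurent_power fin) auto
    also have "(\<Sum>x\<in>U. coef \<alpha> x * K) \<le> V"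
      using sum_bounded_above[of U "\<lambda>x. coef \<alpha> x * K" "T * K"] B(2)[OF \<alpha>]
      by (simp add: V_def)
    then have "bounded_laurent n r (\<Sum>x\<in>U. coef \<alpha> x * K) \<subseteq> bounded_laurent n r V"
      by (rule bounded_laurent_mono)
    finally show ?thesis .
  qed
  obtain x where x: "\<exists>\<alpha>\<in>B. x \<alpha> \<noteq> 0" "\<forall>\<nu>\<in>exponent_box n r V. (\<Sum>\<alpha>\<in>B. x \<alpha> *
      coef (coef (\<Phi> (single \<alpha> 1)) (fst \<nu>)) (snd \<nu>)) = 0"
    using homogeneous_system_nontrivial[OF card_exponent_box(1) finB, of n r V
        "\<lambda>\<nu> \<alpha>. coef (coef (\<Phi> (single \<alpha> 1)) (fst \<nu>)) (snd \<nu>)"] count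
    by (auto simp: cardB)
  define F where "F = (\<Sum>\<alpha>\<in>B. single \<alpha> (x \<alpha>))"
  have "F \<in> pring U"
    unfolding F_def using B(1) by (intro pring_sum) (auto simp: pring_def)
  moreover have "F \<noteq> 0"
  proof -
    obtain \<alpha> where \<alpha>: "\<alpha> \<in> B" "x \<alpha> \<noteq> 0" using x by blast
    have "coef F \<alpha> = x \<alpha>"
      using finB \<alpha> by (simp add: F_def lookup_sum lookup_single when_def)
    then show ?thesis using \<alpha> by auto
  qed
  moreover have "\<Phi> F = 0"
  proof -
    have single: "\<Phi> (single \<alpha> y) = lconst y * \<Phi> (single \<alpha> 1)" for \<alpha> y
    proof -
      have "single \<alpha> y = pconst y * single \<alpha> 1"
        by (simp add: pconst_def mult_single)
      then show ?thesis by (simp add: \<Phi>.hom_mult)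
    qed
    have "coef (coef (\<Phi> F) a) \<gamma> = 0" for a \<gamma>
    proof -
      have "coef (coef (\<Phi> F) a) \<gamma>
          = (\<Sum>\<alpha>\<in>B. x \<alpha> * coef (coef (\<Phi> (single \<alpha> 1)) a) \<gamma>)"
        unfolding F_def \<Phi>.hom_sum by (subst single) (simp add: lookup_sum lookup_lconst_mult)
      also have "\<dots> = 0"
      proof (cases "(a, \<gamma>) \<in> exponent_box n r V")
        case True
        then show ?thesis using x(2) by force
      next
        case False
        then have "coef (coef (\<Phi> (single \<alpha> 1)) a) \<gamma> = 0" if "\<alpha> \<in> B" for \<alpha>
          using bounded[OF that] unfolding bounded_laurent_def by blast
        then show ?thesis by (intro sum.neutral) simp
      qed
      finally show ?thesis .
    qed
    then show ?thesis by (intro poly_mapping_eqI) simp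
  qed
  ultimately show ?thesis by blast
qed

text \<open>Otherwise some relation expresses an element \<open>b j0\<close> of value 0 at \<open>i\<close> by elements of positive value.\<close>

lemma row_has_many_zeros:
  assumes i: "i < n"
  shows "d < card (zcols {i})"
proof (rule ccontr)
  assume "\<not> d < card (zcols {i})"
  then obtain J where J: "zcols {i} \<subseteq> J" "J \<subseteq> {..<m}" "card J = d"
    using exists_subset_between[of "zcols {i}" d "{..<m}"] zcols_bound[of "{i}"] rank by auto
  obtain j0 where j0: "j0 < m" "D i j0 = 0" using row_zero[OF i] by blast
  then have "j0 \<in> J" using J by (auto simp: zcols_def)
  then obtain u where u: "\<forall>j\<in>J. (\<Sum>k<d. u k * c k j) = (if j = j0 then 1 else 0)"
    using generic_matrix_dual[OF generic, of "{..<d}" J j0] J by auto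
  define e where "e j = (\<Sum>k<d. u k * c k j)" for j
  have "\<exists>y. \<forall>j<m. e j = (\<Sum>k<d. y k * c k j)"
    unfolding e_def by blast
  then have "0 = (\<Sum>j<m. pscale (e j) (b j))"
    unfolding relations[symmetric] by simp
  also have "\<dots> = (\<Sum>j\<in>J. pscale (e j) (b j)) + (\<Sum>j\<in>{..<m} - J. pscale (e j) (b j))"
    using sum.subset_diff[OF J(2)] by (simp add: add.commute)
  also have "(\<Sum>j\<in>J. pscale (e j) (b j)) = (\<Sum>j\<in>J. if j = j0 then b j else 0)"
    using u by (intro sum.cong) (auto simp: e_def)
  also have "\<dots> = b j0"
    using \<open>j0 \<in> J\<close> finite_subset[OF J(2)] by simp
  finally have b: "b j0 = - (\<Sum>j\<in>{..<m} - J. pscale (e j) (b j))"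
    by (simp add: eq_neg_iff_add_eq_0)
  interpret sym_valuation r "w i" by (rule sym_valuation_at_ray[OF i])
  have "1 \<le> w i (\<Sum>j\<in>{..<m} - J. pscale (e j) (b j))"
  proof (rule w_sum_ge)
    fix j assume j: "j \<in> {..<m} - J"
    then have "D i j \<noteq> 0" using J by (auto simp: zcols_def)
    then have "1 \<le> D i j" using D_nonneg[OF i, of j] j by auto
    then have "1 \<le> w i (b j)"
      using b_value[OF i, of j] j by (auto simp: one_ereal_def)
    then show "pscale (e j) (b j) \<in> Sym r \<and> 1 \<le> w i (pscale (e j) (b j))"
      using fiber_Sym[OF b_fiber[of j]] j by (auto intro: pring_pscale w_scale_ge)
  qed
  moreover have "(\<Sum>j\<in>{..<m} - J. pscale (e j) (b j)) \<in> Sym r"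
    using fiber_Sym[OF b_fiber] by (intro pring_sum pring_pscale) auto
  ultimately have "1 \<le> w i (b j0)"
    unfolding b by (simp add: w_uminus)
  then show False
    using b_value[OF i j0(1)] j0(2) by (simp add: one_ereal_def)
qed

text \<open>The locus where the \<open>X l\<close> with \<open>l \<in> A\<close> and the \<open>Y j\<close> with \<open>j \<in> zcols A\<close> are 0 is an affine space on which all
  relations hold. It lies in the divisor \<open>X i = 0\<close> for \<open>i \<in> A\<close>, which the valuation makes irreducible, of
  dimension \<open>n + r - 1\<close>. Another \<open>X i'\<close> with \<open>i' \<in> A\<close> vanishes on the locus but not on the divisor, which
  bounds the number of coordinates of the locus by \<open>n + r - 2\<close>.\<close>

theorem hall_if_presentation:
  assumes image: "\<Phi> ` P = cox" and kernel: "{f \<in> P. \<Phi> f = 0} = P \<inter> idl.span (rel ` {..<d})"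
  shows hall_condition
  unfolding hall_condition_def
proof (intro allI impI, elim conjE)
  fix A assume A: "A \<noteq> {}" "A \<subseteq> {..<n}"
  then have finA: "finite A" using finite_subset by blast
  show "d + 2 \<le> card (zcols A) + card A"
  proof (cases "\<exists>i. A = {i}")
    case True
    then show ?thesis using row_has_many_zeros A by fastforce
  next
    case False
    then obtain i i' where ii: "i \<in> A" "i' \<in> A" "i \<noteq> i'"
      using A by blast
    then have n: "i < n" "i' < n" using A by auto
    show ?thesis
    proof (rule ccontr)
      assume neg: "\<not> d + 2 \<le> card (zcols A) + card A"
      define C where "C = {..<m} - zcols A"
      define U' :: "(nat + nat) set" where "U' = Inl ` ({..<n} - A) \<union> Inr ` C"
      define U where "U = insert (Inl i) (insert (Inl i') U')"
      have "card U' = (n - card A) + (m - card (zcols A))"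
        unfolding U'_def C_def using A finA zcols_bound[of A]
        by (subst card_Un_disjoint) (auto simp: card_image card_Diff_subset)
      moreover have "finite U'" "Inl i \<notin> U'" "Inl i' \<notin> U'"
        using ii by (auto simp: U'_def C_def)
      then have "card U = card U' + 2"
        using ii(3) by (simp add: U_def)
      moreover have "card A \<le> n" "card (zcols A) \<le> m"
        using card_mono[OF _ A(2)] card_mono[OF _ zcols_bound[of A]] by auto
      ultimately have "n + r < card U"
        using neg rank by linarith
      moreover have UXY: "U \<subseteq> XY n m"
        using n by (auto simp: U_def U'_def C_def)
      ultimately obtain F where F: "F \<in> pring U" "F \<noteq> 0" "\<Phi> F = 0"
        using algebraic_dependence by blast
      obtain k G H where G: "F = X i ^ k * (G + X i * H)" "G \<noteq> 0" "G \<in> pring (U - {Inl i})" "H \<in> pring U"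
        using factor_variable_power[OF F(1,2), of "Inl i"] by (auto simp: U_def)
      then have "\<Phi> G = - (\<Phi> (X i) * \<Phi> H)"
        using F(3) \<Phi>X_nonzero[of i] by (simp add: \<Phi>.hom_mult \<Phi>.hom_power \<Phi>.hom_add eq_neg_iff_add_eq_0)
      moreover obtain l G' H' where G': "G = X i' ^ l * (G' + X i' * H')" "G' \<noteq> 0"
          "G' \<in> pring (U - {Inl i} - {Inl i'})" "H' \<in> pring (U - {Inl i})"
        using factor_variable_power[OF G(3,2), of "Inl i'"] ii by (auto simp: U_def)
      moreover define Q where "Q = G' + X i' * H'"
      ultimately have eq: "\<Phi> (X i') ^ l * \<Phi> Q = - (\<Phi> (X i) * \<Phi> H)"
        by (simp add: \<Phi>.hom_mult \<Phi>.hom_power)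
      have "H \<in> P" "G' \<in> P" "H' \<in> P"
        using G(4) G'(3,4) pring_mono[OF UXY] pring_mono[of "U - {Inl i}" U] pring_mono[of "U - {Inl i} - {Inl i'}" U] by auto
      then have QP: "Q \<in> P" and HP: "- H \<in> P"
        unfolding Q_def using n by (auto intro!: pring_add pring_mult pring_uminus)
      \<comment> \<open>dividing by \<open>X i\<close> stays in the Cox ring: only the \<open>i\<close>-th condition is at stake, and it can be
        read off after multiplication with a power of \<open>X i'\<close>\<close>
      define F' where "F' = single (single i 1) 1 * \<Phi> Q"
      have XF': "\<Phi> (X i) * F' = \<Phi> Q"
        using \<Phi>X_power[of i 1] by (simp add: F'_def mult.assoc[symmetric])
      have "\<Phi> (X i) * (\<Phi> (X i') ^ l * F') = \<Phi> (X i') ^ l * (\<Phi> (X i) * F')"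
        by (rule mult.left_commute)
      also have "\<dots> = \<Phi> (X i) * \<Phi> (- H)"
        unfolding XF' eq \<Phi>.hom_uminus by simp
      finally have "\<Phi> (X i) * (\<Phi> (X i') ^ l * F') = \<Phi> (X i) * \<Phi> (- H)" .
      then have XH: "\<Phi> (X i') ^ l * F' = \<Phi> (- H)"
        using \<Phi>X_nonzero[of i] by simp
      define e where "e = (\<Sum>_<l. single i' (-1::int))"
      have e: "\<Phi> (X i') ^ l = single e 1"
        by (simp only: \<Phi>X power_single e_def power_one)
      have ei: "coef e i = 0"
        unfolding e_def lookup_sum lookup_single using ii(3) by simp
      have "F' \<in> cox"
        unfolding cox_iff
      proof
        fix a
        let ?f = "coef F' a"
        have 1: "?f \<in> cox_piece (a - single i 1)"
          using image QP by (auto simp: F'_def lookup_single_mult cox_iff[symmetric] dest: cox_iff[THEN iffD1])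
        have "?f = coef (\<Phi> (- H)) (a + e)"
          unfolding XH[symmetric] e lookup_single_mult by simp
        then have 2: "?f \<in> cox_piece (a + e)"
          using image HP by (auto dest: cox_iff[THEN iffD1])
        show "?f \<in> cox_piece a"
        proof (cases "?f = 0")
          case False
          show ?thesis
          proof (rule cox_pieceI)
            have "supp (a - single i 1) \<subseteq> {..<n}"
              using 1 False by (simp add: cox_piece_def)
            then show "supp a \<subseteq> {..<n}"
              using n Poly_Mapping.keys_add[of "a - single i 1" "single i 1"] by auto
            show "?f \<in> Sym r" using 1 False by (simp add: cox_piece_def)
            fix l assume l: "l < n"
            show "ereal (of_int (coef a l)) \<le> w l ?f"
            proof (cases "l = i")
              case True
              then show ?thesis
                using 2 False l ei by (auto simp: cox_piece_def lookup_add)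
            next
              case False
              then have "coef (a - single i 1) l = coef a l"
                by (simp add: lookup_minus lookup_single)
              then show ?thesis
                using 1 \<open>?f \<noteq> 0\<close> l by (auto simp: cox_piece_def)
            qed
          qed
        qed (simp add: cox_piece_0)
      qed
      then obtain h where h: "h \<in> P" "F' = \<Phi> h" using image by auto
      have "\<Phi> (Q - X i * h) = 0"
        using XF' h by (simp add: \<Phi>.hom_minus \<Phi>.hom_mult)
      moreover have "Q - X i * h \<in> P"
        using n by (intro pring_diff pring_mult QP h) simp
      ultimately have Qh: "Q - X i * h \<in> idl.span (rel ` {..<d})"
        using kernel by blast
      \<comment> \<open>\<open>X i\<close> and all relations vanish where the \<open>X l\<close> with \<open>l \<in> A\<close> and the \<open>Y j\<close> with
        \<open>j \<in> zcols A\<close> are 0, but \<open>G'\<close> only involves the other variables\<close>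
      let ?\<kappa> = "retract U' :: (nat + nat, 'k) mpoly \<Rightarrow> _"
      interpret \<kappa>: comm_ring_hom ?\<kappa> by (rule comm_ring_hom_retract)
      have \<kappa>X: "?\<kappa> (X l) = 0" if "l \<in> A" for l
        using that by (auto simp: retract_pvar U'_def)
      have \<kappa>XA: "?\<kappa> f = 0" if "f \<in> idl.span (X ` A)" for f
        using that by (induction rule: idl.span_induct_alt) (auto simp: \<kappa>.hom_add \<kappa>.hom_mult \<kappa>X)
      have "?\<kappa> (colmon j * Y j) = 0" if j: "j < m" for j
      proof (cases "j \<in> zcols A")
        case True
        then have "Inr j \<notin> U'" by (auto simp: U'_def C_def)
        then have "?\<kappa> (Y j) = 0" by (simp add: retract_pvar)
        then show ?thesis by (simp add: \<kappa>.hom_mult)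
      next
        case False
        then show ?thesis using \<kappa>XA colmon_in_ideal[OF A(2) j] by blast
      qed
      then have \<kappa>rel: "?\<kappa> (rel k) = 0" for k
        by (simp add: rel_def \<kappa>.hom_sum \<kappa>.hom_mult)
      have "?\<kappa> f = 0" if "f \<in> idl.span (rel ` {..<d})" for f
        using that by (induction rule: idl.span_induct_alt) (auto simp: \<kappa>.hom_add \<kappa>.hom_mult \<kappa>rel)
      then have "?\<kappa> (Q - X i * h) = 0" using Qh by blast
      then have "?\<kappa> G' = 0"
        by (simp add: Q_def \<kappa>.hom_add \<kappa>.hom_minus \<kappa>.hom_mult \<kappa>X ii)
      moreover have "U - {Inl i} - {Inl i'} = U'"
        using ii by (auto simp: U_def U'_def)
      then have "?\<kappa> G' = G'"
        using G'(3) by (intro retract_id) simp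
      ultimately show False using G'(2) by simp
    qed
  qed
qed

end

section \<open>Uniform toric vector bundles\<close>

lemma adapted_valuation_at:
  fixes v :: "(nat, 'k::field) mpoly \<Rightarrow> 'v::real_vector \<Rightarrow> ereal"
  assumes E: "toric_vector_bundle N \<Sigma> r v" and \<sigma>: "\<sigma> \<in> \<Sigma>" "u \<in> \<sigma>"
  obtains \<beta> where "adapted_valuation r (\<lambda>f. v f u) \<beta>"
    "pm.independent (\<beta> ` {..<r})" "inj_on \<beta> {..<r}"
    "\<And>k. k < r \<Longrightarrow> \<exists>\<phi>. integral_linear_on N \<sigma> \<phi> \<and> v (\<beta> k) u = ereal (\<phi> u)"
proof -
  have u: "u \<in> \<Union>\<Sigma>" using \<sigma> by blast
  have "PL_valuation N \<Sigma> r v" using E by (simp add: toric_vector_bundle_def)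
  note PL = this[unfolded PL_valuation_def, THEN conjunct1]
    this[unfolded PL_valuation_def, THEN conjunct2, THEN conjunct1]
    this[unfolded PL_valuation_def, THEN conjunct2, THEN conjunct2, THEN conjunct1]
    this[unfolded PL_valuation_def, THEN conjunct2, THEN conjunct2, THEN conjunct2, THEN conjunct1]
    this[unfolded PL_valuation_def, THEN conjunct2, THEN conjunct2, THEN conjunct2, THEN conjunct2]
  obtain \<beta> where \<beta>: "adapted_basis N r v \<sigma> \<beta>" using E \<sigma> by (auto simp: toric_vector_bundle_def)
  note parts = \<beta>[unfolded adapted_basis_def]
  have inj: "inj_on \<beta> {..<r}" and indep: "pm.independent (\<beta> ` {..<r})"
    and span: "pm.span (\<beta> ` {..<r}) = fiber r"
    and bij: "bij_betw (poly_subst pconst \<beta>) (pring {..<r}) (Sym r)"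
    using parts by simp_all
  have min: "v (poly_subst pconst \<beta> g) u = Min ((\<lambda>\<alpha>. v (monomial_at \<beta> \<alpha>) u) ` supp g)"
    if "g \<in> pring {..<r}" "g \<noteq> 0" for g
    using parts that \<sigma>(2) by simp
  have "\<exists>\<phi>. integral_linear_on N \<sigma> \<phi> \<and> (\<forall>u\<in>\<sigma>. v (\<beta> k) u = ereal (\<phi> u))" if "k < r" for k
    using parts that by simp
  then have lin: "\<exists>\<phi>. integral_linear_on N \<sigma> \<phi> \<and> v (\<beta> k) u = ereal (\<phi> u)" if "k < r" for k
    using that \<sigma>(2) by meson
  have "adapted_valuation r (\<lambda>f. v f u) \<beta>"
  proof unfold_locales
    show "v 0 u = \<infinity>" using PL(1) u by blast
    show "\<exists>x::real. v f u = ereal x" if "f \<in> Sym r" "f \<noteq> 0" for f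
      using PL(2) u that by blast
    show "v (f * g) u = v f u + v g u" if "f \<in> Sym r" "g \<in> Sym r" for f g
      using PL(3) u that by blast
    show "min (v f u) (v g u) \<le> v (f + g) u" if "f \<in> Sym r" "g \<in> Sym r" for f g
      using PL(4) u that by blast
    show "v (pscale c f) u = v f u" if "f \<in> Sym r" "c \<noteq> 0" for c f
      using PL(5) u that by blast
    show "\<beta> k \<in> fiber r" if "k < r" for k
      using that pm.span_base[of "\<beta> k" "\<beta> ` {..<r}"] span by blast
    show "\<exists>x::real. v (\<beta> k) u = ereal x" if "k < r" for k
      using lin[OF that] by blast
    show "\<exists>g\<in>pring {..<r}. f = poly_subst pconst \<beta> g" if "f \<in> Sym r" for f
      using bij that unfolding bij_betw_def by blast
    show "v (poly_subst pconst \<beta> g) u = Min ((\<lambda>\<alpha>. v (monomial_at \<beta> \<alpha>) u) ` supp g)"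
      if "g \<in> pring {..<r}" "g \<noteq> 0" for g
      using min that by blast
  qed
  from that[OF this indep inj lin] show ?thesis by blast
qed

lemma khovanskii_span:
  fixes v :: "(nat, 'k::field) mpoly \<Rightarrow> 'v::real_vector \<Rightarrow> ereal"
  assumes E: "toric_vector_bundle N \<Sigma> r v" and K: "khovanskii_basis \<Sigma> r v B"
    and u: "u \<in> \<Union>\<Sigma>" and f: "f \<in> fiber r" "f \<noteq> 0"
  shows "f \<in> pm.span {x \<in> B. v f u \<le> v x u}"
proof -
  obtain \<sigma> where \<sigma>: "\<sigma> \<in> \<Sigma>" "u \<in> \<sigma>" using u by blast
  obtain \<beta> where "adapted_valuation r (\<lambda>f. v f u) \<beta>"
    using adapted_valuation_at[OF E \<sigma>] by blast
  then show ?thesis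
    using K u f unfolding khovanskii_basis_def Let_def
    by (intro adapted_valuation.khovanskii_fiber) auto
qed

lemma lookup_linear_form:
  "coef (linear_form m x) (single j 1) = (if j < m then x j else 0)"
  "coef (linear_form m x) 0 = 0"
  using lookup_linear_comb[of "{..<m}" x j]
  by (simp_all add: linear_form_def pscale_eq del: One_nat_def)
    (simp add: pscale_eq[symmetric] lookup_sum lookup_pscale lookup_pvar)

lemma linear_form_pring: "linear_form m x \<in> pring {..<m}"
  unfolding linear_form_def by (intro pring_sum pring_pscale) simp

text \<open>Both generating families of the relation ideal consist of linear forms, so the parts of degree one
  of an ideal member are combinations of them with constant coefficients.\<close>

lemma relations_iff_row_space:
  fixes M :: "'k::field mat"
  assumes gen: "minimally_generates (ring_on (pring {..<m})) d (\<lambda>k. linear_form m (\<lambda>j. M $$ (k, j))) (relation_ideal m b)"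
  shows "(\<Sum>j<m. pscale (x j) (b j)) = 0 \<longleftrightarrow> (\<exists>y. \<forall>j<m. x j = (\<Sum>k<d. y k * M $$ (k, j)))"
proof -
  let ?l = "\<lambda>k. linear_form m (\<lambda>j. M $$ (k, j))"
  let ?R = "{linear_form m c | c. (\<Sum>j<m. pscale (c j) (b j)) = 0}"
  interpret S: comm_ring_hom "poly_subst pconst b" by (intro comm_ring_hom_poly_subst comm_ring_hom_pconst)
  have subst: "poly_subst pconst b (linear_form m c) = (\<Sum>j<m. pscale (c j) (b j))" for c
    by (simp add: linear_form_def pscale_eq S.hom_sum S.hom_mult poly_subst_pconst poly_subst_pvar)
  have "pring {..<m} \<inter> idl.span (?l ` {..<d}) = Idl\<^bsub>ring_on (pring {..<m})\<^esub> (?l ` {..<d})"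
    by (rule Idl_pring[symmetric]) (auto intro: linear_form_pring)
  also have "\<dots> = relation_ideal m b"
    using gen by (simp add: minimally_generates_def)
  also have "\<dots> = pring {..<m} \<inter> idl.span ?R"
    unfolding relation_ideal_def by (rule Idl_pring) (auto intro: linear_form_pring)
  finally have eq: "pring {..<m} \<inter> idl.span (?l ` {..<d}) = pring {..<m} \<inter> idl.span ?R" .
  show ?thesis
  proof
    assume "(\<Sum>j<m. pscale (x j) (b j)) = 0"
    then have "linear_form m x \<in> pring {..<m} \<inter> idl.span ?R"
      by (auto intro: linear_form_pring idl.span_base)
    then have "linear_form m x \<in> idl.span (?l ` {..<d})"
      unfolding eq[symmetric] by blast
    then have "\<exists>y. \<forall>j<m. coef (linear_form m x) (single j 1) = (\<Sum>k<d. y k * M $$ (k, j))"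
    proof (induction rule: idl.span_induct_alt)
      case base
      show ?case by (intro exI[of _ "\<lambda>_. 0"]) simp
    next
      case (step h z f)
      then obtain k y where k: "k < d" "z = ?l k"
        and y: "\<And>j. j < m \<Longrightarrow> coef f (single j 1) = (\<Sum>k<d. y k * M $$ (k, j))"
        by blast
      have "coef (h * z + f) (single j 1)
          = (\<Sum>k'<d. (y k' + (if k' = k then coef h 0 else 0)) * M $$ (k', j))" if "j < m" for j
        using k(1) that unfolding lookup_add lookup_mult_linear k(2) lookup_linear_form y[OF that]
        by (simp add: distrib_right sum.distrib if_distrib[of "\<lambda>x. x * _"] cong: if_cong)
      then show ?case by (intro exI[of _ "\<lambda>k'. y k' + (if k' = k then coef h 0 else 0)"]) blast
    qed
    then show "\<exists>y. \<forall>j<m. x j = (\<Sum>k<d. y k * M $$ (k, j))"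
      unfolding lookup_linear_form by simp
  next
    assume "\<exists>y. \<forall>j<m. x j = (\<Sum>k<d. y k * M $$ (k, j))"
    then obtain y where y: "\<And>j. j < m \<Longrightarrow> x j = (\<Sum>k<d. y k * M $$ (k, j))" by blast
    have vanish: "poly_subst pconst b f = 0" if "f \<in> idl.span ?R" for f
      using that by (induction rule: idl.span_induct_alt) (auto simp: S.hom_add S.hom_mult subst)
    have row: "(\<Sum>j<m. pscale (M $$ (k, j)) (b j)) = 0" if "k < d" for k
    proof -
      have "?l k \<in> pring {..<m} \<inter> idl.span (?l ` {..<d})"
        using that by (auto intro: linear_form_pring idl.span_base)
      then have "poly_subst pconst b (?l k) = 0"
        unfolding eq using vanish by blast
      then show ?thesis by (simp only: subst)
    qed
    have "(\<Sum>j<m. pscale (x j) (b j)) = (\<Sum>j<m. \<Sum>k<d. pscale (y k) (pscale (M $$ (k, j)) (b j)))"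
      by (intro sum.cong) (auto simp: y pm.scale_sum_left)
    also have "\<dots> = (\<Sum>k<d. pscale (y k) (\<Sum>j<m. pscale (M $$ (k, j)) (b j)))"
      by (subst sum.swap) (simp add: pm.scale_sum_right)
    also have "\<dots> = 0" by (simp add: row)
    finally show "(\<Sum>j<m. pscale (x j) (b j)) = 0" .
  qed
qed

lemma zero_in_fan:
  assumes "is_fan N \<Sigma>"
  shows "0 \<in> \<Union>\<Sigma>"
proof -
  obtain \<sigma> where \<sigma>: "\<sigma> \<in> \<Sigma>" using assms by (auto simp: is_fan_def)
  then have "\<sigma> \<inter> uminus ` \<sigma> = {0}" using assms by (auto simp: is_fan_def strongly_convex_rational_cone_def)
  then show ?thesis using \<sigma> by blast
qed

lemma ray_generator_in_fan:
  assumes "u \<in> ray_generators N \<Sigma>"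
  shows "convex_cone hull {u} \<in> \<Sigma>" "u \<in> convex_cone hull {u}" "u \<in> N"
  using assms by (simp_all add: ray_generators_def primitive_def hull_inc)

lemma diagram_value:
  fixes v :: "(nat, 'k::field) mpoly \<Rightarrow> 'v::real_vector \<Rightarrow> ereal"
  assumes E: "toric_vector_bundle N \<Sigma> r v" and u: "\<rho> i \<in> \<Union>\<Sigma>" "\<rho> i \<in> N" and b: "b j \<in> Sym r" "b j \<noteq> 0"
  shows "v (b j) (\<rho> i) = ereal (of_int (diagram v \<rho> b i j))"
proof -
  have "\<forall>f\<in>Sym r. f \<noteq> 0 \<longrightarrow> (\<exists>\<phi>\<in>integral_PL N \<Sigma>. \<forall>u\<in>\<Union>\<Sigma>. v f u = ereal (\<phi> u))"
    using E unfolding toric_vector_bundle_def PL_valuation_def by (elim conjE)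
  then obtain \<phi> where \<phi>: "\<phi> \<in> integral_PL N \<Sigma>" "v (b j) (\<rho> i) = ereal (\<phi> (\<rho> i))"
    using u b by blast
  from \<phi>(1) have "\<forall>u\<in>\<Union>\<Sigma> \<inter> N. \<phi> u \<in> \<int>"
    unfolding integral_PL_def mem_Collect_eq by (rule conjunct2)
  then have "\<phi> (\<rho> i) \<in> \<int>" using u by blast
  then show ?thesis using \<phi>(2) by (auto simp: diagram_def elim!: Ints_cases)
qed

lemma rank_bound:
  fixes v :: "(nat, 'k::field) mpoly \<Rightarrow> 'v::real_vector \<Rightarrow> ereal" and b :: "nat \<Rightarrow> (nat, 'k) mpoly"
  assumes E: "toric_vector_bundle N \<Sigma> r v" and u: "u \<in> \<Union>\<Sigma>" and span: "fiber r \<subseteq> pm.span (b ` {..<m})"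
  shows "r \<le> m"
proof -
  obtain \<sigma> where \<sigma>: "\<sigma> \<in> \<Sigma>" "u \<in> \<sigma>" using u by blast
  obtain \<beta> where \<beta>: "adapted_valuation r (\<lambda>f. v f u) \<beta>" "pm.independent (\<beta> ` {..<r})" "inj_on \<beta> {..<r}"
    using adapted_valuation_at[OF E \<sigma>] by metis
  have "\<beta> ` {..<r} \<subseteq> pm.span (b ` {..<m})"
    using adapted_valuation.\<beta>_fiber[OF \<beta>(1)] span by blast
  then have "card (\<beta> ` {..<r}) \<le> card (b ` {..<m})"
    using pm.independent_span_bound[OF _ \<beta>(2), of "b ` {..<m}"] by simp
  also have "\<dots> \<le> m" using card_image_le[of "{..<m}" b] by simp
  finally show ?thesis using \<beta>(3) by (simp add: card_image)
qed

lemma uniform_bundle_of_toric: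
  fixes v :: "(nat, 'k::field) mpoly \<Rightarrow> 'v::real_vector \<Rightarrow> ereal"
  assumes fan: "smooth_fan N \<Sigma>" and \<rho>: "bij_betw \<rho> {..<n} (ray_generators N \<Sigma>)"
    and E: "toric_vector_bundle N \<Sigma> r v" and U: "uniform_witness \<Sigma> r v m b d M"
    and d: "d = m - r" and D: "D = diagram v \<rho> b"
    and norm: "\<forall>i<n. (\<forall>j<m. 0 \<le> D i j) \<and> (\<exists>j<m. D i j = 0)"
  shows "\<exists>\<beta>. uniform_bundle n m d D (\<lambda>k j. M $$ (k, j)) r (\<lambda>i f. v f (\<rho> i)) b \<beta>"
proof -
  have K: "khovanskii_basis \<Sigma> r v (b ` {..<m})" and M: "M \<in> carrier_mat d m" "all_minors_nonzero M"
    and gen: "minimally_generates (ring_on (pring {..<m})) d (\<lambda>k. linear_form m (\<lambda>j. M $$ (k, j))) (relation_ideal m b)"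
    using U by (auto simp: uniform_witness_def)
  have ray: "\<rho> i \<in> ray_generators N \<Sigma>" if "i < n" for i
    using \<rho> that by (auto simp: bij_betw_def)
  have \<rho>_fan: "\<rho> i \<in> \<Union>\<Sigma>" "\<rho> i \<in> N" if "i < n" for i
    using ray_generator_in_fan[OF ray[OF that]] by auto
  have b: "b j \<in> fiber r" "b j \<noteq> 0" if "j < m" for j
    using K that by (auto simp: khovanskii_basis_def)
  have zero: "0 \<in> \<Union>\<Sigma>"
    using fan zero_in_fan by (auto simp: smooth_fan_def)
  have span: "fiber r \<subseteq> pm.span (b ` {..<m})"
  proof
    fix f :: "(nat, 'k) mpoly" assume f: "f \<in> fiber r"
    show "f \<in> pm.span (b ` {..<m})"
    proof (cases "f = 0")
      case False
      then show ?thesis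
        using khovanskii_span[OF E K zero f] pm.span_mono[of "{x \<in> b ` {..<m}. v f 0 \<le> v x 0}" "b ` {..<m}"] by blast
    qed (simp add: pm.span_zero)
  qed
  have "\<exists>\<beta>. adapted_valuation r (\<lambda>f. v f (\<rho> i)) \<beta> \<and> (\<forall>k<r. \<exists>z::int. v (\<beta> k) (\<rho> i) = ereal (of_int z))" if i: "i < n" for i
  proof -
    note ray = ray_generator_in_fan[OF ray[OF i]]
    obtain \<beta> where \<beta>: "adapted_valuation r (\<lambda>f. v f (\<rho> i)) \<beta>"
      "\<And>k. k < r \<Longrightarrow> \<exists>\<phi>. integral_linear_on N (convex_cone hull {\<rho> i}) \<phi> \<and> v (\<beta> k) (\<rho> i) = ereal (\<phi> (\<rho> i))"
      using adapted_valuation_at[OF E ray(1,2)] by metis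
    have "\<exists>z::int. v (\<beta> k) (\<rho> i) = ereal (of_int z)" if k: "k < r" for k
    proof -
      obtain \<phi> where \<phi>: "integral_linear_on N (convex_cone hull {\<rho> i}) \<phi>" "v (\<beta> k) (\<rho> i) = ereal (\<phi> (\<rho> i))"
        using \<beta>(2)[OF k] by blast
      then have "\<phi> (\<rho> i) \<in> \<int>"
        using ray(2,3) by (fastforce simp: integral_linear_on_def)
      then show ?thesis using \<phi>(2) by (auto elim!: Ints_cases)
    qed
    then show ?thesis using \<beta>(1) by blast
  qed
  then obtain \<beta> where \<beta>: "\<And>i. i < n \<Longrightarrow> adapted_valuation r (\<lambda>f. v f (\<rho> i)) (\<beta> i)"
    "\<And>i k. i < n \<Longrightarrow> k < r \<Longrightarrow> \<exists>z::int. v (\<beta> i k) (\<rho> i) = ereal (of_int z)"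
    by metis
  have "uniform_bundle n m d D (\<lambda>k j. M $$ (k, j)) r (\<lambda>i f. v f (\<rho> i)) b \<beta>"
  proof (intro uniform_bundle.intro generic_relations.intro uniform_bundle_axioms.intro)
    show "0 \<le> D i j" if "i < n" "j < m" for i j using norm that by blast
    show "generic_matrix d m (\<lambda>k j. M $$ (k, j))" by (rule all_minors_nonzero_imp_generic[OF M])
    show "adapted_valuation r (\<lambda>f. v f (\<rho> i)) (\<beta> i)" if "i < n" for i by (rule \<beta>(1)[OF that])
    show "\<exists>z::int. v (\<beta> i k) (\<rho> i) = ereal (of_int z)" if "i < n" "k < r" for i k by (rule \<beta>(2)[OF that])
    show "b j \<in> fiber r" if "j < m" for j by (rule b(1)[OF that])
    show "v (b j) (\<rho> i) = ereal (of_int (D i j))" if "i < n" "j < m" for i j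
      unfolding D using \<rho>_fan[OF that(1)] b[OF that(2)] by (intro diagram_value[OF E]) (auto intro: fiber_Sym)
    show "fiber r \<subseteq> pm.span (b ` {..<m})" by (rule span)
    show "f \<in> pm.span {x \<in> b ` {..<m}. v f (\<rho> i) \<le> v x (\<rho> i)}" if "i < n" "f \<in> fiber r" "f \<noteq> 0" for i f
      by (rule khovanskii_span[OF E K \<rho>_fan(1)[OF that(1)] that(2,3)])
    show "(\<Sum>j<m. pscale (x j) (b j)) = 0 \<longleftrightarrow> (\<exists>y. \<forall>j<m. x j = (\<Sum>k<d. y k * M $$ (k, j)))" for x
      by (rule relations_iff_row_space[OF gen])
    show "r + d = m" using rank_bound[OF E zero span] d by simp
    show "\<exists>j<m. D i j = 0" if "i < n" for i using norm that by blast
  qed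
  then show ?thesis by (rule exI[of _ \<beta>])
qed

context uniform_bundle
begin

lemma hall_condition_iff:
  "hall_condition \<longleftrightarrow> (\<forall>A. A \<noteq> {} \<and> A \<subseteq> {..<n} \<longrightarrow>
     int (card {j. j < m \<and> (\<exists>i\<in>A. D i j \<noteq> 0)}) \<le> int r + int (card A) - 2)"
proof -
  have "d + 2 \<le> card (zcols A) + card A \<longleftrightarrow> int (card {j. j < m \<and> (\<exists>i\<in>A. D i j \<noteq> 0)}) \<le> int r + int (card A) - 2" for A
  proof -
    have "{j. j < m \<and> (\<exists>i\<in>A. D i j \<noteq> 0)} = {..<m} - zcols A" by (auto simp: zcols_def)
    then have "card {j. j < m \<and> (\<exists>i\<in>A. D i j \<noteq> 0)} = m - card (zcols A)"
      using zcols_bound[of A] by (simp add: card_Diff_subset)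
    moreover have "card (zcols A) \<le> m" using card_mono[OF _ zcols_bound[of A]] by simp
    ultimately show ?thesis using rank by linarith
  qed
  then show ?thesis by (simp add: hall_condition_def)
qed

end

theorem corollary6p5:
  fixes N :: "'v::real_vector set" and \<Sigma> :: "'v set set" and \<rho> :: "nat \<Rightarrow> 'v"
    and n r m d :: nat
    and v :: "(nat, 'k::alg_closed_field) mpoly \<Rightarrow> 'v \<Rightarrow> ereal"
    and b :: "nat \<Rightarrow> (nat, 'k) mpoly" and M :: "'k mat"
    and D :: "nat \<Rightarrow> nat \<Rightarrow> int"
  assumes "smooth_fan N \<Sigma>"
    and "bij_betw \<rho> {..<n} (ray_generators N \<Sigma>)"
    and "toric_vector_bundle N \<Sigma> r v"
    and "uniform_witness \<Sigma> r v m b d M"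
    and "d = m - r"
    and D_def: "D = diagram v \<rho> b"
    and "\<forall>i<n. (\<forall>j<m. 0 \<le> D i j) \<and> (\<exists>j<m. D i j = 0)"
  shows "(Phi n D b ` pring (XY n m) = cox_ring n r v \<rho> \<and>
          {f \<in> pring (XY n m). Phi n D b f = 0}
            = Idl\<^bsub>ring_on (pring (XY n m))\<^esub> (homogenized_relation n D m M ` {..<d}))
     \<longleftrightarrow> (\<forall>A. A \<noteq> {} \<and> A \<subseteq> {..<n} \<longrightarrow>
            int (card {j. j < m \<and> (\<exists>i\<in>A. D i j \<noteq> 0)}) \<le> int r + int (card A) - 2)"
proof -
  obtain \<beta> where "uniform_bundle n m d D (\<lambda>k j. M $$ (k, j)) r (\<lambda>i f. v f (\<rho> i)) b \<beta>"
    using uniform_bundle_of_toric[OF assms(1-5) D_def assms(7)] by blast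
  then interpret uniform_bundle n m d D "\<lambda>k j. M $$ (k, j)" r "\<lambda>i f. v f (\<rho> i)" b \<beta> .
  have "homogenized_relation n D m M k = rel k" if k: "k < d" for k
  proof -
    have "row_min D m M k i = 0" if i: "i < n" for i
    proof -
      have eq: "{D i j | j. j < m \<and> M $$ (k, j) \<noteq> 0} = D i ` {..<m}"
        using generic_matrix_entry[OF generic k] by auto
      obtain j where "j < m" "D i j = 0" using row_zero[OF i] by blast
      then show ?thesis
        unfolding row_min_def eq using D_nonneg[OF i] by (intro Min_eqI) (auto intro!: image_eqI[of _ _ j])
    qed
    then show ?thesis
      by (simp add: homogenized_relation_def rel_def colmon_def pscale_eq)
  qed
  then have rels: "homogenized_relation n D m M ` {..<d} = rel ` {..<d}"
    by (intro image_cong) auto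
  have ideal: "Idl\<^bsub>ring_on (pring (XY n m))\<^esub> (rel ` {..<d}) = pring (XY n m) \<inter> idl.span (rel ` {..<d})"
    using rel_P by (intro Idl_pring) auto
  have cox: "cox_ring n r v \<rho> = cox"
    by (simp add: cox_ring_def cox_def)
  show ?thesis
    unfolding rels ideal cox Phi_eq_stratum_subst hall_condition_iff[symmetric]
    using presentation_if_hall hall_if_presentation by blast
qed

end
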